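(* Let $L>0$ and $D\in(0,L)$, and let $\omega>0$ be the smallest positive solution of the transcendental equation $$\cos\left(\frac{\omega D}{2}\right)=\frac{\omega(L-D)}{2}\,\sin\left(\frac{\omega D}{2}\right).$$ Then: (i) for every connected, compact metric graph $\mathcal{G}$ with a finite number of edges, total length $L$ and diameter $D$, one has $\mu_2(\mathcal{G})>\omega^2$ (so equality is never attained on any fixed graph); (ii) $\omega^2$ satisfies the two-sided bound $$\frac{1}{LD}<\omega^2<\frac{12}{LD};$$ (iii) there is a sequence of such graphs $\mathcal{D}_n$, each of total length $L$ and diameter $D$, such that $\mu_2(\mathcal{D}_n)\to\omega^2$ as $n\to\infty$.
   Context: A compact metric graph $\mathcal{G}$ with finitely many edges is obtained from finitely many intervals $[0,\ell_e]$, $0<\ell_e<\infty$ (the edges $e$) by identifying endpoints (the vertices); loops and multiple parallel edges are allowed. Its total length is $L=\sum_e\ell_e$, and its diameter is $D=\sup\{\operatorname{dist}(x,y):x,y\in\mathcal{G}\}$, where $\operatorname{dist}$ is the shortest-path distance in $\mathcal{G}$ (all points of $\mathcal{G}$, not only vertices, are considered). $H^1(\mathcal{G})$ is the space of continuous functions on $\mathcal{G}$ which are in $H^1$ on each edge. The Laplacian with natural (continuity and Kirchhoff) vertex conditions is the operator associated with the form $\int_{\mathcal{G}}f'g'\,dx=\sum_e\int_e f'g'\,dx$ on $H^1(\mathcal{G})$; its eigenvalues, repeated according to multiplicity, are $0=\mu_1(\mathcal{G})<\mu_2(\mathcal{G})\le\mu_3(\mathcal{G})\le\dots$, and $$\mu_2(\mathcal{G})=\inf\left\{\frac{\int_{\mathcal{G}}|f'|^2dx}{\int_{\mathcal{G}}|f|^2dx}:0\ne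 f\in H^1(\mathcal{G}),\ \int_{\mathcal{G}}f\,dx=0\right\}.$$ *)

theory Defs
  imports "HOL-Analysis.Analysis"
begin

section \<open>Compact metric graphs\<close>

text \<open>
  The edge \<open>e\<close> is the interval \<open>{0..len G e}\<close>; its endpoints \<open>0\<close> and \<open>len G e\<close> are attached to the
  vertices \<open>src G e\<close> and \<open>tgt G e\<close>. Loops and parallel edges are allowed. The orientation only serves
  to parametrise edges. There is no separate vertex set: vertices are the classes of identified
  endpoints.
\<close>

record ('v, 'e) metric_graph =
  edges :: "'e set"
  len :: "'e \<Rightarrow> real"
  src :: "'e \<Rightarrow> 'v"
  tgt :: "'e \<Rightarrow> 'v"

definition compact_metric_graph :: "('v, 'e) metric_graph \<Rightarrow> bool" where
  "compact_metric_graph G \<longleftrightarrow> finite (edges G) \<and> (\<forall>e\<in>edges G. 0 < len G e)"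

text \<open>
  The graph as a space is the quotient of the disjoint union of the edges \<open>mg_points G\<close> by the
  equivalence relation \<open>glued G\<close>. We work with representatives \<open>(e, t)\<close> instead of classes.
\<close>

definition mg_points :: "('v, 'e) metric_graph \<Rightarrow> ('e \<times> real) set" where
  "mg_points G = (SIGMA e:edges G. {0..len G e})"

definition endpoint_at :: "('v, 'e) metric_graph \<Rightarrow> 'v \<Rightarrow> ('e \<times> real) \<Rightarrow> bool" where
  "endpoint_at G v x \<longleftrightarrow> (\<exists>e\<in>edges G. x = (e, 0) \<and> src G e = v \<or> x = (e, len G e) \<and> tgt G e = v)"

definition glued :: "('v, 'e) metric_graph \<Rightarrow> ('e \<times> real) \<Rightarrow> ('e \<times> real) \<Rightarrow> bool" where
  "glued G x y \<longleftrightarrow> x = y \<or> (\<exists>v. endpoint_at G v x \<and> endpoint_at G v y)"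

text \<open>
  \<open>mg_path G x r y\<close>: there is a path of length \<open>r\<close> in the graph from \<open>x\<close> to \<open>y\<close>, composed of finitely
  many segments, each lying in one edge.
\<close>

inductive mg_path :: "('v, 'e) metric_graph \<Rightarrow> ('e \<times> real) \<Rightarrow> real \<Rightarrow> ('e \<times> real) \<Rightarrow> bool"
  for G :: "('v, 'e) metric_graph" and x :: "'e \<times> real" where
  start: "x \<in> mg_points G \<Longrightarrow> mg_path G x 0 x"
| segment: "mg_path G x r (e, s) \<Longrightarrow> t \<in> {0..len G e} \<Longrightarrow> mg_path G x (r + \<bar>t - s\<bar>) (e, t)"
| glue: "mg_path G x r y \<Longrightarrow> glued G y z \<Longrightarrow> mg_path G x r z"

definition mg_connected :: "('v, 'e) metric_graph \<Rightarrow> bool" where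
  "mg_connected G \<longleftrightarrow> (\<forall>x\<in>mg_points G. \<forall>y\<in>mg_points G. \<exists>r. mg_path G x r y)"

definition mg_dist :: "('v, 'e) metric_graph \<Rightarrow> ('e \<times> real) \<Rightarrow> ('e \<times> real) \<Rightarrow> real" where
  "mg_dist G x y = Inf {r. mg_path G x r y}"

definition total_length :: "('v, 'e) metric_graph \<Rightarrow> real" where
  "total_length G = (\<Sum>e\<in>edges G. len G e)"

definition mg_diameter :: "('v, 'e) metric_graph \<Rightarrow> real" where
  "mg_diameter G = (SUP (x, y)\<in>mg_points G \<times> mg_points G. mg_dist G x y)"


section \<open>The Sobolev space and the Laplacian with natural vertex conditions\<close>

text \<open>
  \<open>H1_interval l u u'\<close>: the continuous function \<open>u\<close> belongs to \<open>H\<^sup>1\<close> of the interval \<open>{0..l}\<close>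
  and \<open>u'\<close> is (a Borel representative of) its derivative, i.e. \<open>u\<close> is absolutely continuous, being
  the indefinite integral of the square-integrable function \<open>u'\<close>. The derivative is determined only
  up to null sets, hence the relational form.
\<close>

definition H1_interval :: "real \<Rightarrow> (real \<Rightarrow> real) \<Rightarrow> (real \<Rightarrow> real) \<Rightarrow> bool" where
  "H1_interval l u u' \<longleftrightarrow>
     set_borel_measurable lborel {0..l} u' \<and>
     set_integrable lborel {0..l} (\<lambda>t. (u' t)\<^sup>2) \<and>
     (\<forall>s\<in>{0..l}. u s = u 0 + (LBINT t:{0..s}. u' t))"

text \<open>
  \<open>H1_graph G f f'\<close>: \<open>f\<close> belongs to \<open>H\<^sup>1\<close> of the graph, with edgewise derivative \<open>f'\<close>. Compatibility
  with \<open>glued\<close> makes \<open>f\<close> a function on the quotient; its continuity there then amounts to continuity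
  on every edge, which \<open>H1_interval\<close> entails.
\<close>

definition H1_graph ::
  "('v, 'e) metric_graph \<Rightarrow> ('e \<times> real \<Rightarrow> real) \<Rightarrow> ('e \<times> real \<Rightarrow> real) \<Rightarrow> bool" where
  "H1_graph G f f' \<longleftrightarrow>
     (\<forall>x\<in>mg_points G. \<forall>y\<in>mg_points G. glued G x y \<longrightarrow> f x = f y) \<and>
     (\<forall>e\<in>edges G. H1_interval (len G e) (\<lambda>t. f (e, t)) (\<lambda>t. f' (e, t)))"

definition mg_integral :: "('v, 'e) metric_graph \<Rightarrow> ('e \<times> real \<Rightarrow> real) \<Rightarrow> real" where
  "mg_integral G f = (\<Sum>e\<in>edges G. LBINT t:{0..len G e}. f (e, t))"

text \<open>
  Members of the eigenspace (including \<open>0\<close>) of the operator associated with the form: that operator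
  maps \<open>f\<close> to \<open>h\<close> iff \<open>\<integral> f' g' = \<integral> h g\<close> for all \<open>g\<close> in the form domain; here \<open>h = \<kappa> f\<close>.
\<close>

definition in_eigenspace ::
  "('v, 'e) metric_graph \<Rightarrow> real \<Rightarrow> ('e \<times> real \<Rightarrow> real) \<Rightarrow> bool" where
  "in_eigenspace G \<kappa> f \<longleftrightarrow>
     (\<exists>f'. H1_graph G f f' \<and>
        (\<forall>g g'. H1_graph G g g' \<longrightarrow>
           mg_integral G (\<lambda>x. f' x * g' x) = \<kappa> * mg_integral G (\<lambda>x. f x * g x)))"

definition lin_indep_on :: "('e \<times> real) set \<Rightarrow> nat \<Rightarrow> (nat \<Rightarrow> 'e \<times> real \<Rightarrow> real) \<Rightarrow> bool" where
  "lin_indep_on X k f \<longleftrightarrow>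
     (\<forall>c. (\<forall>x\<in>X. (\<Sum>i<k. c i * f i x) = 0) \<longrightarrow> (\<forall>i<k. c i = (0::real)))"

text \<open>
  The \<open>k\<close>-th eigenvalue, \<open>k \<ge> 1\<close>, in the increasing enumeration repeated according to multiplicity:
  the least \<open>\<kappa>\<close> such that the eigenvalues up to \<open>\<kappa>\<close>, counted with multiplicity, number at least \<open>k\<close>.
\<close>

definition mg_eigenvalue :: "('v, 'e) metric_graph \<Rightarrow> nat \<Rightarrow> real" where
  "mg_eigenvalue G k =
     Inf {\<kappa>. \<exists>\<nu> f. (\<forall>i<k. \<nu> i \<le> \<kappa> \<and> in_eigenspace G (\<nu> i) (f i)) \<and> lin_indep_on (mg_points G) k f}"

end

theory Submission
  imports Defs "HOL-Complex_Analysis.Great_Picard"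
begin

text \<open>
  Lower bound. A minimiser \<open>f\<close> of the Rayleigh quotient exists by compactness. Let \<open>c\<close> be the mean of
  its maximum and its minimum and \<open>M\<close> half their difference, so that \<open>g = f - c\<close> has values in
  \<open>[-M, M]\<close> and runs from \<open>-M\<close> to \<open>M\<close> along a shortest path of length at most \<open>D\<close>. On that path
  \<open>\<integral> (g'\<^sup>2 - \<omega>\<^sup>2 g\<^sup>2)\<close> is bounded below by a calibration, off the path by \<open>- \<omega>\<^sup>2 M\<^sup>2\<close> times the remaining
  length, and the equation for \<open>\<omega>\<close> says that the two bounds cancel. Equality would make \<open>f\<close> a nonzero
  constant on some interval off the path, which an eigenfunction is not.

  Sharpness. Two bunches of many short edges, attached to the ends of an interval, act in the limit as
  point masses \<open>(L - D) / 2\<close>; the test function is a sine on the interval and constant on the bunches.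
\<close>

section \<open>Absolutely continuous functions on an interval\<close>

text \<open>The equation for \<omega> says that sin(\<omega> \<tau>) on [-D/2, D/2] is an odd
  eigenfunction of a string with a point mass (L - D)/2 at each end: u'(D/2) = \<omega>^2 (L - D)/2
  u(D/2). The graph is compared with this string through integrals, so a path that retraces part of
  an edge would count it twice; hence paths are replaced by trails, whose arcs have disjoint
  interiors. The distance is an infimum over arbitrary paths: the replacement must not lengthen
  them, and since trails have only finitely many arc sets, a shortest one exists. Minimality of
  \<omega> supplies \<omega> D < pi, which keeps the calibration away from the zeros of the cosine.
  Eigenvalues are defined by counting eigenfunctions, not by Rayleigh quotients. The minimiser is
  therefore needed as an eigenfunction, both to identify the second eigenvalue and to exclude
  equality. The shift by c does no harm: f has mean zero, so the shift can only increase the norm. A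
  trail shorter than D is completed by letting g rest at the value M for the missing time.\<close>

definition AC_on :: "real \<Rightarrow> real \<Rightarrow> (real \<Rightarrow> real) \<Rightarrow> (real \<Rightarrow> real) \<Rightarrow> bool" where
  "AC_on a b u u' \<longleftrightarrow>
     set_integrable lborel {a..b} u' \<and> (\<forall>s\<in>{a..b}. u s = u a + (LBINT t:{a..s}. u' t))"

lemma AC_on_integrable: "AC_on a b u u' \<Longrightarrow> set_integrable lborel {a..b} u'"
  by (simp add: AC_on_def)

lemma AC_on_eq: "AC_on a b u u' \<Longrightarrow> s \<in> {a..b} \<Longrightarrow> u s = u a + (LBINT t:{a..s}. u' t)"
  unfolding AC_on_def by blast

lemma AC_on_integrable_sub:
  "AC_on a b u u' \<Longrightarrow> a \<le> c \<Longrightarrow> d \<le> b \<Longrightarrow> set_integrable lborel {c..d} u'"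
  unfolding AC_on_def by (intro set_integrable_subset[of _ "{a..b}" _ "{c..d}"]) simp_all

lemma set_integral_combine_Icc:
  fixes f :: "real \<Rightarrow> real"
  assumes "a \<le> c" "c \<le> b" "set_integrable lborel {a..b} f"
  shows "(LBINT t:{a..b}. f t) = (LBINT t:{a..c}. f t) + (LBINT t:{c..b}. f t)"
proof -
  have 1: "set_integrable lborel {a..c} f" "set_integrable lborel {c..b} f"
    by (rule set_integrable_subset[OF assms(3)]; use assms in auto)+
  show ?thesis
    using assms 1
    by (simp add: set_borel_integral_eq_integral Henstock_Kurzweil_Integration.integral_combine)
qed

lemma set_integral_Ioo_eq_Icc:
  fixes f :: "real \<Rightarrow> real"
  shows "(LBINT t:{a<..<b}. f t) = (LBINT t:{a..b}. f t)"
  by (rule set_integral_discrete_difference[where X="{a,b}"]) auto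

lemma set_integrable_mult_continuous:
  fixes f g :: "real \<Rightarrow> real"
  assumes "set_integrable lborel {a..b} f" "continuous_on {a..b} g"
  shows "set_integrable lborel {a..b} (\<lambda>t. f t * g t)"
proof -
  have "bounded (g ` {a..b})"
    using compact_imp_bounded[OF compact_continuous_image[OF assms(2) compact_Icc]] .
  then obtain B where B: "\<forall>t\<in>{a..b}. \<bar>g t\<bar> \<le> B"
    by (auto simp: bounded_iff)
  have g: "(\<lambda>t. indicator {a..b} t * g t) \<in> borel_measurable lborel"
    using borel_integrable_atLeastAtMost'[OF assms(2)]
    by (auto simp: set_integrable_def dest: borel_measurable_integrable)
  have f: "(\<lambda>t. indicator {a..b} t * f t) \<in> borel_measurable lborel"
    using assms(1) by (auto simp: set_integrable_def dest: borel_measurable_integrable)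
  show ?thesis
    unfolding set_integrable_def
  proof (rule Bochner_Integration.integrable_bound)
    show "integrable lborel (\<lambda>t. B * \<bar>indicator {a..b} t * f t\<bar>)"
      using assms(1) by (intro integrable_mult_right integrable_abs) (auto simp: set_integrable_def)
    have "(\<lambda>t. indicator {a..b} t * (f t * g t)) =
        (\<lambda>t. (indicator {a..b} t * f t) * (indicator {a..b} t * g t))"
      by (auto split: split_indicator)
    then show "(\<lambda>t. indicator {a..b} t *\<^sub>R (f t * g t)) \<in> borel_measurable lborel"
      using borel_measurable_times[OF f g] by simp
    have "norm (indicator {a..b} t *\<^sub>R (f t * g t)) \<le> norm (B * \<bar>indicator {a..b} t * f t\<bar>)" for t
    proof (cases "t \<in> {a..b}")
      case True
      then have "\<bar>g t\<bar> * \<bar>f t\<bar> \<le> \<bar>B\<bar> * \<bar>f t\<bar>"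
        using B by (intro mult_right_mono) force+
      then show ?thesis using True by (simp add: abs_mult mult.commute)
    qed simp
    then show "AE t in lborel. norm (indicator {a..b} t *\<^sub>R (f t * g t)) \<le> norm (B * \<bar>indicator {a..b} t * f t\<bar>)"
      by (intro AE_I2)
  qed
qed

lemma AC_on_continuous:
  assumes "AC_on a b u u'"
  shows "continuous_on {a..b} u"
proof -
  have "continuous_on {a..b} (\<lambda>s. u a + integral {a..s} u')"
    by (intro continuous_intros indefinite_integral_continuous_1 set_borel_integral_eq_integral(1)
        AC_on_integrable[OF assms])
  moreover have "u a + integral {a..s} u' = u s" if "s \<in> {a..b}" for s
    using AC_on_eq[OF assms that] AC_on_integrable_sub[OF assms, of a s] that
    by (simp add: set_borel_integral_eq_integral)
  ultimately show ?thesis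
    by (rule continuous_on_eq)
qed

lemma AC_on_diff_eq:
  assumes "AC_on a b u u'" "a \<le> s" "s \<le> t" "t \<le> b"
  shows "(LBINT x:{s..t}. u' x) = u t - u s"
proof -
  have i: "set_integrable lborel {a..t} u'"
    using assms by (intro AC_on_integrable_sub[OF assms(1)]) auto
  have "u t = u a + (LBINT t:{a..t}. u' t)" "u s = u a + (LBINT t:{a..s}. u' t)"
    by (rule AC_on_eq[OF assms(1)]; use assms in force)+
  moreover have "(LBINT t:{a..t}. u' t) = (LBINT t:{a..s}. u' t) + (LBINT t:{s..t}. u' t)"
    using assms by (intro set_integral_combine_Icc i)
  ultimately show ?thesis by linarith
qed

lemma AC_on_cong:
  assumes eq: "\<And>t. t \<in> {a..b} \<Longrightarrow> u t = v t" and "a \<le> b" and u: "AC_on a b u u'"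
  shows "AC_on a b v u'"
  unfolding AC_on_def
proof (intro conjI ballI)
  show "set_integrable lborel {a..b} u'" by (rule AC_on_integrable[OF u])
  show "v s = v a + (LBINT t:{a..s}. u' t)" if "s \<in> {a..b}" for s
    using AC_on_eq[OF u that] eq[OF that] eq[of a] \<open>a \<le> b\<close> by simp
qed

lemma AC_on_subset:
  assumes "AC_on a b u u'" "a \<le> c" "d \<le> b"
  shows "AC_on c d u u'"
  unfolding AC_on_def
proof (intro conjI ballI)
  show "set_integrable lborel {c..d} u'"
    using assms by (intro AC_on_integrable_sub[OF assms(1)])
  show "u s = u c + (LBINT x:{c..s}. u' x)" if "s \<in> {c..d}" for s
    using AC_on_diff_eq[OF assms(1), of c s] assms(2,3) that by auto
qed

lemma AC_on_add:
  assumes "AC_on a b u u'" "AC_on a b v v'"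
  shows "AC_on a b (\<lambda>t. u t + v t) (\<lambda>t. u' t + v' t)"
  unfolding AC_on_def
proof (intro conjI ballI)
  show "set_integrable lborel {a..b} (\<lambda>t. u' t + v' t)"
    using assms by (intro set_integral_add(1) AC_on_integrable)
  fix s assume s: "s \<in> {a..b}"
  have "(LBINT t:{a..s}. u' t + v' t) = (LBINT t:{a..s}. u' t) + (LBINT t:{a..s}. v' t)"
    using s by (intro set_integral_add(2) AC_on_integrable_sub[OF assms(1)] AC_on_integrable_sub[OF assms(2)]) auto
  then show "u s + v s = u a + v a + (LBINT t:{a..s}. u' t + v' t)"
    using AC_on_eq[OF assms(1) s] AC_on_eq[OF assms(2) s] by linarith
qed

lemma AC_on_C1:
  assumes "\<And>x. x \<in> {a..b} \<Longrightarrow> (F has_real_derivative f x) (at x within {a..b})"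
    and "continuous_on {a..b} f"
  shows "AC_on a b F f"
  unfolding AC_on_def
proof (intro conjI ballI)
  show "set_integrable lborel {a..b} f"
    using assms(2) by (rule borel_integrable_atLeastAtMost')
  fix s assume s: "s \<in> {a..b}"
  have "(LBINT t:{a..s}. f t) = F s - F a"
    unfolding set_lebesgue_integral_def
  proof (rule integral_FTC_atLeastAtMost)
    fix x assume "a \<le> x" "x \<le> s"
    then show "(F has_vector_derivative f x) (at x within {a..s})"
      using s by (auto simp: has_real_derivative_iff_has_vector_derivative[symmetric]
          intro!: DERIV_subset[OF assms(1)])
  qed (use s in \<open>auto intro: continuous_on_subset[OF assms(2)]\<close>)
  then show "F s = F a + (LBINT t:{a..s}. f t)" by simp
qed

text \<open>Fubini on the two triangles into which the diagonal divides the square.\<close>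

lemma integral_by_parts_Fubini:
  fixes p q :: "real \<Rightarrow> real"
  assumes ip: "integrable lborel p" and iq: "integrable lborel q"
  shows "(\<integral>x. p x * (LBINT y:{..x}. q y) \<partial>lborel) + (\<integral>x. q x * (LBINT y:{..x}. p y) \<partial>lborel)
    = (\<integral>x. p x \<partial>lborel) * (\<integral>x. q x \<partial>lborel)"
proof -
  have [measurable]: "p \<in> borel_measurable borel" "q \<in> borel_measurable borel"
    using ip iq by (auto dest: borel_measurable_integrable)
  have prod: "integrable (lborel \<Otimes>\<^sub>M lborel) (\<lambda>(x,y). p x * q y)"
    by (rule lborel_pair.Fubini_integrable) (use ip iq in \<open>auto simp: abs_mult\<close>)
  have i1: "integrable (lborel \<Otimes>\<^sub>M lborel) (\<lambda>(x,y). p x * (indicator {..x} y * q y))"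
    by (rule Bochner_Integration.integrable_bound[OF prod])
       (auto split: split_indicator simp: indicator_def intro!: borel_measurable_times)
  have i2: "integrable (lborel \<Otimes>\<^sub>M lborel) (\<lambda>(x,y). (indicator {..<y} x * p x) * q y)"
    by (rule Bochner_Integration.integrable_bound[OF prod])
       (auto split: split_indicator simp: indicator_def intro!: borel_measurable_times)
  have "(\<integral>x. p x \<partial>lborel) * (\<integral>x. q x \<partial>lborel) = (\<integral>x. \<integral>y. p x * q y \<partial>lborel \<partial>lborel)"
    by simp
  also have "\<dots> = integral\<^sup>L (lborel \<Otimes>\<^sub>M lborel) (\<lambda>(x,y). p x * q y)"
    using lborel_pair.integral_fst'[OF prod] by simp
  also have "\<dots> = integral\<^sup>L (lborel \<Otimes>\<^sub>M lborel) (\<lambda>z. (\<lambda>(x,y). p x * (indicator {..x} y * q y)) z +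
      (\<lambda>(x,y). (indicator {..<y} x * p x) * q y) z)"
    by (rule Bochner_Integration.integral_cong) (auto split: split_indicator)
  also have "\<dots> = integral\<^sup>L (lborel \<Otimes>\<^sub>M lborel) (\<lambda>(x,y). p x * (indicator {..x} y * q y)) +
      integral\<^sup>L (lborel \<Otimes>\<^sub>M lborel) (\<lambda>(x,y). (indicator {..<y} x * p x) * q y)"
    using i1 i2 by (rule Bochner_Integration.integral_add)
  also have "integral\<^sup>L (lborel \<Otimes>\<^sub>M lborel) (\<lambda>(x,y). p x * (indicator {..x} y * q y)) =
      (\<integral>x. p x * (LBINT y:{..x}. q y) \<partial>lborel)"
    using lborel_pair.integral_fst'[OF i1] by (simp add: set_lebesgue_integral_def)
  also have "integral\<^sup>L (lborel \<Otimes>\<^sub>M lborel) (\<lambda>(x,y). (indicator {..<y} x * p x) * q y) =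
      (\<integral>y. (LBINT x:{..<y}. p x) * q y \<partial>lborel)"
    using lborel_pair.integral_snd[OF i2] by (simp add: set_lebesgue_integral_def)
  also have "\<dots> = (\<integral>y. q y * (LBINT x:{..y}. p x) \<partial>lborel)"
  proof (rule Bochner_Integration.integral_cong)
    fix y :: real
    have "(LBINT x:{..<y}. p x) = (LBINT x:{..y}. p x)"
      by (rule set_integral_discrete_difference[where X="{y}"]) auto
    then show "(LBINT x:{..<y}. p x) * q y = q y * (LBINT x:{..y}. p x)" by simp
  qed simp
  finally show ?thesis by simp
qed

text \<open>Apply the Fubini identity to the derivatives cut off to [a, s]: there their primitives
  are u - u(a) and v - v(a), and the boundary values rearrange to the product rule.
  Square-integrability is kept out of \<open>AC_on\<close> and carried separately, so that it need
  not be followed through composite expressions.\<close>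

lemma AC_on_mult:
  assumes u: "AC_on a b u u'" and v: "AC_on a b v v'"
  shows "AC_on a b (\<lambda>t. u t * v t) (\<lambda>t. u' t * v t + v' t * u t)"
  unfolding AC_on_def
proof (intro conjI ballI)
  have iu: "set_integrable lborel {a..b} (\<lambda>t. u' t * v t)"
    and iv: "set_integrable lborel {a..b} (\<lambda>t. v' t * u t)"
    using set_integrable_mult_continuous[OF AC_on_integrable[OF u] AC_on_continuous[OF v]]
      set_integrable_mult_continuous[OF AC_on_integrable[OF v] AC_on_continuous[OF u]] by simp_all
  then show "set_integrable lborel {a..b} (\<lambda>t. u' t * v t + v' t * u t)" by simp
  fix s assume s: "s \<in> {a..b}"
  have sub: "set_integrable lborel {a..s} f" if "set_integrable lborel {a..b} f" for f :: "real \<Rightarrow> real"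
    by (rule set_integrable_subset[OF that]) (use s in auto)
  define p q where "p = (\<lambda>t. indicator {a..s} t * u' t)" and "q = (\<lambda>t. indicator {a..s} t * v' t)"
  have ip: "integrable lborel p" and iq: "integrable lborel q"
    using sub[OF AC_on_integrable[OF u]] sub[OF AC_on_integrable[OF v]]
    unfolding set_integrable_def p_def q_def by auto
  have P: "(LBINT y:{..x}. p y) = u x - u a" "(LBINT y:{..x}. q y) = v x - v a" if "x \<in> {a..s}" for x
  proof -
    have "(LBINT y:{..x}. p y) = (LBINT y:{a..x}. u' y)" "(LBINT y:{..x}. q y) = (LBINT y:{a..x}. v' y)"
      using that by (auto simp: set_lebesgue_integral_def p_def q_def
          intro!: Bochner_Integration.integral_cong split: split_indicator)
    then show "(LBINT y:{..x}. p y) = u x - u a" "(LBINT y:{..x}. q y) = v x - v a"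
      using AC_on_diff_eq[OF u, of a x] AC_on_diff_eq[OF v, of a x] that s by auto
  qed
  have Q: "integral\<^sup>L lborel p = u s - u a" "integral\<^sup>L lborel q = v s - v a"
    using AC_on_diff_eq[OF u, of a s] AC_on_diff_eq[OF v, of a s] s
    by (auto simp: set_lebesgue_integral_def p_def q_def)
  have "(\<integral>x. p x * (LBINT y:{..x}. q y) \<partial>lborel) = (LBINT t:{a..s}. u' t * v t - u' t * v a)"
    unfolding set_lebesgue_integral_def[of lborel "{a..s}"]
    by (rule Bochner_Integration.integral_cong) (auto simp: P p_def algebra_simps split: split_indicator)
  also have "\<dots> = (LBINT t:{a..s}. u' t * v t) - (u s - u a) * v a"
    using AC_on_diff_eq[OF u, of a s] s sub[OF iu] sub[OF AC_on_integrable[OF u]]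
    by (subst set_integral_diff) auto
  finally have 1: "(\<integral>x. p x * (LBINT y:{..x}. q y) \<partial>lborel) = \<dots>" .
  have "(\<integral>x. q x * (LBINT y:{..x}. p y) \<partial>lborel) = (LBINT t:{a..s}. v' t * u t - v' t * u a)"
    unfolding set_lebesgue_integral_def[of lborel "{a..s}"]
    by (rule Bochner_Integration.integral_cong) (auto simp: P q_def algebra_simps split: split_indicator)
  also have "\<dots> = (LBINT t:{a..s}. v' t * u t) - (v s - v a) * u a"
    using AC_on_diff_eq[OF v, of a s] s sub[OF iv] sub[OF AC_on_integrable[OF v]]
    by (subst set_integral_diff) auto
  finally have 2: "(\<integral>x. q x * (LBINT y:{..x}. p y) \<partial>lborel) = \<dots>" .
  have "(LBINT t:{a..s}. u' t * v t + v' t * u t) = (LBINT t:{a..s}. u' t * v t) + (LBINT t:{a..s}. v' t * u t)"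
    using sub iu iv by simp
  then show "u s * v s = u a * v a + (LBINT t:{a..s}. u' t * v t + v' t * u t)"
    using integral_by_parts_Fubini[OF ip iq] unfolding 1 2 Q by (simp add: algebra_simps)
qed

section \<open>Square-integrable derivatives\<close>

text \<open>Riesz-Fischer with plain integrals. A subsequence of geometric speed converges almost
  everywhere, and Fatou turns this into convergence in mean of the whole sequence. It provides the
  derivative of the Rayleigh minimiser.\<close>

lemma L2_complete:
  fixes f :: "nat \<Rightarrow> 'a \<Rightarrow> real"
  assumes [measurable]: "\<And>n. f n \<in> borel_measurable M"
    and int: "\<And>n. integrable M (\<lambda>x. (f n x)\<^sup>2)"
    and Cauchy: "\<And>e. 0 < e \<Longrightarrow> \<exists>N. \<forall>m\<ge>N. \<forall>n\<ge>N. (\<integral>x. (f m x - f n x)\<^sup>2 \<partial>M) < e"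
  obtains g where "g \<in> borel_measurable M" "integrable M (\<lambda>x. (g x)\<^sup>2)"
    "(\<lambda>n. \<integral>x. (f n x - g x)\<^sup>2 \<partial>M) \<longlonglongrightarrow> 0"
proof -
  have sq_le: "(x - y)\<^sup>2 \<le> 2 * x\<^sup>2 + 2 * y\<^sup>2" for x y :: real
    using zero_le_power2[of "x + y"] by (simp add: power2_eq_square algebra_simps)
  have intd: "integrable M (\<lambda>x. (f m x - f n x)\<^sup>2)" for m n
    by (rule Bochner_Integration.integrable_bound[where f="\<lambda>x. 2 * (f m x)\<^sup>2 + 2 * (f n x)\<^sup>2"])
       (use int sq_le in \<open>auto intro!: AE_I2 order_trans[OF sq_le]\<close>)
  \<comment> \<open>With the rate 1/8, the integrals weighted by 2^k below are still at most (1/4)^k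
    and hence summable.\<close>
  have "\<exists>r. \<forall>n. (\<forall>i\<ge>r n. \<forall>j\<ge> r n. (\<integral>x. (f i x - f j x)\<^sup>2 \<partial>M) < (1 / 8) ^ n) \<and> (r (Suc n) > r n)"
  proof (intro dependent_nat_choice, goal_cases)
    case 1
    then show ?case using Cauchy[of 1] by auto
  next
    case (2 x n)
    obtain N where *: "(\<integral>x. (f i x - f j x)\<^sup>2 \<partial>M) < (1 / 8) ^ Suc n" if "i \<ge> N" "j \<ge> N" for i j
      using Cauchy[of "(1 / 8) ^ Suc n"] by auto
    show ?case
      by (intro exI[of _ "max N (Suc x)"] conjI allI impI *) auto
  qed
  then obtain r where r: "\<And>n i j. i \<ge> r n \<Longrightarrow> j \<ge> r n \<Longrightarrow> (\<integral>x. (f i x - f j x)\<^sup>2 \<partial>M) < (1 / 8) ^ n"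
    and "strict_mono r"
    using strict_mono_Suc_iff by blast
  define d where "d k x = f (r (Suc k)) x - f (r k) x" for k x
  have [measurable]: "d k \<in> borel_measurable M" for k
    unfolding d_def by measurable
  have "(\<integral>\<^sup>+x. (\<Sum>k. ennreal (2 ^ k * (d k x)\<^sup>2)) \<partial>M) = (\<Sum>k. \<integral>\<^sup>+x. ennreal (2 ^ k * (d k x)\<^sup>2) \<partial>M)"
    by (rule nn_integral_suminf) measurable
  also have "\<dots> \<le> (\<Sum>k. ennreal ((1/4) ^ k))"
  proof (rule suminf_le)
    fix k
    have "(\<integral>\<^sup>+x. ennreal (2 ^ k * (d k x)\<^sup>2) \<partial>M) = ennreal (\<integral>x. 2 ^ k * (d k x)\<^sup>2 \<partial>M)"
      by (rule nn_integral_eq_integral) (auto simp: d_def intd)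
    also have "(\<integral>x. 2 ^ k * (d k x)\<^sup>2 \<partial>M) \<le> 2 ^ k * (1/8) ^ k"
      using r[of k "r (Suc k)" "r k"] strict_mono_mono[OF \<open>strict_mono r\<close>]
      by (auto simp: d_def mono_def intro!: mult_left_mono)
    also have "2 ^ k * (1/8) ^ k = (1/4 :: real) ^ k"
      by (simp add: power_mult_distrib[symmetric])
    finally show "(\<integral>\<^sup>+x. ennreal (2 ^ k * (d k x)\<^sup>2) \<partial>M) \<le> ennreal ((1/4) ^ k)"
      by (simp add: ennreal_leI)
  qed auto
  also have "\<dots> = ennreal (\<Sum>k. (1/4) ^ k)"
    by (rule suminf_ennreal2) (auto intro: summable_geometric)
  also have "\<dots> < \<infinity>" by simp
  finally have "AE x in M. (\<Sum>k. ennreal (2 ^ k * (d k x)\<^sup>2)) < \<infinity>"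
    by (intro finite_nn_integral_imp_ae_finite) measurable
  then have conv: "AE x in M. convergent (\<lambda>k. f (r k) x)"
  proof eventually_elim
    case (elim x)
    then have "summable (\<lambda>k. 2 ^ k * (d k x)\<^sup>2)"
      by (intro summable_suminf_not_top) auto
    then have "summable (\<lambda>k. (2 ^ k * (d k x)\<^sup>2 + (1/2) ^ k) / 2)"
      by (intro summable_divide summable_add summable_geometric) auto
    then have "summable (\<lambda>k. d k x)"
    proof (rule summable_comparison_test'[where N = 0])
      fix k :: nat
      have p: "(2::real) ^ k * (1/2) ^ k = 1" by (simp add: power_mult_distrib[symmetric])
      \<comment> \<open>Expanding the square gives 2 |d| \<le> 2^k d^2 + 2^(-k), which dominates the
        increments by a summable sequence.\<close>
      have "0 \<le> (1/2) ^ k * (2 ^ k * \<bar>d k x\<bar> - 1)\<^sup>2" by simp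
      also have "\<dots> = (2 ^ k * (1/2) ^ k) * (2 ^ k * (d k x)\<^sup>2) - 2 * (2 ^ k * (1/2) ^ k) * \<bar>d k x\<bar> + (1/2) ^ k"
        by (simp add: power2_eq_square algebra_simps)
      finally show "norm (d k x) \<le> (2 ^ k * (d k x)\<^sup>2 + (1/2) ^ k) / 2"
        unfolding p by (simp del: power_one_over)
    qed
    then have "convergent (\<lambda>n. \<Sum>k<n. d k x)"
      by (simp add: summable_iff_convergent)
    then have "convergent (\<lambda>n. f (r 0) x + (\<Sum>k<n. d k x))"
      by (intro convergent_add convergent_const)
    moreover have "(\<Sum>k<n. d k x) = f (r n) x - f (r 0) x" for n
      unfolding d_def by (rule sum_lessThan_telescope)
    ultimately show ?case by simp
  qed
  define g where "g x = lim (\<lambda>k. f (r k) x)" for x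
  have [measurable]: "g \<in> borel_measurable M"
    unfolding g_def by measurable
  have lim: "AE x in M. (\<lambda>k. f (r k) x) \<longlonglongrightarrow> g x"
    using conv by eventually_elim (simp add: g_def convergent_LIMSEQ_iff)
  \<comment> \<open>Extended nonnegative integrals are used because the integrability of the squares
    involving \<open>g\<close> is itself drawn from this bound.\<close>
  have fatou: "(\<integral>\<^sup>+x. ennreal ((f n x - g x)\<^sup>2) \<partial>M) \<le> ennreal e"
    if N: "\<And>m n. m \<ge> N \<Longrightarrow> n \<ge> N \<Longrightarrow> (\<integral>x. (f m x - f n x)\<^sup>2 \<partial>M) < e" and "n \<ge> N" for n N e
  proof -
    have "(\<integral>\<^sup>+x. ennreal ((f n x - g x)\<^sup>2) \<partial>M) \<le> (\<integral>\<^sup>+x. liminf (\<lambda>k. ennreal ((f n x - f (r k) x)\<^sup>2)) \<partial>M)"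
    proof (rule nn_integral_mono_AE)
      show "AE x in M. ennreal ((f n x - g x)\<^sup>2) \<le> liminf (\<lambda>k. ennreal ((f n x - f (r k) x)\<^sup>2))"
        using lim
      proof eventually_elim
        case (elim x)
        then have L: "(\<lambda>k. ennreal ((f n x - f (r k) x)\<^sup>2)) \<longlonglongrightarrow> ennreal ((f n x - g x)\<^sup>2)"
          by (intro tendsto_ennrealI tendsto_intros)
        show ?case using lim_imp_Liminf[OF sequentially_bot L] by simp
      qed
    qed
    also have "\<dots> \<le> liminf (\<lambda>k. \<integral>\<^sup>+x. ennreal ((f n x - f (r k) x)\<^sup>2) \<partial>M)"
      by (rule nn_integral_liminf) measurable
    also have "\<dots> \<le> ennreal e"
    proof (rule Liminf_le)
      show "\<forall>\<^sub>F k in sequentially. (\<integral>\<^sup>+x. ennreal ((f n x - f (r k) x)\<^sup>2) \<partial>M) \<le> ennreal e"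
        unfolding eventually_sequentially
      proof (intro exI allI impI)
        fix k assume "N \<le> k"
        then have "N \<le> r k"
          using strict_mono_imp_increasing[OF \<open>strict_mono r\<close>, of k] by linarith
        have "(\<integral>\<^sup>+x. ennreal ((f n x - f (r k) x)\<^sup>2) \<partial>M) = ennreal (\<integral>x. (f n x - f (r k) x)\<^sup>2 \<partial>M)"
          by (rule nn_integral_eq_integral) (auto simp: intd)
        then show "(\<integral>\<^sup>+x. ennreal ((f n x - f (r k) x)\<^sup>2) \<partial>M) \<le> ennreal e"
          using N[OF \<open>n \<ge> N\<close> \<open>N \<le> r k\<close>] by (simp add: ennreal_leI)
      qed
    qed simp
    finally show ?thesis .
  qed
  have intg: "integrable M (\<lambda>x. (g x)\<^sup>2)"
  proof -
    obtain N where N: "\<And>m n. m \<ge> N \<Longrightarrow> n \<ge> N \<Longrightarrow> (\<integral>x. (f m x - f n x)\<^sup>2 \<partial>M) < 1"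
      using Cauchy[of 1] by auto
    have "(\<integral>\<^sup>+x. ennreal ((f N x - g x)\<^sup>2) \<partial>M) \<le> ennreal 1"
      by (rule fatou[OF N order_refl])
    also have "\<dots> < \<infinity>" by simp
    finally have "(\<integral>\<^sup>+x. ennreal ((f N x - g x)\<^sup>2) \<partial>M) < \<infinity>" .
    then have "integrable M (\<lambda>x. (f N x - g x)\<^sup>2)"
      by (intro integrableI_nonneg) auto
    then have "integrable M (\<lambda>x. 2 * (f N x)\<^sup>2 + 2 * (f N x - g x)\<^sup>2)"
      using int by auto
    then show ?thesis
      by (rule Bochner_Integration.integrable_bound)
         (use sq_le[of "f N x" "f N x - g x" for x] in \<open>auto intro!: AE_I2\<close>)
  qed
  have intfg: "integrable M (\<lambda>x. (f n x - g x)\<^sup>2)" for n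
    by (rule Bochner_Integration.integrable_bound[where f="\<lambda>x. 2 * (f n x)\<^sup>2 + 2 * (g x)\<^sup>2"])
       (use int intg sq_le in \<open>auto intro!: AE_I2 order_trans[OF sq_le]\<close>)
  have "(\<lambda>n. \<integral>x. (f n x - g x)\<^sup>2 \<partial>M) \<longlonglongrightarrow> 0"
  proof (rule LIMSEQ_I)
    fix e :: real assume "0 < e"
    then obtain N where N: "\<And>m n. m \<ge> N \<Longrightarrow> n \<ge> N \<Longrightarrow> (\<integral>x. (f m x - f n x)\<^sup>2 \<partial>M) < e / 2"
      using Cauchy[of "e / 2"] by auto
    show "\<exists>N. \<forall>n\<ge>N. norm ((\<integral>x. (f n x - g x)\<^sup>2 \<partial>M) - 0) < e"
    proof (intro exI allI impI)
      fix n assume "n \<ge> N"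
      have "ennreal (\<integral>x. (f n x - g x)\<^sup>2 \<partial>M) = (\<integral>\<^sup>+x. ennreal ((f n x - g x)\<^sup>2) \<partial>M)"
        by (rule nn_integral_eq_integral[symmetric]) (auto simp: intfg)
      also have "\<dots> \<le> ennreal (e / 2)"
        by (rule fatou[OF N \<open>n \<ge> N\<close>])
      finally show "norm ((\<integral>x. (f n x - g x)\<^sup>2 \<partial>M) - 0) < e"
        using \<open>0 < e\<close> by (simp add: ennreal_le_iff)
    qed
  qed
  then show ?thesis
    using that[of g] intg by simp
qed

text \<open>Cauchy-Schwarz against the constant 1, read off from the nonnegative integral of (f -
  m)^2 with m the mean of f. The degenerate interval is treated apart because m divides by the
  length.\<close>

lemma set_integral_square_le:
  fixes f :: "real \<Rightarrow> real"
  assumes "a \<le> b" "set_integrable lborel {a..b} f" "set_integrable lborel {a..b} (\<lambda>t. (f t)\<^sup>2)"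
  shows "(LBINT t:{a..b}. f t)\<^sup>2 \<le> (b - a) * (LBINT t:{a..b}. (f t)\<^sup>2)"
proof (cases "a = b")
  case True
  have "(LBINT t:{a..a}. f t) = 0"
    using set_integral_Ioo_eq_Icc[of a a f] by (simp add: set_lebesgue_integral_def)
  with True show ?thesis by simp
next
  case False
  define I J where "I = (LBINT t:{a..b}. f t)" and "J = (LBINT t:{a..b}. (f t)\<^sup>2)"
  define m where "m = I / (b - a)"
  have c: "set_integrable lborel {a..b} (\<lambda>t. m\<^sup>2)" by (intro borel_integrable_atLeastAtMost') simp
  have "0 \<le> (LBINT t:{a..b}. (f t - m)\<^sup>2)"
    unfolding set_lebesgue_integral_def by (intro Bochner_Integration.integral_nonneg) auto
  also have "\<dots> = (LBINT t:{a..b}. ((f t)\<^sup>2 - 2 * m * f t) + m\<^sup>2)"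
    by (intro set_lebesgue_integral_cong) (auto simp: power2_eq_square algebra_simps)
  also have "\<dots> = J - 2 * m * I + m\<^sup>2 * (b - a)"
    using assms c by (simp add: I_def J_def set_integral_diff set_lebesgue_integral_def[of _ _ "\<lambda>_. m\<^sup>2"])
  finally have "0 \<le> (J - 2 * m * I + m\<^sup>2 * (b - a)) * (b - a)"
    using assms False by simp
  also have "\<dots> = (b - a) * J - 2 * I * (m * (b - a)) + (m * (b - a))\<^sup>2"
    by (simp add: power2_eq_square algebra_simps)
  also have "m * (b - a) = I"
    using False by (simp add: m_def)
  finally show ?thesis by (simp add: I_def J_def power2_eq_square)
qed

lemma set_integral_mono_set_nonneg:
  fixes f :: "real \<Rightarrow> real"
  assumes "set_integrable lborel B f" "A \<subseteq> B" "A \<in> sets lborel" "\<And>t. t \<in> B \<Longrightarrow> 0 \<le> f t"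
  shows "(LBINT t:A. f t) \<le> (LBINT t:B. f t)"
  unfolding set_lebesgue_integral_def
proof (rule integral_mono)
  show "integrable lborel (\<lambda>t. indicator A t *\<^sub>R f t)" "integrable lborel (\<lambda>t. indicator B t *\<^sub>R f t)"
    using assms(1) set_integrable_subset[OF assms(1,3,2)] by (auto simp: set_integrable_def)
  show "indicator A t *\<^sub>R f t \<le> indicator B t *\<^sub>R f t" for t
    using assms by (auto split: split_indicator)
qed

text \<open>The increment is the integral of u', to which Cauchy-Schwarz applies. The resulting
  modulus depends on the energy alone, which makes minimising sequences equicontinuous; with energy
  zero it forces u to be constant.\<close>

lemma AC_on_Hoelder:
  assumes u: "AC_on a b u u'" and sq: "set_integrable lborel {a..b} (\<lambda>t. (u' t)\<^sup>2)"
    and "s \<in> {a..b}" "t \<in> {a..b}"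
  shows "(u t - u s)\<^sup>2 \<le> \<bar>t - s\<bar> * (LBINT x:{a..b}. (u' x)\<^sup>2)"
proof -
  have *: "(u t - u s)\<^sup>2 \<le> (t - s) * (LBINT x:{a..b}. (u' x)\<^sup>2)"
    if st: "a \<le> s" "s \<le> t" "t \<le> b" for s t
  proof -
    have "set_integrable lborel {s..t} (\<lambda>t. (u' t)\<^sup>2)"
      by (rule set_integrable_subset[OF sq]) (use st in auto)
    then have "(LBINT x:{s..t}. u' x)\<^sup>2 \<le> (t - s) * (LBINT x:{s..t}. (u' x)\<^sup>2)"
      using st by (intro set_integral_square_le AC_on_integrable_sub[OF u]) auto
    also have "\<dots> \<le> (t - s) * (LBINT x:{a..b}. (u' x)\<^sup>2)"
      using st sq by (intro mult_left_mono set_integral_mono_set_nonneg) auto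
    finally show ?thesis
      using AC_on_diff_eq[OF u st] by simp
  qed
  show ?thesis
  proof (cases "s \<le> t")
    case True
    then show ?thesis using *[of s t] assms by auto
  next
    case False
    then show ?thesis using *[of t s] assms by (auto simp: power2_commute)
  qed
qed

text \<open>
  The function \<open>cal \<omega> a z \<tau>\<close> solves the Hamilton--Jacobi equation \<open>\<partial>\<^sub>\<tau> V + (\<partial>\<^sub>z V)\<^sup>2 / 4 + \<omega>\<^sup>2 z\<^sup>2 = 0\<close>
  of the functional \<open>\<integral> (u'\<^sup>2 - \<omega>\<^sup>2 u\<^sup>2)\<close>; it is the calibration belonging to the extremals
  \<open>z = a sin (\<omega> \<tau>)\<close>.
\<close>

definition cal :: "real \<Rightarrow> real \<Rightarrow> real \<Rightarrow> real \<Rightarrow> real" where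
  "cal \<omega> a z \<tau> = \<omega> * (2 * a * z / cos (\<omega> * \<tau>) - tan (\<omega> * \<tau>) * (z\<^sup>2 + a\<^sup>2))"

text \<open>The t-derivative of V(u(t), \<tau> + \<sigma> t), with V =
  \<open>cal \<omega> a\<close>, multiplied by \<sigma>, falls short of the integrand by a perfect
  square. The sign \<sigma> lets time run with or against the parametrisation of an edge; the bound
  on the angle keeps its cosine positive.\<close>

lemma cal_le_integral:
  assumes u: "AC_on \<alpha> \<beta> u u'" and sq: "set_integrable lborel {\<alpha>..\<beta>} (\<lambda>t. (u' t)\<^sup>2)"
    and le: "\<alpha> \<le> \<beta>" and \<sigma>: "\<sigma>\<^sup>2 = 1"
    and T: "\<And>t. t \<in> {\<alpha>..\<beta>} \<Longrightarrow> \<bar>\<omega> * (\<tau> + \<sigma> * t)\<bar> < pi / 2"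
  shows "\<sigma> * (cal \<omega> a (u \<beta>) (\<tau> + \<sigma> * \<beta>) - cal \<omega> a (u \<alpha>) (\<tau> + \<sigma> * \<alpha>))
    \<le> (LBINT t:{\<alpha>..\<beta>}. (u' t)\<^sup>2 - \<omega>\<^sup>2 * (u t)\<^sup>2)"
proof -
  define C S where "C t = cos (\<omega> * (\<tau> + \<sigma> * t))" and "S t = sin (\<omega> * (\<tau> + \<sigma> * t))" for t
  have Cpos: "C t > 0" if "t \<in> {\<alpha>..\<beta>}" for t
    using T[OF that] unfolding C_def by (intro cos_gt_zero_pi) linarith+
  have CS: "(S t)\<^sup>2 + (C t)\<^sup>2 = 1" for t by (simp add: C_def S_def)
  have dC: "(C has_real_derivative - (\<omega> * \<sigma> * S t)) (at t within X)" for t X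
    unfolding C_def S_def by (auto intro!: derivative_eq_intros)
  have dS: "(S has_real_derivative \<omega> * \<sigma> * C t) (at t within X)" for t X
    unfolding C_def S_def by (auto intro!: derivative_eq_intros)
  have cont: "continuous_on X C" "continuous_on X S" for X
    unfolding C_def S_def by (auto intro!: continuous_intros)
  have tanAC: "AC_on \<alpha> \<beta> (\<lambda>t. k * (S t / C t)) (\<lambda>t. k * \<omega> * \<sigma> / (C t)\<^sup>2)" for k
  proof (rule AC_on_C1)
    fix t assume t: "t \<in> {\<alpha>..\<beta>}"
    have "k * ((\<omega> * \<sigma> * C t * C t - S t * (- (\<omega> * \<sigma> * S t))) / (C t * C t)) = k * \<omega> * \<sigma> * ((S t)\<^sup>2 + (C t)\<^sup>2) / (C t)\<^sup>2"
      by (simp add: power2_eq_square algebra_simps)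
    then show "((\<lambda>t. k * (S t / C t)) has_real_derivative k * \<omega> * \<sigma> / (C t)\<^sup>2) (at t within {\<alpha>..\<beta>})"
      using DERIV_cmult[OF DERIV_divide[OF dS dC], of t k "{\<alpha>..\<beta>}"] Cpos[OF t] CS[of t] by simp
  qed (use Cpos in \<open>auto intro!: continuous_intros cont simp: less_imp_neq[symmetric]\<close>)
  have secAC: "AC_on \<alpha> \<beta> (\<lambda>t. k / C t) (\<lambda>t. k * \<omega> * \<sigma> * S t / (C t)\<^sup>2)" for k
  proof (rule AC_on_C1)
    fix t assume t: "t \<in> {\<alpha>..\<beta>}"
    show "((\<lambda>t. k / C t) has_real_derivative k * \<omega> * \<sigma> * S t / (C t)\<^sup>2) (at t within {\<alpha>..\<beta>})"
      using DERIV_divide[OF DERIV_const[of k] dC, of t "{\<alpha>..\<beta>}"] Cpos[OF t]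
      by (simp add: power2_eq_square algebra_simps)
  qed (use Cpos in \<open>auto intro!: continuous_intros cont simp: less_imp_neq[symmetric]\<close>)
  define G where "G t = cal \<omega> a (u t) (\<tau> + \<sigma> * t)" for t
  \<comment> \<open>The derivative exactly as the sum and product rules assemble it, so that those
    rules alone give the absolute continuity of \<open>G\<close>.\<close>
  define G' where "G' t = ((u' t * u t + u' t * u t) * (- \<omega> * (S t / C t)) + - \<omega> * \<omega> * \<sigma> / (C t)\<^sup>2 * (u t * u t)) +
     (u' t * (2 * a * \<omega> / C t) + 2 * a * \<omega> * \<omega> * \<sigma> * S t / (C t)\<^sup>2 * u t) + - (a\<^sup>2 * \<omega>) * \<omega> * \<sigma> / (C t)\<^sup>2" for t
  have Geq: "(\<lambda>t. ((u t * u t) * (- \<omega> * (S t / C t)) + u t * (2 * a * \<omega> / C t)) + - (a\<^sup>2 * \<omega>) * (S t / C t)) = G"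
    by (simp add: fun_eq_iff G_def cal_def C_def S_def tan_def power2_eq_square algebra_simps add_divide_distrib)
  have AC: "AC_on \<alpha> \<beta> G G'"
    unfolding Geq[symmetric] G'_def
    by (intro AC_on_add AC_on_mult u tanAC secAC)
  have "\<sigma> * (G \<beta> - G \<alpha>) = (LBINT t:{\<alpha>..\<beta>}. \<sigma> * G' t)"
    using AC_on_diff_eq[OF AC, of \<alpha> \<beta>] le by simp
  also have "\<dots> \<le> (LBINT t:{\<alpha>..\<beta>}. (u' t)\<^sup>2 - \<omega>\<^sup>2 * (u t)\<^sup>2)"
  proof (rule set_integral_mono)
    show "set_integrable lborel {\<alpha>..\<beta>} (\<lambda>t. \<sigma> * G' t)"
      using AC_on_integrable[OF AC] by simp
    show "set_integrable lborel {\<alpha>..\<beta>} (\<lambda>t. (u' t)\<^sup>2 - \<omega>\<^sup>2 * (u t)\<^sup>2)"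
      by (intro set_integral_diff(1)[OF sq] borel_integrable_atLeastAtMost' continuous_intros AC_on_continuous[OF u])
    fix t assume t: "t \<in> {\<alpha>..\<beta>}"
    \<comment> \<open>Half the z-derivative of \<open>cal\<close>, that is, the slope of the field
      of extremals: on z = a sin(\<omega> \<tau>) it equals a \<omega> cos(\<omega> \<tau>).\<close>
    define W where "W = \<omega> * (a - u t * S t) / C t"
    have c0: "C t \<noteq> 0" using Cpos[OF t] by simp
    have s2: "\<sigma> * \<sigma> = 1" using \<sigma> by (simp add: power2_eq_square)
    have "\<sigma> * G' t = 2 * \<sigma> * u' t * W - (\<sigma> * \<sigma>) * \<omega>\<^sup>2 * ((u t)\<^sup>2 + a\<^sup>2 - 2 * a * u t * S t) / (C t)\<^sup>2"
      using c0 by (simp add: G'_def W_def field_simps power2_eq_square)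
    moreover have "W\<^sup>2 = \<omega>\<^sup>2 * (a\<^sup>2 - 2 * a * u t * S t + (u t)\<^sup>2 * (1 - (C t)\<^sup>2)) / (C t)\<^sup>2"
    proof -
      have "(a - u t * S t)\<^sup>2 = a\<^sup>2 - 2 * a * u t * S t + (u t)\<^sup>2 * (S t)\<^sup>2"
        by (simp add: power2_eq_square algebra_simps)
      also have "(S t)\<^sup>2 = 1 - (C t)\<^sup>2" using CS[of t] by simp
      finally show ?thesis
        by (simp add: W_def power_divide power_mult_distrib)
    qed
    then have "W\<^sup>2 = \<omega>\<^sup>2 * ((u t)\<^sup>2 + a\<^sup>2 - 2 * a * u t * S t) / (C t)\<^sup>2 - \<omega>\<^sup>2 * (u t)\<^sup>2"
      using c0 by (simp add: field_simps)
    ultimately have "(u' t)\<^sup>2 - \<omega>\<^sup>2 * (u t)\<^sup>2 - \<sigma> * G' t = (u' t)\<^sup>2 - 2 * \<sigma> * u' t * W + W\<^sup>2"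
      unfolding s2 by simp
    also have "\<dots> = (u' t - \<sigma> * W)\<^sup>2"
      using \<sigma> by (simp add: power2_diff power_mult_distrib)
    finally show "\<sigma> * G' t \<le> (u' t)\<^sup>2 - \<omega>\<^sup>2 * (u t)\<^sup>2"
      by (metis diff_ge_0_iff_ge zero_le_power2)
  qed
  finally show ?thesis by (simp add: G_def)
qed

section \<open>The form and the norm on a graph\<close>

lemma set_integrable_mult_of_squares:
  fixes f g :: "real \<Rightarrow> real"
  assumes "set_borel_measurable lborel A f" "set_borel_measurable lborel A g"
    and "set_integrable lborel A (\<lambda>t. (f t)\<^sup>2)" "set_integrable lborel A (\<lambda>t. (g t)\<^sup>2)"
  shows "set_integrable lborel A (\<lambda>t. f t * g t)"
  unfolding set_integrable_def
proof (rule Bochner_Integration.integrable_bound)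
  show "integrable lborel (\<lambda>t. indicator A t *\<^sub>R (f t)\<^sup>2 + indicator A t *\<^sub>R (g t)\<^sup>2)"
    using assms(3,4) unfolding set_integrable_def by (rule Bochner_Integration.integrable_add)
  have "(\<lambda>t. indicator A t *\<^sub>R f t * (indicator A t *\<^sub>R g t)) \<in> borel_measurable lborel"
    using assms(1,2) unfolding set_borel_measurable_def by (rule borel_measurable_times)
  moreover have "(\<lambda>t. indicator A t *\<^sub>R f t * (indicator A t *\<^sub>R g t)) = (\<lambda>t. indicator A t *\<^sub>R (f t * g t))"
    by (auto split: split_indicator)
  ultimately show "(\<lambda>t. indicator A t *\<^sub>R (f t * g t)) \<in> borel_measurable lborel" by simp
  have "\<bar>x * y\<bar> \<le> x\<^sup>2 + y\<^sup>2" for x y :: real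
  proof -
    have "2 * (\<bar>x\<bar> * \<bar>y\<bar>) \<le> x\<^sup>2 + y\<^sup>2"
      using zero_le_power2[of "\<bar>x\<bar> - \<bar>y\<bar>"] by (simp add: power2_diff)
    moreover have "0 \<le> \<bar>x\<bar> * \<bar>y\<bar>" by simp
    ultimately show ?thesis unfolding abs_mult by linarith
  qed
  then show "AE t in lborel. norm (indicator A t *\<^sub>R (f t * g t))
      \<le> norm (indicator A t *\<^sub>R (f t)\<^sup>2 + indicator A t *\<^sub>R (g t)\<^sup>2)"
    by (intro AE_I2) (auto split: split_indicator)
qed

lemma set_borel_measurable_of_integrable:
  "set_integrable M A f \<Longrightarrow> set_borel_measurable M A f"
  by (simp add: set_integrable_def set_borel_measurable_def borel_measurable_integrable)

text \<open>On a bounded interval a square-integrable function is integrable, by pairing it with 1.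
  All later work on H1 goes through this form.\<close>

lemma H1_interval_iff:
  "H1_interval l u u' \<longleftrightarrow> AC_on 0 l u u' \<and> set_integrable lborel {0..l} (\<lambda>t. (u' t)\<^sup>2)"
proof -
  have "set_integrable lborel {0..l} u'"
    if "set_borel_measurable lborel {0..l} u'" "set_integrable lborel {0..l} (\<lambda>t. (u' t)\<^sup>2)"
  proof -
    have 1: "set_integrable lborel {0..l} (\<lambda>t. 1 :: real)"
      by (intro borel_integrable_atLeastAtMost') simp
    then show ?thesis
      using set_integrable_mult_of_squares[OF that(1) set_borel_measurable_of_integrable[OF 1] that(2)] by simp
  qed
  then show ?thesis
    unfolding H1_interval_def AC_on_def using set_borel_measurable_of_integrable by blast
qed

text \<open>One class for functions and for their edgewise derivatives, so that norm and energy are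
  values of the same bilinear form \<open>mg_inner\<close>. Everything is restricted to the edges,
  since values elsewhere are arbitrary.\<close>

definition L2_graph :: "('v, 'e) metric_graph \<Rightarrow> ('e \<times> real \<Rightarrow> real) \<Rightarrow> bool" where
  "L2_graph G h \<longleftrightarrow> (\<forall>e\<in>edges G.
     set_borel_measurable lborel {0..len G e} (\<lambda>t. h (e, t)) \<and>
     set_integrable lborel {0..len G e} (\<lambda>t. (h (e, t))\<^sup>2))"

definition mg_inner :: "('v, 'e) metric_graph \<Rightarrow> ('e \<times> real \<Rightarrow> real) \<Rightarrow> ('e \<times> real \<Rightarrow> real) \<Rightarrow> real" where
  "mg_inner G f g = mg_integral G (\<lambda>x. f x * g x)"

lemma L2_graph_mult:
  assumes "L2_graph G f" "L2_graph G g" "e \<in> edges G"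
  shows "set_integrable lborel {0..len G e} (\<lambda>t. f (e, t) * g (e, t))"
  using assms unfolding L2_graph_def by (intro set_integrable_mult_of_squares) auto

lemma L2_graph_continuous:
  assumes "\<And>e. e \<in> edges G \<Longrightarrow> continuous_on {0..len G e} (\<lambda>t. f (e, t))"
  shows "L2_graph G f"
  unfolding L2_graph_def
proof (intro ballI conjI)
  fix e assume e: "e \<in> edges G"
  show "set_borel_measurable lborel {0..len G e} (\<lambda>t. f (e, t))"
    by (intro set_borel_measurable_of_integrable borel_integrable_atLeastAtMost' assms e)
  show "set_integrable lborel {0..len G e} (\<lambda>t. (f (e, t))\<^sup>2)"
    by (intro borel_integrable_atLeastAtMost' continuous_intros assms e)
qed

lemma L2_graph_const: "L2_graph G (\<lambda>x. c)"
  by (rule L2_graph_continuous) simp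

lemma L2_graph_scale:
  assumes "L2_graph G f"
  shows "L2_graph G (\<lambda>x. c * f x)"
  unfolding L2_graph_def
proof (intro ballI conjI)
  fix e assume e: "e \<in> edges G"
  have "(\<lambda>t. c * (indicator {0..len G e} t *\<^sub>R f (e, t))) \<in> borel_measurable lborel"
    using assms e by (intro borel_measurable_times) (auto simp: L2_graph_def set_borel_measurable_def)
  then show "set_borel_measurable lborel {0..len G e} (\<lambda>t. c * f (e, t))"
    by (simp add: set_borel_measurable_def mult_ac)
  show "set_integrable lborel {0..len G e} (\<lambda>t. (c * f (e, t))\<^sup>2)"
    using assms e by (auto simp: L2_graph_def power_mult_distrib)
qed

lemma L2_graph_add:
  assumes "L2_graph G f" "L2_graph G g"
  shows "L2_graph G (\<lambda>x. f x + g x)"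
  unfolding L2_graph_def
proof (intro ballI conjI)
  fix e assume e: "e \<in> edges G"
  have "(\<lambda>t. indicator {0..len G e} t *\<^sub>R f (e, t) + indicator {0..len G e} t *\<^sub>R g (e, t)) \<in> borel_measurable lborel"
    using assms e by (intro borel_measurable_add) (auto simp: L2_graph_def set_borel_measurable_def)
  then show "set_borel_measurable lborel {0..len G e} (\<lambda>t. f (e, t) + g (e, t))"
    by (simp add: set_borel_measurable_def algebra_simps)
  have "set_integrable lborel {0..len G e} (\<lambda>t. ((f (e, t))\<^sup>2 + (g (e, t))\<^sup>2) + 2 * (f (e, t) * g (e, t)))"
    using assms e L2_graph_mult[OF assms e] by (intro set_integral_add(1)) (auto simp: L2_graph_def)
  then show "set_integrable lborel {0..len G e} (\<lambda>t. (f (e, t) + g (e, t))\<^sup>2)"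
    by (simp add: power2_sum mult.assoc)
qed

lemma L2_graph_diff:
  assumes "L2_graph G f" "L2_graph G g"
  shows "L2_graph G (\<lambda>x. f x - g x)"
  using L2_graph_add[OF assms(1) L2_graph_scale[OF assms(2), of "-1"]] by simp

lemma mg_inner_commute: "mg_inner G f g = mg_inner G g f"
  by (simp add: mg_inner_def mult.commute)

lemma mg_inner_scale_left: "mg_inner G (\<lambda>x. c * f x) g = c * mg_inner G f g"
  by (simp add: mg_inner_def mg_integral_def mult.assoc sum_distrib_left)

lemma mg_inner_scale_right: "mg_inner G f (\<lambda>x. c * g x) = c * mg_inner G f g"
  using mg_inner_scale_left[of G c g f] by (simp add: mg_inner_commute)

lemma mg_inner_add_left:
  assumes "L2_graph G f" "L2_graph G g" "L2_graph G h"
  shows "mg_inner G (\<lambda>x. f x + g x) h = mg_inner G f h + mg_inner G g h"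
  unfolding mg_inner_def mg_integral_def sum.distrib[symmetric]
  using assms by (intro sum.cong) (simp_all add: distrib_right L2_graph_mult)

lemma mg_inner_add_right:
  assumes "L2_graph G f" "L2_graph G g" "L2_graph G h"
  shows "mg_inner G h (\<lambda>x. f x + g x) = mg_inner G h f + mg_inner G h g"
  using mg_inner_add_left[OF assms] by (simp add: mg_inner_commute)

lemma mg_inner_diff_left:
  assumes "L2_graph G f" "L2_graph G g" "L2_graph G h"
  shows "mg_inner G (\<lambda>x. f x - g x) h = mg_inner G f h - mg_inner G g h"
  using mg_inner_add_left[OF assms(1) L2_graph_scale[OF assms(2), of "-1"] assms(3)]
    mg_inner_scale_left[of G "-1" g h] by simp

lemma mg_inner_diff_right:
  assumes "L2_graph G f" "L2_graph G g" "L2_graph G h"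
  shows "mg_inner G h (\<lambda>x. f x - g x) = mg_inner G h f - mg_inner G h g"
  using mg_inner_diff_left[OF assms] by (simp add: mg_inner_commute)

lemma mg_inner_nonneg: "0 \<le> mg_inner G f f"
  unfolding mg_inner_def mg_integral_def set_lebesgue_integral_def
  by (intro sum_nonneg Bochner_Integration.integral_nonneg) auto

lemma mg_inner_square_add:
  assumes "L2_graph G f" "L2_graph G g"
  shows "mg_inner G (\<lambda>x. f x + g x) (\<lambda>x. f x + g x) = mg_inner G f f + 2 * mg_inner G f g + mg_inner G g g"
  using assms by (simp add: mg_inner_add_left mg_inner_add_right L2_graph_add mg_inner_commute[of G g f])

lemma mg_inner_square_diff:
  assumes "L2_graph G f" "L2_graph G g"
  shows "mg_inner G (\<lambda>x. f x - g x) (\<lambda>x. f x - g x) = mg_inner G f f - 2 * mg_inner G f g + mg_inner G g g"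
  using assms by (simp add: mg_inner_diff_left mg_inner_diff_right L2_graph_diff mg_inner_commute[of G g f])

text \<open>A nonzero linear term beats the quadratic one for small t of the opposite sign; t = - X
  / K with a positive K above Y is small enough. This is the first variation at a minimum.\<close>

lemma quadratic_nonneg_imp:
  fixes X Y :: real
  assumes "\<And>t. 0 \<le> 2 * t * X + t\<^sup>2 * Y"
  shows "X = 0"
proof (rule ccontr)
  assume "X \<noteq> 0"
  define K where "K = \<bar>Y\<bar> + 1"
  have K: "K > 0" "Y < K" by (auto simp: K_def)
  have "0 \<le> 2 * (- X / K) * X + (- X / K)\<^sup>2 * Y" by (rule assms)
  also have "\<dots> \<le> 2 * (- X / K) * X + (- X / K)\<^sup>2 * K"
    using K by (intro add_left_mono mult_left_mono) auto
  also have "\<dots> = - (X\<^sup>2 / K)"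
    using K by (simp add: power2_eq_square field_simps)
  also have "\<dots> < 0"
    using K \<open>X \<noteq> 0\<close> by simp
  finally show False by simp
qed

text \<open>The squared norm of f + t g is a nonnegative quadratic in t. The form is only
  semidefinite on this class, so a \<open>g\<close> of norm zero needs its own choice of t, one that
  gives the quadratic the value -1.\<close>

lemma mg_inner_Cauchy_Schwarz:
  assumes "L2_graph G f" "L2_graph G g"
  shows "(mg_inner G f g)\<^sup>2 \<le> mg_inner G f f * mg_inner G g g"
proof -
  have q: "0 \<le> mg_inner G f f + 2 * t * mg_inner G f g + t\<^sup>2 * mg_inner G g g" for t
    using mg_inner_nonneg[of G "\<lambda>x. f x + t * g x"] assms
    by (simp add: mg_inner_square_add L2_graph_scale mg_inner_scale_left mg_inner_scale_right power2_eq_square mult.assoc)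
  show ?thesis
  proof (cases "mg_inner G g g = 0")
    case True
    have "mg_inner G f g = 0"
    proof (rule ccontr)
      assume n: "mg_inner G f g \<noteq> 0"
      show False
        using q[of "- (mg_inner G f f + 1) / (2 * mg_inner G f g)"] n True by (simp add: field_simps)
    qed
    then show ?thesis using True by simp
  next
    case False
    then have p: "mg_inner G g g > 0" using mg_inner_nonneg[of G g] by simp
    have "0 \<le> mg_inner G g g * (mg_inner G f f + 2 * (- mg_inner G f g / mg_inner G g g) * mg_inner G f g
        + (- mg_inner G f g / mg_inner G g g)\<^sup>2 * mg_inner G g g)"
      using p q[of "- mg_inner G f g / mg_inner G g g"] by simp
    also have "\<dots> = mg_inner G f f * mg_inner G g g - (mg_inner G f g)\<^sup>2"
      using p by (simp add: power2_eq_square field_simps)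
    finally show ?thesis by simp
  qed
qed

text \<open>Cauchy-Schwarz applied to the differences. It carries the mean and the norm of a
  minimising sequence to its limit, and likewise the energy once the derivatives converge.\<close>

lemma mg_inner_tendsto:
  assumes F: "\<And>n. L2_graph G (F n)" and h: "L2_graph G h"
    and lim: "(\<lambda>n. mg_inner G (\<lambda>x. F n x - h x) (\<lambda>x. F n x - h x)) \<longlonglongrightarrow> 0"
    and g: "L2_graph G g"
  shows "(\<lambda>n. mg_inner G (F n) g) \<longlonglongrightarrow> mg_inner G h g"
    and "(\<lambda>n. mg_inner G (F n) (F n)) \<longlonglongrightarrow> mg_inner G h h"
proof -
  let ?d = "\<lambda>n x. F n x - h x"
  have *: "(\<lambda>n. mg_inner G (?d n) g) \<longlonglongrightarrow> 0" if g: "L2_graph G g" for g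
  proof (rule Lim_null_comparison)
    show "(\<lambda>n. sqrt (mg_inner G (?d n) (?d n) * mg_inner G g g)) \<longlonglongrightarrow> 0"
      using tendsto_real_sqrt[OF tendsto_mult_left_zero[OF lim, of "mg_inner G g g"]] by simp
    show "\<forall>\<^sub>F n in sequentially. norm (mg_inner G (?d n) g) \<le> sqrt (mg_inner G (?d n) (?d n) * mg_inner G g g)"
      using mg_inner_Cauchy_Schwarz[OF L2_graph_diff[OF F h] g] by (auto intro!: always_eventually real_le_rsqrt)
  qed
  have "(\<lambda>n. mg_inner G (?d n) g + mg_inner G h g) \<longlonglongrightarrow> 0 + mg_inner G h g"
    using *[OF g] by (intro tendsto_intros)
  then show "(\<lambda>n. mg_inner G (F n) g) \<longlonglongrightarrow> mg_inner G h g"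
    by (simp add: mg_inner_diff_left F h g)
  have "(\<lambda>n. mg_inner G (?d n) (?d n) + 2 * mg_inner G (?d n) h + mg_inner G h h) \<longlonglongrightarrow> 0 + 2 * 0 + mg_inner G h h"
    using *[OF h] lim by (intro tendsto_intros)
  then show "(\<lambda>n. mg_inner G (F n) (F n)) \<longlonglongrightarrow> mg_inner G h h"
    by (simp add: mg_inner_diff_left mg_inner_diff_right L2_graph_diff F h mg_inner_commute[of G h "F _"] algebra_simps)
qed

lemma mg_integral_eq_inner: "mg_integral G f = mg_inner G f (\<lambda>x. 1)"
  by (simp add: mg_inner_def)

lemma mg_integral_const:
  assumes "compact_metric_graph G"
  shows "mg_integral G (\<lambda>x. c) = c * total_length G"
  using assms by (auto simp: mg_integral_def total_length_def sum_distrib_left set_lebesgue_integral_def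
      compact_metric_graph_def intro!: sum.cong)

section \<open>The Sobolev space of the graph\<close>

lemma H1_graph_glued:
  "H1_graph G f f' \<Longrightarrow> x \<in> mg_points G \<Longrightarrow> y \<in> mg_points G \<Longrightarrow> glued G x y \<Longrightarrow> f x = f y"
  unfolding H1_graph_def by blast

lemma H1_graph_interval:
  "H1_graph G f f' \<Longrightarrow> e \<in> edges G \<Longrightarrow> H1_interval (len G e) (\<lambda>t. f (e, t)) (\<lambda>t. f' (e, t))"
  unfolding H1_graph_def by blast

lemma H1_graph_AC:
  assumes "H1_graph G f f'" "e \<in> edges G"
  shows "AC_on 0 (len G e) (\<lambda>t. f (e, t)) (\<lambda>t. f' (e, t))"
    and "set_integrable lborel {0..len G e} (\<lambda>t. (f' (e, t))\<^sup>2)"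
  using H1_graph_interval[OF assms] by (simp_all add: H1_interval_iff)

lemma H1_graph_continuous:
  assumes "H1_graph G f f'" "e \<in> edges G"
  shows "continuous_on {0..len G e} (\<lambda>t. f (e, t))"
  by (rule AC_on_continuous[OF H1_graph_AC(1)[OF assms]])

lemma H1_graph_L2:
  assumes "H1_graph G f f'"
  shows "L2_graph G f" "L2_graph G f'"
  using L2_graph_continuous[OF H1_graph_continuous[OF assms]] H1_graph_interval[OF assms]
  by (simp_all add: L2_graph_def H1_interval_def)

lemma H1_graph_const: "H1_graph G (\<lambda>x. c) (\<lambda>x. 0)"
  unfolding H1_graph_def H1_interval_iff
  by (intro conjI ballI impI AC_on_C1 borel_integrable_atLeastAtMost') simp_all

lemma H1_graph_add:
  assumes "H1_graph G f f'" "H1_graph G g g'"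
  shows "H1_graph G (\<lambda>x. f x + g x) (\<lambda>x. f' x + g' x)"
  unfolding H1_graph_def H1_interval_iff
proof (intro conjI ballI impI)
  show "f x + g x = f y + g y" if "x \<in> mg_points G" "y \<in> mg_points G" "glued G x y" for x y
    using H1_graph_glued[OF assms(1) that] H1_graph_glued[OF assms(2) that] by simp
  fix e assume e: "e \<in> edges G"
  show "AC_on 0 (len G e) (\<lambda>t. f (e, t) + g (e, t)) (\<lambda>t. f' (e, t) + g' (e, t))"
    by (intro AC_on_add H1_graph_AC(1)[OF assms(1) e] H1_graph_AC(1)[OF assms(2) e])
  show "set_integrable lborel {0..len G e} (\<lambda>t. (f' (e, t) + g' (e, t))\<^sup>2)"
    using L2_graph_add[OF H1_graph_L2(2)[OF assms(1)] H1_graph_L2(2)[OF assms(2)]] e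
    by (auto simp: L2_graph_def)
qed

lemma H1_graph_scale:
  assumes "H1_graph G f f'"
  shows "H1_graph G (\<lambda>x. c * f x) (\<lambda>x. c * f' x)"
  unfolding H1_graph_def H1_interval_iff
proof (intro conjI ballI impI)
  show "c * f x = c * f y" if "x \<in> mg_points G" "y \<in> mg_points G" "glued G x y" for x y
    using H1_graph_glued[OF assms that] by simp
  fix e assume e: "e \<in> edges G"
  have "AC_on 0 (len G e) (\<lambda>t. c) (\<lambda>t. 0)" by (intro AC_on_C1) auto
  from AC_on_mult[OF this H1_graph_AC(1)[OF assms e]]
  show "AC_on 0 (len G e) (\<lambda>t. c * f (e, t)) (\<lambda>t. c * f' (e, t))" by (simp add: mult.commute)
  show "set_integrable lborel {0..len G e} (\<lambda>t. (c * f' (e, t))\<^sup>2)"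
    using L2_graph_scale[OF H1_graph_L2(2)[OF assms]] e by (auto simp: L2_graph_def)
qed

text \<open>Continuity on edges of positive length upgrades vanishing in mean to vanishing at every
  point. Points matter because linear independence of eigenfunctions is expressed through values on
  \<open>mg_points G\<close>.\<close>

lemma mg_inner_eq_0_imp:
  assumes G: "compact_metric_graph G" and f: "H1_graph G f f'" and 0: "mg_inner G f f = 0"
    and x: "x \<in> mg_points G"
  shows "f x = 0"
proof -
  obtain e t where e: "x = (e, t)" "e \<in> edges G" "0 \<le> t" "t \<le> len G e"
    using x by (auto simp: mg_points_def)
  have c: "continuous_on {0..len G e} (\<lambda>t. f (e, t) * f (e, t))"
    by (intro continuous_intros H1_graph_continuous[OF f e(2)])
  have "(LBINT t:{0..len G e}. f (e, t) * f (e, t)) = 0"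
  proof -
    have "\<forall>e\<in>edges G. (LBINT t:{0..len G e}. f (e, t) * f (e, t)) = 0"
      using 0 G unfolding mg_inner_def mg_integral_def
      by (subst (asm) sum_nonneg_eq_0_iff)
         (auto simp: compact_metric_graph_def set_lebesgue_integral_def intro!: Bochner_Integration.integral_nonneg)
    with e show ?thesis by blast
  qed
  then have "integral (cbox 0 (len G e)) (\<lambda>t. f (e, t) * f (e, t)) = 0"
    using set_borel_integral_eq_integral(2)[OF borel_integrable_atLeastAtMost'[OF c]] by simp
  moreover have "((\<lambda>t. f (e, t) * f (e, t)) has_integral integral (cbox 0 (len G e)) (\<lambda>t. f (e, t) * f (e, t))) (cbox 0 (len G e))"
    using integrable_continuous_interval[OF c] by auto
  ultimately have "((\<lambda>t. f (e, t) * f (e, t)) has_integral 0) (cbox 0 (len G e))" by simp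
  then have "f (e, t) * f (e, t) = 0"
    using c e G by (intro has_integral_0_cbox_imp_0[of 0 "len G e" "\<lambda>t. f (e, t) * f (e, t)"])
      (auto simp: compact_metric_graph_def box_real)
  then show ?thesis by (simp add: e)
qed

section \<open>Existence of the second eigenvalue\<close>

text \<open>Induction over the edges, each thinning the subsequence found so far; uniform limits on
  earlier edges survive the thinning. The Hoelder bound is equicontinuity with modulus \<epsilon>^2
  / (|K| + 1).\<close>

lemma Arzela_Ascoli_finite_family:
  fixes F :: "nat \<Rightarrow> 'e \<times> real \<Rightarrow> real"
  assumes "finite E"
    and "\<And>e n t. e \<in> E \<Longrightarrow> t \<in> {0..l e} \<Longrightarrow> \<bar>F n (e, t)\<bar> \<le> M e"
    and "\<And>e n s t. e \<in> E \<Longrightarrow> s \<in> {0..l e} \<Longrightarrow> t \<in> {0..l e} \<Longrightarrow> (F n (e, t) - F n (e, s))\<^sup>2 \<le> K * \<bar>t - s\<bar>"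
  shows "\<exists>r h. strict_mono r \<and> (\<forall>e\<in>E. continuous_on {0..l e} (\<lambda>t. h (e, t)) \<and>
           uniform_limit {0..l e} (\<lambda>n t. F (r n) (e, t)) (\<lambda>t. h (e, t)) sequentially)"
  using assms
proof (induction E)
  case empty
  show ?case by (intro exI[of _ id]) (auto simp: strict_mono_def)
next
  case (insert e E)
  have "\<exists>r h. strict_mono r \<and> (\<forall>e\<in>E. continuous_on {0..l e} (\<lambda>t. h (e, t)) \<and>
           uniform_limit {0..l e} (\<lambda>n t. F (r n) (e, t)) (\<lambda>t. h (e, t)) sequentially)"
    by (rule insert.IH) (use insert.prems in auto)
  then obtain r h where r: "strict_mono r"
    and c: "\<And>e. e \<in> E \<Longrightarrow> continuous_on {0..l e} (\<lambda>t. h (e, t))"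
    and u: "\<And>e. e \<in> E \<Longrightarrow> uniform_limit {0..l e} (\<lambda>n t. F (r n) (e, t)) (\<lambda>t. h (e, t)) sequentially"
    by blast
  obtain g k where g: "continuous_on {0..l e} g" and k: "strict_mono (k :: nat \<Rightarrow> nat)"
    and lim: "\<And>\<epsilon>. 0 < \<epsilon> \<Longrightarrow> \<exists>N. \<forall>n t. n \<ge> N \<and> t \<in> {0..l e} \<longrightarrow> norm (F (r (k n)) (e, t) - g t) < \<epsilon>"
  proof (rule Arzela_Ascoli[of "{0..l e}" "\<lambda>n t. F (r n) (e, t)" "M e"])
    show "norm (F (r n) (e, t)) \<le> M e" if "t \<in> {0..l e}" for n t
      using insert.prems(1)[of e t "r n"] that by simp
    fix s \<epsilon> :: real assume s: "s \<in> {0..l e}" and "0 < \<epsilon>"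
    have "\<bar>F (r n) (e, s) - F (r n) (e, t)\<bar> < \<epsilon>" if t: "t \<in> {0..l e}" "norm (s - t) < \<epsilon>\<^sup>2 / (\<bar>K\<bar> + 1)" for n t
    proof -
      have "(F (r n) (e, s) - F (r n) (e, t))\<^sup>2 \<le> K * \<bar>s - t\<bar>"
        using insert.prems(2)[of e t s "r n"] s t by simp
      also have "\<dots> \<le> (\<bar>K\<bar> + 1) * \<bar>s - t\<bar>"
        by (intro mult_right_mono) auto
      also have "\<dots> < \<epsilon>\<^sup>2"
        using t(2) by (simp add: field_simps)
      finally show ?thesis
        using \<open>0 < \<epsilon>\<close> power2_less_imp_less[of "\<bar>F (r n) (e, s) - F (r n) (e, t)\<bar>" \<epsilon>] by simp
    qed
    then show "\<exists>d>0. \<forall>n t. t \<in> {0..l e} \<and> norm (s - t) < d \<longrightarrow> norm (F (r n) (e, s) - F (r n) (e, t)) < \<epsilon>"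
      using \<open>0 < \<epsilon>\<close> by (intro exI[of _ "\<epsilon>\<^sup>2 / (\<bar>K\<bar> + 1)"]) auto
  qed (simp, blast)
  define h' where "h' = (\<lambda>x. if fst x = e then g (snd x) else h x)"
  have "continuous_on {0..l e'} (\<lambda>t. h' (e', t)) \<and>
      uniform_limit {0..l e'} (\<lambda>n t. F ((r \<circ> k) n) (e', t)) (\<lambda>t. h' (e', t)) sequentially" if e': "e' \<in> insert e E" for e'
  proof (cases "e' = e")
    case True
    have "uniform_limit {0..l e} (\<lambda>n t. F ((r \<circ> k) n) (e, t)) g sequentially"
      unfolding uniform_limit_sequentially_iff
    proof (intro allI impI)
      fix \<epsilon> :: real assume "0 < \<epsilon>"
      then obtain N where "\<forall>n t. n \<ge> N \<and> t \<in> {0..l e} \<longrightarrow> norm (F (r (k n)) (e, t) - g t) < \<epsilon>"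
        using lim by blast
      then show "\<exists>N. \<forall>n\<ge>N. \<forall>t\<in>{0..l e}. dist (F ((r \<circ> k) n) (e, t)) (g t) < \<epsilon>"
        by (intro exI[of _ N]) (auto simp: dist_norm)
    qed
    then show ?thesis using g True by (simp add: h'_def)
  next
    case False
    then have "e' \<in> E" using e' by simp
    then show ?thesis
      using False c u[THEN filterlim_compose, OF _ filterlim_subseq[OF k], of e'] by (simp add: h'_def o_def)
  qed
  then show ?case
    using strict_mono_o[OF r k] by blast
qed

text \<open>A full period of the sine on one edge vanishes at both ends and extends by zero. It
  shows that the Rayleigh infimum is taken over a nonempty set.\<close>

lemma exists_mean_zero:
  assumes G: "compact_metric_graph G" and e: "e \<in> edges G"
  shows "\<exists>f f'. H1_graph G f f' \<and> mg_integral G f = 0 \<and> mg_inner G f f \<noteq> 0"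
proof -
  define l where "l = len G e"
  have l: "l > 0" using G e by (auto simp: compact_metric_graph_def l_def)
  define f where "f = (\<lambda>x. if fst x = e then sin (2 * pi * snd x / l) else 0)"
  define f' where "f' = (\<lambda>x. if fst x = e then 2 * pi / l * cos (2 * pi * snd x / l) else 0)"
  have ep: "f x = 0" if "endpoint_at G v x" for v x
    using that l by (auto simp: endpoint_at_def f_def l_def)
  have H1: "H1_graph G f f'"
    unfolding H1_graph_def H1_interval_iff
  proof (intro conjI ballI impI)
    show "f x = f y" if "glued G x y" for x y
      using that ep[of _ x] ep[of _ y] unfolding glued_def by metis
    fix d
    have "AC_on 0 (len G d) (\<lambda>t. sin (2 * pi * t / l)) (\<lambda>t. 2 * pi / l * cos (2 * pi * t / l))"
      using l by (intro AC_on_C1 continuous_intros) (auto intro!: derivative_eq_intros)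
    moreover have "AC_on 0 (len G d) (\<lambda>t. 0) (\<lambda>t. 0)"
      by (intro AC_on_C1) auto
    ultimately show "AC_on 0 (len G d) (\<lambda>t. f (d, t)) (\<lambda>t. f' (d, t))"
      by (cases "d = e") (simp_all add: f_def f'_def)
    show "set_integrable lborel {0..len G d} (\<lambda>t. (f' (d, t))\<^sup>2)"
      using l by (cases "d = e") (auto simp: f'_def intro!: borel_integrable_atLeastAtMost' continuous_intros)
  qed
  have "(LBINT t:{0..len G d}. f (d, t)) = 0" for d
  proof (cases "d = e")
    case True
    have "AC_on 0 l (\<lambda>t. - (l / (2 * pi)) * cos (2 * pi * t / l)) (\<lambda>t. sin (2 * pi * t / l))"
      using l by (intro AC_on_C1 continuous_intros) (auto intro!: derivative_eq_intros)
    from AC_on_diff_eq[OF this, of 0 l] show ?thesis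
      using l True by (simp add: f_def l_def)
  qed (simp add: f_def)
  then have "mg_integral G f = 0"
    by (simp add: mg_integral_def)
  moreover have "mg_inner G f f \<noteq> 0"
  proof
    assume "mg_inner G f f = 0"
    from mg_inner_eq_0_imp[OF G H1 this, of "(e, l / 4)"] have "f (e, l / 4) = 0"
      using e l by (auto simp: mg_points_def l_def)
    moreover have "f (e, l / 4) = sin (pi / 2)" using l by (simp add: f_def)
    ultimately show False by simp
  qed
  ultimately show ?thesis using H1 by blast
qed

text \<open>The direct method without weak convergence: equicontinuity gives uniform convergence of
  the functions, and near-minimality then forces the derivatives to be Cauchy in the mean square, so
  completeness supplies the derivative of the limit and no energy is lost.\<close>

lemma rayleigh_minimiser:
  fixes G :: "('v, 'e) metric_graph"
  assumes G: "compact_metric_graph G" and ne: "edges G \<noteq> {}"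
  shows "\<exists>f f'. H1_graph G f f' \<and> mg_integral G f = 0 \<and> mg_inner G f f = 1 \<and>
    (\<forall>g g'. H1_graph G g g' \<longrightarrow> mg_integral G g = 0 \<longrightarrow> mg_inner G f' f' * mg_inner G g g \<le> mg_inner G g' g')"
proof -
  have fin: "finite (edges G)" and len: "\<And>e. e \<in> edges G \<Longrightarrow> 0 < len G e"
    using G by (auto simp: compact_metric_graph_def)
  define S where "S = {mg_inner G g' g' | g g'. H1_graph G g g' \<and> mg_integral G g = 0 \<and> mg_inner G g g = 1}"
  define m where "m = Inf S"
  have bdd: "bdd_below S" unfolding S_def by (rule bdd_belowI[of _ 0]) (auto simp: mg_inner_nonneg)
  have scaled: "(1 / mg_inner G g g) * mg_inner G g' g' \<in> S"
    if g: "H1_graph G g g'" "mg_integral G g = 0" "mg_inner G g g \<noteq> 0" for g g'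
  proof -
    define c where "c = 1 / sqrt (mg_inner G g g)"
    have c: "c * c * mg_inner G g g = 1" "c * c = 1 / mg_inner G g g"
      using g(3) mg_inner_nonneg[of G g] by (auto simp: c_def)
    have "mg_integral G (\<lambda>x. c * g x) = 0"
      using g(2) by (simp add: mg_integral_eq_inner mg_inner_scale_left)
    moreover have "mg_inner G (\<lambda>x. c * g x) (\<lambda>x. c * g x) = 1"
      using c(1) by (simp add: mg_inner_scale_left mg_inner_scale_right mult.assoc)
    ultimately have "mg_inner G (\<lambda>x. c * g' x) (\<lambda>x. c * g' x) \<in> S"
      unfolding S_def using H1_graph_scale[OF g(1), of c] by blast
    then show ?thesis
      using c by (simp add: mg_inner_scale_left mg_inner_scale_right mult.assoc[symmetric])
  qed
  have Sne: "S \<noteq> {}"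
    using exists_mean_zero[OF G] ne scaled by blast
  have m: "m * mg_inner G g g \<le> mg_inner G g' g'" if g: "H1_graph G g g'" "mg_integral G g = 0" for g g'
  proof (cases "mg_inner G g g = 0")
    case True
    then show ?thesis by (simp add: mg_inner_nonneg)
  next
    case False
    then have "mg_inner G g g > 0" using mg_inner_nonneg[of G g] by simp
    moreover have "m \<le> (1 / mg_inner G g g) * mg_inner G g' g'"
      unfolding m_def by (rule cInf_lower[OF scaled[OF g False] bdd])
    ultimately show ?thesis by (simp add: field_simps)
  qed
  have m0: "0 \<le> m"
    unfolding m_def by (rule cInf_greatest[OF Sne]) (auto simp: S_def mg_inner_nonneg)
  have "\<exists>g g'. (H1_graph G g g' \<and> mg_integral G g = 0 \<and> mg_inner G g g = 1) \<and> mg_inner G g' g' < m + 1 / Suc n" for n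
  proof -
    have "\<exists>x\<in>S. x < m + 1 / Suc n"
      using cInf_lessD[OF Sne, of "m + 1 / Suc n"] by (simp add: m_def)
    then show ?thesis by (auto simp: S_def)
  qed
  then obtain F F' where F: "\<And>n. H1_graph G (F n) (F' n)" "\<And>n. mg_integral G (F n) = 0" "\<And>n. mg_inner G (F n) (F n) = 1"
    and F': "\<And>n. mg_inner G (F' n) (F' n) < m + 1 / Suc n"
    by metis
  note L2F = H1_graph_L2(1)[OF F(1)] and L2F' = H1_graph_L2(2)[OF F(1)]
  have edge_le: "(LBINT t:{0..len G e}. (h (e, t))\<^sup>2) \<le> mg_inner G h h" if "e \<in> edges G" for h e
    unfolding mg_inner_def mg_integral_def power2_eq_square[symmetric] set_lebesgue_integral_def
    using fin that by (intro member_le_sum Bochner_Integration.integral_nonneg) auto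
  have F'1: "mg_inner G (F' n) (F' n) \<le> m + 1" for n
    using F'[of n] by (smt (verit) divide_le_eq_1_pos of_nat_0_less_iff of_nat_1 of_nat_mono zero_less_Suc One_nat_def Suc_leI)
  have hoelder: "(F n (e, t) - F n (e, s))\<^sup>2 \<le> (m + 1) * \<bar>t - s\<bar>"
    if e: "e \<in> edges G" and st: "s \<in> {0..len G e}" "t \<in> {0..len G e}" for e n s t
  proof -
    have "(F n (e, t) - F n (e, s))\<^sup>2 \<le> \<bar>t - s\<bar> * (LBINT x:{0..len G e}. (F' n (e, x))\<^sup>2)"
      by (rule AC_on_Hoelder[OF H1_graph_AC[OF F(1) e] st])
    also have "\<dots> \<le> \<bar>t - s\<bar> * (m + 1)"
      using edge_le[OF e, of "F' n"] F'1[of n] by (intro mult_left_mono) auto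
    finally show ?thesis by (simp add: mult.commute)
  qed
  \<comment> \<open>The value at t is compared with the value at s by the Hoelder bound; averaging
    over s replaces the latter by the norm, which is at most 1 on the edge.\<close>
  have bound: "\<bar>F n (e, t)\<bar> \<le> sqrt ((2 + 2 * (m + 1) * len G e * len G e) / len G e)"
    if e: "e \<in> edges G" and t: "t \<in> {0..len G e}" for e n t
  proof -
    let ?l = "len G e"
    have c: "continuous_on {0..?l} (\<lambda>s. F n (e, s))" by (rule H1_graph_continuous[OF F(1) e])
    have "(LBINT s:{0..?l}. (F n (e, t))\<^sup>2) \<le> (LBINT s:{0..?l}. 2 * (F n (e, s))\<^sup>2 + 2 * (m + 1) * ?l)"
    proof (rule set_integral_mono)
      fix s assume s: "s \<in> {0..?l}"
      have "(F n (e, t) - F n (e, s))\<^sup>2 \<le> (m + 1) * ?l"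
        using hoelder[OF e s t, of n] s t m0 by (auto intro!: order_trans[OF hoelder[OF e s t]] mult_left_mono)
      moreover have "(F n (e, t))\<^sup>2 \<le> 2 * (F n (e, s))\<^sup>2 + 2 * (F n (e, t) - F n (e, s))\<^sup>2"
        using zero_le_power2[of "F n (e, t) - 2 * F n (e, s)"] by (simp add: power2_eq_square algebra_simps)
      ultimately show "(F n (e, t))\<^sup>2 \<le> 2 * (F n (e, s))\<^sup>2 + 2 * (m + 1) * ?l" by linarith
    qed (intro borel_integrable_atLeastAtMost' continuous_intros c)+
    also have "\<dots> = 2 * (LBINT s:{0..?l}. (F n (e, s))\<^sup>2) + (LBINT s:{0..?l}. 2 * (m + 1) * ?l)"
      by (subst set_integral_add) (auto intro!: borel_integrable_atLeastAtMost' continuous_intros c)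
    also have "\<dots> \<le> 2 * 1 + 2 * (m + 1) * ?l * ?l"
      using edge_le[OF e, of "F n"] F(3)[of n] len[OF e] by (simp add: set_lebesgue_integral_def mult_ac)
    finally have "?l * (F n (e, t))\<^sup>2 \<le> 2 + 2 * (m + 1) * ?l * ?l"
      using len[OF e] by (simp add: set_lebesgue_integral_def)
    then have "(F n (e, t))\<^sup>2 \<le> (2 + 2 * (m + 1) * ?l * ?l) / ?l"
      using len[OF e] by (simp add: field_simps)
    then show ?thesis by (rule real_le_rsqrt[where x = "\<bar>F n (e, t)\<bar>", simplified])
  qed
  obtain r h where r: "strict_mono r" and hc: "\<And>e. e \<in> edges G \<Longrightarrow> continuous_on {0..len G e} (\<lambda>t. h (e, t))"
    and unif: "\<And>e. e \<in> edges G \<Longrightarrow> uniform_limit {0..len G e} (\<lambda>n t. F (r n) (e, t)) (\<lambda>t. h (e, t)) sequentially"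
  proof -
    have "\<exists>r h. strict_mono r \<and> (\<forall>e\<in>edges G. continuous_on {0..len G e} (\<lambda>t. h (e, t)) \<and>
        uniform_limit {0..len G e} (\<lambda>n t. F (r n) (e, t)) (\<lambda>t. h (e, t)) sequentially)"
      by (rule Arzela_Ascoli_finite_family[OF fin]) (fact bound hoelder)+
    then show ?thesis using that by blast
  qed
  have L2h: "L2_graph G h" by (rule L2_graph_continuous[OF hc])
  let ?a = "\<lambda>n. mg_inner G (\<lambda>x. F (r n) x - h x) (\<lambda>x. F (r n) x - h x)"
  have a: "?a \<longlonglongrightarrow> 0"
    unfolding mg_inner_def mg_integral_def
  proof (rule tendsto_null_sum)
    fix e assume e: "e \<in> edges G"
    let ?I = "\<lambda>n. LBINT t:{0..len G e}. (F (r n) (e, t) - h (e, t)) * (F (r n) (e, t) - h (e, t))"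
    show "?I \<longlonglongrightarrow> 0"
    proof (rule LIMSEQ_I)
      fix \<epsilon> :: real assume "0 < \<epsilon>"
      define d where "d = sqrt (\<epsilon> / (2 * len G e))"
      have d: "d > 0" "d * d * len G e = \<epsilon> / 2" using \<open>0 < \<epsilon>\<close> len[OF e] by (auto simp: d_def)
      obtain N where N: "\<And>n t. n \<ge> N \<Longrightarrow> t \<in> {0..len G e} \<Longrightarrow> \<bar>F (r n) (e, t) - h (e, t)\<bar> < d"
        using uniform_limit_sequentially_iff[THEN iffD1, OF unif[OF e]] d(1) unfolding dist_real_def by blast
      have "norm (?I n - 0) < \<epsilon>" if "n \<ge> N" for n
      proof -
        have "0 \<le> ?I n" unfolding set_lebesgue_integral_def by (intro Bochner_Integration.integral_nonneg) auto
        moreover have "?I n \<le> (LBINT t:{0..len G e}. d * d)"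
        proof (rule set_integral_mono)
          fix t assume "t \<in> {0..len G e}"
          then have "\<bar>F (r n) (e, t) - h (e, t)\<bar> * \<bar>F (r n) (e, t) - h (e, t)\<bar> \<le> d * d"
            using N[OF that, of t] by (intro mult_mono) auto
          then show "(F (r n) (e, t) - h (e, t)) * (F (r n) (e, t) - h (e, t)) \<le> d * d"
            by simp
        qed (intro borel_integrable_atLeastAtMost' continuous_intros hc[OF e] H1_graph_continuous[OF F(1) e])+
        moreover have "(LBINT t:{0..len G e}. d * d) = \<epsilon> / 2"
          using len[OF e] d(2) by (simp add: set_lebesgue_integral_def mult_ac)
        ultimately show ?thesis using \<open>0 < \<epsilon>\<close> by simp
      qed
      then show "\<exists>N. \<forall>n\<ge>N. norm (?I n - 0) < \<epsilon>" by blast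
    qed
  qed
  have q: "(\<lambda>n. mg_inner G (F' (r n)) (F' (r n))) \<longlonglongrightarrow> m"
  proof (rule tendsto_sandwich)
    show "\<forall>\<^sub>F n in sequentially. m \<le> mg_inner G (F' (r n)) (F' (r n))"
      using m[OF F(1,2)] F(3) by (auto intro!: always_eventually)
    show "\<forall>\<^sub>F n in sequentially. mg_inner G (F' (r n)) (F' (r n)) \<le> m + 1 / Suc (r n)"
      using F' by (auto intro!: always_eventually less_imp_le)
    have "(\<lambda>n. m + 1 / real (Suc n)) \<longlonglongrightarrow> m + 0"
      by (intro tendsto_intros LIMSEQ_Suc[OF lim_1_over_n])
    from filterlim_compose[OF this filterlim_subseq[OF r]]
    show "(\<lambda>n. m + 1 / Suc (r n)) \<longlonglongrightarrow> m" by simp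
  qed simp
  \<comment> \<open>The parallelogram identity bounds the distance of the derivatives by that of the functions.\<close>
  have parallelogram: "mg_inner G (\<lambda>x. F' (r i) x - F' (r j) x) (\<lambda>x. F' (r i) x - F' (r j) x)
      \<le> 2 * (mg_inner G (F' (r i)) (F' (r i)) - m) + 2 * (mg_inner G (F' (r j)) (F' (r j)) - m) + m * (2 * ?a i + 2 * ?a j)" for i j
  proof -
    let ?f = "F (r i)" and ?g = "F (r j)" and ?f' = "F' (r i)" and ?g' = "F' (r j)"
    let ?u = "\<lambda>x. ?f x - h x" and ?v = "\<lambda>x. ?g x - h x"
    have L: "L2_graph G ?u" "L2_graph G ?v" by (intro L2_graph_diff L2F L2h)+
    have "mg_integral G (\<lambda>x. ?f x + ?g x) = 0"
      using F(2) L2F by (simp add: mg_integral_eq_inner mg_inner_add_left L2_graph_const)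
    then have 1: "m * (2 + 2 * mg_inner G ?f ?g) \<le> mg_inner G ?f' ?f' + 2 * mg_inner G ?f' ?g' + mg_inner G ?g' ?g'"
      using m[OF H1_graph_add[OF F(1) F(1)], of "r i" "r j"] F(3)
      by (simp add: mg_inner_square_add L2F L2F')
    have "mg_inner G (\<lambda>x. ?u x - ?v x) (\<lambda>x. ?u x - ?v x) \<le> 2 * mg_inner G ?u ?u + 2 * mg_inner G ?v ?v"
      using mg_inner_nonneg[of G "\<lambda>x. ?u x + ?v x"] by (simp only: mg_inner_square_add[OF L] mg_inner_square_diff[OF L])
    moreover have "mg_inner G (\<lambda>x. ?u x - ?v x) (\<lambda>x. ?u x - ?v x) = 2 - 2 * mg_inner G ?f ?g"
      using F(3) mg_inner_square_diff[OF L2F L2F, of "r i" "r j"] by simp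
    ultimately have "m * (2 - 2 * mg_inner G ?f ?g) \<le> m * (2 * ?a i + 2 * ?a j)"
      using m0 by (intro mult_left_mono) auto
    with 1 show ?thesis
      by (simp add: mg_inner_square_diff L2F' algebra_simps)
  qed
  have cauchy: "\<exists>N. \<forall>i\<ge>N. \<forall>j\<ge>N. mg_inner G (\<lambda>x. F' (r i) x - F' (r j) x) (\<lambda>x. F' (r i) x - F' (r j) x) < \<epsilon>" if "0 < \<epsilon>" for \<epsilon>
  proof -
    \<comment> \<open>The parallelogram bound is a sum of one term in i and one in j, each tending
      to zero.\<close>
    let ?b = "\<lambda>n. 2 * (mg_inner G (F' (r n)) (F' (r n)) - m) + m * (2 * ?a n)"
    have "?b \<longlonglongrightarrow> 2 * (m - m) + m * (2 * 0)"
      by (intro tendsto_intros q a)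
    then have b: "?b \<longlonglongrightarrow> 0" by simp
    obtain N where "\<forall>n\<ge>N. norm (?b n - 0) < \<epsilon> / 2"
      using LIMSEQ_D[OF b half_gt_zero[OF \<open>0 < \<epsilon>\<close>]] by blast
    then have N: "\<bar>?b n\<bar> < \<epsilon> / 2" if "n \<ge> N" for n
      using that by simp
    show ?thesis
    proof (intro exI allI impI)
      fix i j assume "N \<le> i" "N \<le> j"
      then have "?b i + ?b j < \<epsilon>" using N[of i] N[of j] by linarith
      then show "mg_inner G (\<lambda>x. F' (r i) x - F' (r j) x) (\<lambda>x. F' (r i) x - F' (r j) x) < \<epsilon>"
        using parallelogram[of i j] by (simp add: algebra_simps)
    qed
  qed
  have "\<exists>p. \<forall>e\<in>edges G. p e \<in> borel_measurable lborel \<and> integrable lborel (\<lambda>t. (p e t)\<^sup>2) \<and>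
      (\<lambda>n. LBINT t:{0..len G e}. (F' (r n) (e, t) - p e t)\<^sup>2) \<longlonglongrightarrow> 0"
  proof (rule bchoice, rule ballI)
    fix e assume e: "e \<in> edges G"
    \<comment> \<open>Cutting off by the indicator makes these functions on the whole line, where
      completeness is available.\<close>
    let ?f = "\<lambda>n t. indicator {0..len G e} t * F' (r n) (e, t)"
    have sq: "(\<lambda>t. (?f n t)\<^sup>2) = (\<lambda>t. indicator {0..len G e} t *\<^sub>R (F' (r n) (e, t))\<^sup>2)" for n
      by (auto split: split_indicator)
    obtain p where p: "p \<in> borel_measurable lborel" "integrable lborel (\<lambda>t. (p t)\<^sup>2)"
      and lim: "(\<lambda>n. \<integral>t. (?f n t - p t)\<^sup>2 \<partial>lborel) \<longlonglongrightarrow> 0"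
    proof (rule L2_complete)
      show meas: "?f n \<in> borel_measurable lborel" for n
        using L2F'[of "r n"] e by (simp add: L2_graph_def set_borel_measurable_def)
      show "integrable lborel (\<lambda>t. (?f n t)\<^sup>2)" for n
        using L2F'[of "r n"] e unfolding sq by (simp add: L2_graph_def set_integrable_def)
      fix \<epsilon> :: real assume "0 < \<epsilon>"
      then obtain N where N: "\<And>i j. i \<ge> N \<Longrightarrow> j \<ge> N \<Longrightarrow> mg_inner G (\<lambda>x. F' (r i) x - F' (r j) x) (\<lambda>x. F' (r i) x - F' (r j) x) < \<epsilon>"
        using cauchy by blast
      have "(\<integral>t. (?f i t - ?f j t)\<^sup>2 \<partial>lborel) = (LBINT t:{0..len G e}. (F' (r i) (e, t) - F' (r j) (e, t))\<^sup>2)" for i j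
        unfolding set_lebesgue_integral_def by (intro Bochner_Integration.integral_cong) (auto split: split_indicator)
      then show "\<exists>N. \<forall>i\<ge>N. \<forall>j\<ge>N. (\<integral>t. (?f i t - ?f j t)\<^sup>2 \<partial>lborel) < \<epsilon>"
        using le_less_trans[OF edge_le[OF e, of "\<lambda>x. F' (r i) x - F' (r j) x" for i j] N] by (intro exI[of _ N]) simp
    qed
    have "(\<lambda>n. LBINT t:{0..len G e}. (F' (r n) (e, t) - p t)\<^sup>2) \<longlonglongrightarrow> 0"
    proof (rule Lim_null_comparison[OF _ lim], rule always_eventually, rule allI)
      fix n
      have int: "integrable lborel (\<lambda>t. (?f n t - p t)\<^sup>2)"
      proof (rule Bochner_Integration.integrable_bound)
        show "integrable lborel (\<lambda>t. 2 * (?f n t)\<^sup>2 + 2 * (p t)\<^sup>2)"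
        proof (intro Bochner_Integration.integrable_add integrable_mult_right p(2))
          show "integrable lborel (\<lambda>t. (?f n t)\<^sup>2)"
            unfolding sq using L2F'[of "r n"] e by (simp add: L2_graph_def set_integrable_def)
        qed
        have "?f n \<in> borel_measurable lborel"
          using L2F'[of "r n"] e by (simp add: L2_graph_def set_borel_measurable_def)
        then show "(\<lambda>t. (?f n t - p t)\<^sup>2) \<in> borel_measurable lborel"
          using p(1) by measurable
        have "(x - y)\<^sup>2 \<le> 2 * x\<^sup>2 + 2 * y\<^sup>2" for x y :: real
          using zero_le_power2[of "x + y"] by (simp add: power2_eq_square algebra_simps)
        then show "AE t in lborel. norm ((?f n t - p t)\<^sup>2) \<le> norm (2 * (?f n t)\<^sup>2 + 2 * (p t)\<^sup>2)"
          by (intro AE_I2) simp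
      qed
      have eq: "(LBINT t:{0..len G e}. (F' (r n) (e, t) - p t)\<^sup>2) = (LBINT t:{0..len G e}. (?f n t - p t)\<^sup>2)"
        by (intro set_lebesgue_integral_cong) auto
      have "(LBINT t:{0..len G e}. (?f n t - p t)\<^sup>2) \<le> (LBINT t:UNIV. (?f n t - p t)\<^sup>2)"
        using int by (intro set_integral_mono_set_nonneg) (auto simp: set_integrable_def)
      moreover have "0 \<le> (LBINT t:{0..len G e}. (?f n t - p t)\<^sup>2)"
        unfolding set_lebesgue_integral_def by (intro Bochner_Integration.integral_nonneg) auto
      ultimately show "norm (LBINT t:{0..len G e}. (F' (r n) (e, t) - p t)\<^sup>2) \<le> (\<integral>t. (?f n t - p t)\<^sup>2 \<partial>lborel)"
        unfolding eq by (simp add: set_lebesgue_integral_def)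
    qed
    with p show "\<exists>p. p \<in> borel_measurable lborel \<and> integrable lborel (\<lambda>t. (p t)\<^sup>2) \<and>
        (\<lambda>n. LBINT t:{0..len G e}. (F' (r n) (e, t) - p t)\<^sup>2) \<longlonglongrightarrow> 0"
      by blast
  qed
  then obtain p where p: "\<And>e. e \<in> edges G \<Longrightarrow> p e \<in> borel_measurable lborel"
      "\<And>e. e \<in> edges G \<Longrightarrow> integrable lborel (\<lambda>t. (p e t)\<^sup>2)"
      "\<And>e. e \<in> edges G \<Longrightarrow> (\<lambda>n. LBINT t:{0..len G e}. (F' (r n) (e, t) - p e t)\<^sup>2) \<longlonglongrightarrow> 0"
    by blast
  define h' where "h' = (\<lambda>x. p (fst x) (snd x))"
  have p_sq: "set_integrable lborel {0..len G e} (\<lambda>t. (h' (e, t))\<^sup>2)"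
    and p_meas: "set_borel_measurable lborel {0..len G e} (\<lambda>t. h' (e, t))" if e: "e \<in> edges G" for e
  proof -
    show "set_integrable lborel {0..len G e} (\<lambda>t. (h' (e, t))\<^sup>2)"
      unfolding set_integrable_def h'_def fst_conv snd_conv
      by (intro integrable_mult_indicator p(2)[OF e]) simp
    show "set_borel_measurable lborel {0..len G e} (\<lambda>t. h' (e, t))"
      using p(1)[OF e] by (simp add: set_borel_measurable_def h'_def)
  qed
  have L2h': "L2_graph G h'" by (simp add: L2_graph_def p_sq p_meas)
  have conv': "(\<lambda>n. mg_inner G (\<lambda>x. F' (r n) x - h' x) (\<lambda>x. F' (r n) x - h' x)) \<longlonglongrightarrow> 0"
    unfolding mg_inner_def mg_integral_def
    by (rule tendsto_null_sum) (use p(3) in \<open>simp add: h'_def flip: power2_eq_square\<close>)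
  have hlim: "(\<lambda>n. F (r n) x) \<longlonglongrightarrow> h x" if "x \<in> mg_points G" for x
    using that tendsto_uniform_limitI[OF unif] by (auto simp: mg_points_def)
  have H1: "H1_graph G h h'"
    unfolding H1_graph_def H1_interval_def
  proof (intro conjI ballI impI)
    fix x y assume xy: "x \<in> mg_points G" "y \<in> mg_points G" "glued G x y"
    have "F (r n) x = F (r n) y" for n by (rule H1_graph_glued[OF F(1) xy])
    then have "(\<lambda>n. F (r n) x) \<longlonglongrightarrow> h y" using hlim[OF xy(2)] by simp
    with hlim[OF xy(1)] show "h x = h y" by (rule LIMSEQ_unique)
  next
    fix e s assume e: "e \<in> edges G" and s: "s \<in> {0..len G e}"
    have sub: "set_integrable lborel {0..s} k" if "set_integrable lborel {0..len G e} k" for k :: "real \<Rightarrow> real"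
      by (rule set_integrable_subset[OF that]) (use s in auto)
    have ih': "set_integrable lborel {0..len G e} (\<lambda>t. h' (e, t))"
      using L2_graph_mult[OF L2h' L2_graph_const[of G 1] e] by simp
    have iF': "set_integrable lborel {0..len G e} (\<lambda>t. F' n (e, t))" for n
      by (rule AC_on_integrable[OF H1_graph_AC(1)[OF F(1) e]])
    have isq: "set_integrable lborel {0..len G e} (\<lambda>t. (F' n (e, t) - h' (e, t))\<^sup>2)" for n
      using L2_graph_diff[OF L2F' L2h'] e by (simp add: L2_graph_def)
    \<comment> \<open>Mean-square convergence on a bounded interval gives convergence of integrals
      over {0..s}. Hence the fundamental theorem passes to the limit and \<open>h'\<close> is a
      derivative of \<open>h\<close>.\<close>
    have lim: "(\<lambda>n. LBINT t:{0..s}. F' (r n) (e, t)) \<longlonglongrightarrow> (LBINT t:{0..s}. h' (e, t))"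
    proof (rule LIM_zero_cancel, rule Lim_null_comparison)
      let ?c = "\<lambda>n. sqrt (s * (LBINT t:{0..len G e}. (F' (r n) (e, t) - h' (e, t))\<^sup>2))"
      have "?c \<longlonglongrightarrow> sqrt (s * 0)"
        using p(3)[OF e] unfolding h'_def by (intro tendsto_intros) simp
      then show "?c \<longlonglongrightarrow> 0" by simp
      show "\<forall>\<^sub>F n in sequentially. norm ((LBINT t:{0..s}. F' (r n) (e, t)) - (LBINT t:{0..s}. h' (e, t))) \<le> ?c n"
      proof (rule always_eventually, rule allI)
        fix n
        have "(LBINT t:{0..s}. F' (r n) (e, t) - h' (e, t))\<^sup>2 \<le> (s - 0) * (LBINT t:{0..s}. (F' (r n) (e, t) - h' (e, t))\<^sup>2)"
          using s by (intro set_integral_square_le set_integral_diff(1) sub ih' iF' isq) auto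
        also have "\<dots> \<le> s * (LBINT t:{0..len G e}. (F' (r n) (e, t) - h' (e, t))\<^sup>2)"
          using s isq by (auto intro!: mult_left_mono set_integral_mono_set_nonneg)
        finally have "(LBINT t:{0..s}. F' (r n) (e, t) - h' (e, t))\<^sup>2 \<le> s * (LBINT t:{0..len G e}. (F' (r n) (e, t) - h' (e, t))\<^sup>2)" .
        moreover have "(LBINT t:{0..s}. F' (r n) (e, t) - h' (e, t)) = (LBINT t:{0..s}. F' (r n) (e, t)) - (LBINT t:{0..s}. h' (e, t))"
          by (intro set_integral_diff(2) sub ih' iF')
        ultimately show "norm ((LBINT t:{0..s}. F' (r n) (e, t)) - (LBINT t:{0..s}. h' (e, t))) \<le> ?c n"
          by (intro real_le_rsqrt) simp
      qed
    qed
    have "(\<lambda>n. F (r n) (e, 0) + (LBINT t:{0..s}. F' (r n) (e, t))) \<longlonglongrightarrow> h (e, 0) + (LBINT t:{0..s}. h' (e, t))"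
      using e s by (intro tendsto_add hlim lim) (auto simp: mg_points_def)
    moreover have "F (r n) (e, 0) + (LBINT t:{0..s}. F' (r n) (e, t)) = F (r n) (e, s)" for n
      using AC_on_eq[OF H1_graph_AC(1)[OF F(1) e] s, of "r n"] by simp
    ultimately have "(\<lambda>n. F (r n) (e, s)) \<longlonglongrightarrow> h (e, 0) + (LBINT t:{0..s}. h' (e, t))" by simp
    moreover have "(\<lambda>n. F (r n) (e, s)) \<longlonglongrightarrow> h (e, s)"
      using e s by (intro hlim) (auto simp: mg_points_def)
    ultimately show "h (e, s) = h (e, 0) + (LBINT t:{0..s}. h' (e, t))"
      using LIMSEQ_unique by blast
  qed (use p_sq p_meas in auto)
  have "(\<lambda>n. mg_inner G (F (r n)) (\<lambda>x. 1)) \<longlonglongrightarrow> mg_inner G h (\<lambda>x. 1)"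
    by (rule mg_inner_tendsto(1)[OF L2F L2h a L2_graph_const])
  then have "mg_integral G h = 0"
    using F(2) LIMSEQ_unique[OF _ tendsto_const] by (auto simp: mg_integral_eq_inner)
  moreover have "(\<lambda>n. mg_inner G (F (r n)) (F (r n))) \<longlonglongrightarrow> mg_inner G h h"
    by (rule mg_inner_tendsto(2)[OF L2F L2h a L2h])
  then have "mg_inner G h h = 1"
    using F(3) LIMSEQ_unique[OF _ tendsto_const] by auto
  moreover have "mg_inner G h' h' = m"
    using mg_inner_tendsto(2)[OF L2F' L2h' conv' L2h'] q LIMSEQ_unique by blast
  ultimately show ?thesis using H1 m by blast
qed

text \<open>Minimality concerns test functions of mean zero only. Adding the constant
  \<open>c\<close> to g removes its mean, changes no derivative, and leaves the product with f
  unchanged because f has mean zero; then the first variation applies.\<close>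

lemma minimiser_weak:
  assumes G: "compact_metric_graph G" and L: "0 < total_length G"
    and f: "H1_graph G f f'" "mg_integral G f = 0" "mg_inner G f f = 1"
    and min: "\<And>g g'. H1_graph G g g' \<Longrightarrow> mg_integral G g = 0 \<Longrightarrow> mg_inner G f' f' * mg_inner G g g \<le> mg_inner G g' g'"
    and g: "H1_graph G g g'"
  shows "mg_inner G f' g' = mg_inner G f' f' * mg_inner G f g"
proof -
  define c where "c = - mg_integral G g / total_length G"
  define h where "h = (\<lambda>x. g x + c)"
  have h: "H1_graph G h g'"
    using H1_graph_add[OF g H1_graph_const[of G c]] by (simp add: h_def)
  note L2 = H1_graph_L2[OF f(1)] H1_graph_L2[OF g] H1_graph_L2(1)[OF h] L2_graph_const[of G]
  have h0: "mg_integral G h = 0"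
    using mg_inner_add_left[OF L2(3) L2(6)[of c] L2(6)[of 1]] mg_integral_const[OF G, of c] L
    by (simp add: mg_integral_eq_inner[symmetric] c_def h_def)
  have "mg_inner G f h = mg_inner G f g + c * mg_integral G f"
    using mg_inner_add_right[OF L2(3) L2(6)[of c] L2(1)] mg_inner_scale_right[of G f c "\<lambda>x. 1"]
    by (simp add: mg_integral_eq_inner h_def)
  then have fg: "mg_inner G f h = mg_inner G f g" using f(2) by simp
  have "mg_inner G f' g' - mg_inner G f' f' * mg_inner G f h = 0"
  proof (rule quadratic_nonneg_imp)
    fix t
    have th: "H1_graph G (\<lambda>x. f x + t * h x) (\<lambda>x. f' x + t * g' x)"
      by (rule H1_graph_add[OF f(1) H1_graph_scale[OF h]])
    have "mg_integral G (\<lambda>x. f x + t * h x) = 0"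
      using mg_inner_add_left[OF L2(1) L2_graph_scale[OF L2(5), of t] L2(6)[of 1]] mg_inner_scale_left[of G t h "\<lambda>x. 1"] f(2) h0
      by (simp add: mg_integral_eq_inner)
    from min[OF th this]
    show "0 \<le> 2 * t * (mg_inner G f' g' - mg_inner G f' f' * mg_inner G f h)
        + t\<^sup>2 * (mg_inner G g' g' - mg_inner G f' f' * mg_inner G h h)"
      by (simp add: mg_inner_square_add L2_graph_scale L2 mg_inner_scale_left mg_inner_scale_right f(3)
          power2_eq_square algebra_simps)
  qed
  then show ?thesis by (simp add: fg)
qed

text \<open>Links the eigenvalue defined by counting with the Rayleigh quotient. The constant 1 and
  the minimiser are two independent eigenfunctions, so the minimum is admissible in the infimum;
  conversely any two independent eigenfunctions yield a function of mean zero whose quotient does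
  not exceed the admissible level.\<close>

lemma mg_eigenvalue_2_variational:
  fixes G :: "('v, 'e) metric_graph"
  assumes G: "compact_metric_graph G" and L: "0 < total_length G"
  shows "\<exists>f f'. H1_graph G f f' \<and> mg_integral G f = 0 \<and> mg_inner G f f = 1 \<and>
    mg_inner G f' f' = mg_eigenvalue G 2 \<and>
    (\<forall>g g'. H1_graph G g g' \<longrightarrow> mg_inner G f' g' = mg_eigenvalue G 2 * mg_inner G f g) \<and>
    (\<forall>g g'. H1_graph G g g' \<longrightarrow> mg_integral G g = 0 \<longrightarrow> mg_eigenvalue G 2 * mg_inner G g g \<le> mg_inner G g' g')"
proof -
  have ne: "edges G \<noteq> {}" using L by (auto simp: total_length_def)
  obtain f f' where f: "H1_graph G f f'" "mg_integral G f = 0" "mg_inner G f f = 1"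
    and min: "\<And>g g'. H1_graph G g g' \<Longrightarrow> mg_integral G g = 0 \<Longrightarrow> mg_inner G f' f' * mg_inner G g g \<le> mg_inner G g' g'"
    using rayleigh_minimiser[OF G ne] by blast
  have weak: "mg_inner G f' g' = mg_inner G f' f' * mg_inner G f g" if "H1_graph G g g'" for g g'
    by (rule minimiser_weak[OF G L f _ that]) (fact min)
  define S where "S = {\<kappa>. \<exists>\<nu> u. (\<forall>i<2. \<nu> i \<le> \<kappa> \<and> in_eigenspace G (\<nu> i) (u i)) \<and> lin_indep_on (mg_points G) 2 u}"
  note L2f = H1_graph_L2[OF f(1)] L2_graph_const[of G]
  have one: "mg_inner G (\<lambda>x. 1) (\<lambda>x. 1) = total_length G"
    using mg_integral_const[OF G, of 1] by (simp add: mg_inner_def)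
  have "mg_inner G f' f' \<in> S"
    unfolding S_def
  proof (intro CollectI exI conjI allI impI)
    let ?\<nu> = "\<lambda>i::nat. if i = 0 then 0 else mg_inner G f' f'"
    let ?u = "\<lambda>i::nat. if i = 0 then (\<lambda>x. 1) else f"
    fix i :: nat
    show "?\<nu> i \<le> mg_inner G f' f'" by (simp add: mg_inner_nonneg)
    have "in_eigenspace G 0 (\<lambda>x. 1)"
      unfolding in_eigenspace_def by (intro exI[of _ "\<lambda>x. 0"]) (auto simp: H1_graph_const mg_integral_def)
    moreover have "in_eigenspace G (mg_inner G f' f') f"
    proof -
      have "mg_integral G (\<lambda>x. f' x * g' x) = mg_inner G f' f' * mg_integral G (\<lambda>x. f x * g x)"
        if "H1_graph G g g'" for g g'
        using weak[OF that] by (simp only: mg_inner_def)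
      then show ?thesis
        unfolding in_eigenspace_def using f(1) by blast
    qed
    ultimately show "in_eigenspace G (?\<nu> i) (?u i)" by simp
    show "lin_indep_on (mg_points G) 2 ?u"
      unfolding lin_indep_on_def
    proof (intro allI impI)
      fix c :: "nat \<Rightarrow> real" and i :: nat assume c: "\<forall>x\<in>mg_points G. (\<Sum>i<2. c i * ?u i x) = 0" and i: "i < 2"
      have c': "c 0 + c 1 * f x = 0" if "x \<in> mg_points G" for x
        using bspec[OF c that] by (simp add: numeral_2_eq_2)
      have z: "mg_inner G (\<lambda>x. c 0 * 1 + c 1 * f x) g = 0" for g
        unfolding mg_inner_def mg_integral_def
      proof (rule sum.neutral, rule ballI)
        fix e assume "e \<in> edges G"
        then have "(LBINT t:{0..len G e}. (c 0 * 1 + c 1 * f (e, t)) * g (e, t)) = (LBINT t:{0..len G e}. 0)"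
          using c' by (intro set_lebesgue_integral_cong) (auto simp: mg_points_def)
        then show "(LBINT t:{0..len G e}. (c 0 * 1 + c 1 * f (e, t)) * g (e, t)) = 0" by simp
      qed
      have e: "mg_inner G (\<lambda>x. c 0 * 1 + c 1 * f x) g = c 0 * mg_inner G (\<lambda>x. 1) g + c 1 * mg_inner G f g" if "L2_graph G g" for g
        by (subst mg_inner_add_left) (use that L2f in \<open>simp_all add: L2_graph_scale mg_inner_scale_left[of _ _ f]
            mg_inner_scale_left[of _ "c 0" "\<lambda>x. 1", simplified]\<close>)
      have "c 0 = 0"
        using z[of "\<lambda>x. 1"] e[OF L2f(3)[of 1]] f(2) L by (simp add: one mg_integral_eq_inner)
      moreover have "c 1 = 0"
        using z[of f] e[OF L2f(1)] f(3) \<open>c 0 = 0\<close> by simp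
      ultimately show "c i = 0" using i by (auto simp: less_2_cases_iff)
    qed
  qed
  moreover have "mg_inner G f' f' \<le> \<kappa>" if "\<kappa> \<in> S" for \<kappa>
  proof -
    obtain \<nu> u where \<nu>: "\<And>i::nat. i < 2 \<Longrightarrow> \<nu> i \<le> \<kappa>" and eig: "\<And>i. i < 2 \<Longrightarrow> in_eigenspace G (\<nu> i) (u i)"
      and ind: "lin_indep_on (mg_points G) 2 u"
      using \<open>\<kappa> \<in> S\<close> by (auto simp: S_def)
    obtain u' where u: "\<And>i. i < 2 \<Longrightarrow> H1_graph G (u i) (u' i)"
      and w: "\<And>i g g'. i < 2 \<Longrightarrow> H1_graph G g g' \<Longrightarrow> mg_inner G (u' i) g' = \<nu> i * mg_inner G (u i) g"
      using eig unfolding in_eigenspace_def mg_inner_def by metis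
    \<comment> \<open>Testing with the constant 1: an eigenfunction of nonzero eigenvalue has mean
      zero and can be inserted into the Rayleigh bound.\<close>
    have mean: "\<nu> i * mg_integral G (u i) = 0" if "i < 2" for i
      using w[OF that H1_graph_const[of G 1]] mg_inner_scale_right[of G "u' i" 0 "\<lambda>x. 0"]
      by (simp add: mg_integral_eq_inner)
    have combo: "mg_inner G (\<lambda>x. a * u 0 x + b * u 1 x) (\<lambda>x. a * u 0 x + b * u 1 x) > 0" if "a \<noteq> 0 \<or> b \<noteq> 0" for a b
    proof (rule ccontr)
      assume "\<not> ?thesis"
      then have "mg_inner G (\<lambda>x. a * u 0 x + b * u 1 x) (\<lambda>x. a * u 0 x + b * u 1 x) = 0"
        using mg_inner_nonneg[of G "\<lambda>x. a * u 0 x + b * u 1 x"] by simp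
      from mg_inner_eq_0_imp[OF G H1_graph_add[OF H1_graph_scale[OF u] H1_graph_scale[OF u]] this]
      have "\<forall>x\<in>mg_points G. a * u 0 x + b * u 1 x = 0" by simp
      then have "\<forall>x\<in>mg_points G. (\<Sum>i<2. (if i = 0 then a else b) * u i x) = 0"
        by (simp add: numeral_2_eq_2)
      then have "\<forall>i<2. (if i = (0::nat) then a else b) = 0"
        using ind unfolding lin_indep_on_def by (elim allE[where x = "\<lambda>i. if i = 0 then a else b"]) simp
      from spec[OF this, of 0] spec[OF this, of 1] show False
        using that by simp
    qed
    show ?thesis
    proof (cases "\<exists>i<2. \<nu> i \<noteq> 0")
      case True
      then obtain i where i: "i < 2" "\<nu> i \<noteq> 0" by blast
      have p: "mg_inner G (u i) (u i) > 0"
        using combo[of 1 0] combo[of 0 1] i(1) by (auto simp: less_2_cases_iff)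
      have "mg_inner G f' f' * mg_inner G (u i) (u i) \<le> mg_inner G (u' i) (u' i)"
        using mean[OF i(1)] i by (intro min[OF u]) auto
      also have "\<dots> = \<nu> i * mg_inner G (u i) (u i)"
        by (rule w[OF i(1) u[OF i(1)]])
      finally have "mg_inner G f' f' \<le> \<nu> i" using p by simp
      with \<nu>[OF i(1)] show ?thesis by simp
    next
      case False
      then have \<nu>0: "\<nu> 0 = 0" "\<nu> 1 = 0" by auto
      \<comment> \<open>Both eigenvalues are zero, as happens on a disconnected graph. The
        coefficients cancel the means without both vanishing; the combination has energy zero but
        positive norm, so the minimum is at most zero.\<close>
      define a b where "a = (if mg_integral G (u 0) = 0 then 1 else - mg_integral G (u 1))"
        and "b = (if mg_integral G (u 0) = 0 then 0 else mg_integral G (u 0))"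
      have ab: "a \<noteq> 0 \<or> b \<noteq> 0" by (auto simp: a_def b_def)
      let ?g = "\<lambda>x. a * u 0 x + b * u 1 x" and ?g' = "\<lambda>x. a * u' 0 x + b * u' 1 x"
      have g: "H1_graph G ?g ?g'" by (intro H1_graph_add H1_graph_scale u) auto
      have Lu: "L2_graph G (u 0)" "L2_graph G (u 1)" "L2_graph G (u' 0)" "L2_graph G (u' 1)"
        by (rule H1_graph_L2[OF u]; simp)+
      have "mg_integral G ?g = a * mg_integral G (u 0) + b * mg_integral G (u 1)"
        unfolding mg_integral_eq_inner
        by (simp add: mg_inner_add_left L2_graph_scale Lu L2_graph_const mg_inner_scale_left del: One_nat_def)
      then have "mg_integral G ?g = 0" by (simp add: a_def b_def)
      then have "mg_inner G f' f' * mg_inner G ?g ?g \<le> mg_inner G ?g' ?g'" by (rule min[OF g])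
      also have "mg_inner G ?g' ?g' = a * mg_inner G (u' 0) ?g' + b * mg_inner G (u' 1) ?g'"
        by (simp add: mg_inner_add_left L2_graph_add L2_graph_scale Lu mg_inner_scale_left del: One_nat_def)
      also have "\<dots> = 0"
        using w[OF _ g, of 0] w[OF _ g, of 1] \<nu>0 by simp
      finally have "mg_inner G f' f' \<le> 0"
        using combo[OF ab] by (simp add: mult_le_0_iff)
      then show ?thesis using \<nu>[of 0] \<nu>0 by simp
    qed
  qed
  ultimately have "Inf S = mg_inner G f' f'"
    by (rule cInf_eq_minimum)
  then have "mg_eigenvalue G 2 = mg_inner G f' f'"
    by (simp add: mg_eigenvalue_def S_def)
  then show ?thesis using f min weak by metis
qed

section \<open>Trails\<close>

text \<open>An arc is stored with its lower parameter first, whichever way a trail runs through it.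
  The two nodes are consecutive on the edge, so distinct arcs can meet only at nodes.\<close>

definition mg_arcs :: "('e \<times> real) set \<Rightarrow> ('e \<times> real \<times> real) set" where
  "mg_arcs N = {(e, a, b). a < b \<and> (e, a) \<in> N \<and> (e, b) \<in> N \<and> (\<forall>c. a < c \<and> c < b \<longrightarrow> (e, c) \<notin> N)}"

text \<open>
  A trail joins nodes from the finite set \<open>N\<close>; it is recorded by its set of arcs, each of which it
  traverses once.
\<close>

inductive trail :: "('v, 'e) metric_graph \<Rightarrow> ('e \<times> real) set \<Rightarrow> 'e \<times> real \<Rightarrow>
    ('e \<times> real \<times> real) set \<Rightarrow> 'e \<times> real \<Rightarrow> bool"
  for G :: "('v, 'e) metric_graph" and N :: "('e \<times> real) set" and x :: "'e \<times> real" where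
  start: "trail G N x {} x"
| forward: "trail G N x A (e, a) \<Longrightarrow> (e, a, b) \<in> mg_arcs N \<Longrightarrow> (e, a, b) \<notin> A
    \<Longrightarrow> trail G N x (insert (e, a, b) A) (e, b)"
| backward: "trail G N x A (e, b) \<Longrightarrow> (e, a, b) \<in> mg_arcs N \<Longrightarrow> (e, a, b) \<notin> A
    \<Longrightarrow> trail G N x (insert (e, a, b) A) (e, a)"
| glue: "trail G N x A y \<Longrightarrow> glued G y z \<Longrightarrow> z \<in> N \<Longrightarrow> trail G N x A z"

definition arcs_length :: "('e \<times> real \<times> real) set \<Rightarrow> real" where
  "arcs_length A = (\<Sum>(e, a, b)\<in>A. b - a)"

lemma finite_mg_arcs:
  assumes "finite N"
  shows "finite (mg_arcs N)"
proof (rule finite_subset)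
  show "mg_arcs N \<subseteq> (\<lambda>(p, q). (fst p, snd p, snd q)) ` (N \<times> N)"
    by (force simp: mg_arcs_def)
qed (use assms in auto)

lemma trail_arcs: "trail G N x A y \<Longrightarrow> A \<subseteq> mg_arcs N"
  by (induction rule: trail.induct) auto

lemma trail_finite: "trail G N x A y \<Longrightarrow> finite A"
  by (induction rule: trail.induct) auto

lemma trail_end: "trail G N x A y \<Longrightarrow> x \<in> N \<Longrightarrow> y \<in> N"
  by (induction rule: trail.induct) (auto simp: mg_arcs_def)

lemma arcs_length_mono:
  assumes "A' \<subseteq> A" "A \<subseteq> mg_arcs N" "finite A"
  shows "arcs_length A' \<le> arcs_length A"
  unfolding arcs_length_def
  using assms by (intro sum_mono2) (auto simp: mg_arcs_def)

lemma arcs_length_insert: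
  "finite A \<Longrightarrow> (e, a, b) \<notin> A \<Longrightarrow> arcs_length (insert (e, a, b) A) = b - a + arcs_length A"
  by (simp add: arcs_length_def)

text \<open>A trail containing an arc has been at both of its ends, and stopping it there uses only
  some of its arcs. This is what allows a repeated arc to be cut out.\<close>

lemma trail_visits:
  assumes "trail G N x A y" "(e, a, b) \<in> A"
  shows "(\<exists>A'\<subseteq>A. trail G N x A' (e, a)) \<and> (\<exists>A'\<subseteq>A. trail G N x A' (e, b))"
  using assms
proof (induction rule: trail.induct)
  case (forward A e' a' b')
  show ?case
  proof (cases "(e, a, b) = (e', a', b')")
    case True
    then show ?thesis using forward.hyps trail.forward[OF forward.hyps] by blast
  next
    case False
    then show ?thesis using forward by blast
  qed
next
  case (backward A e' b' a')
  show ?case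
  proof (cases "(e, a, b) = (e', a', b')")
    case True
    then show ?thesis using backward.hyps trail.backward[OF backward.hyps] by blast
  next
    case False
    then show ?thesis using backward by blast
  qed
qed auto

text \<open>A new arc is appended. For an arc already used, the trail is shortened to an earlier
  visit of the target node, which costs no extra length; thus arcs stay distinct and the length of a
  path is not exceeded.\<close>

lemma trail_arc_step:
  assumes "trail G N x A p" "(e, a, b) \<in> mg_arcs N" "{p, q} = {(e, a), (e, b)}"
  shows "\<exists>A'. trail G N x A' q \<and> arcs_length A' \<le> arcs_length A + (b - a)"
proof -
  have ab: "a < b" using assms(2) by (simp add: mg_arcs_def)
  have pq: "p = (e, a) \<and> q = (e, b) \<or> p = (e, b) \<and> q = (e, a)"
    using assms(3) by (auto simp: doubleton_eq_iff)
  show ?thesis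
  proof (cases "(e, a, b) \<in> A")
    case True
    then obtain A' where A': "A' \<subseteq> A" "trail G N x A' q"
      using trail_visits[OF assms(1) True] pq by blast
    then have "arcs_length A' \<le> arcs_length A"
      using trail_arcs[OF assms(1)] trail_finite[OF assms(1)] by (intro arcs_length_mono)
    then show ?thesis using A' ab by (intro exI[of _ A']) auto
  next
    case False
    have "trail G N x (insert (e, a, b) A) q"
      using pq assms(1,2) False by (auto intro: trail.forward trail.backward)
    then show ?thesis
      using arcs_length_insert[OF trail_finite[OF assms(1)] False] by (intro exI[of _ "insert (e, a, b) A"]) auto
  qed
qed

text \<open>Induction on the number of nodes strictly between the two parameters: with none there is
  a single arc, otherwise the way splits at a node in between.\<close>

lemma trail_along_edge:
  assumes N: "finite N" and "trail G N x A (e, s)" "(e, s) \<in> N" "(e, t) \<in> N"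
  shows "\<exists>A'. trail G N x A' (e, t) \<and> arcs_length A' \<le> arcs_length A + \<bar>s - t\<bar>"
  using assms(2-)
proof (induction "card {c. (e, c) \<in> N \<and> min s t < c \<and> c < max s t}" arbitrary: s t A rule: less_induct)
  case less
  let ?B = "\<lambda>s t. {c. (e, c) \<in> N \<and> min s t < c \<and> c < max s t}"
  have fin: "finite (?B s t)" for s t
    by (rule finite_subset[of _ "snd ` N"]) (use N in \<open>force+\<close>)
  show ?case
  proof (cases "s = t \<or> ?B s t = {}")
    case True
    show ?thesis
    proof (cases "s = t")
      case True
      then show ?thesis using less.prems by auto
    next
      case False
      then have "(e, min s t, max s t) \<in> mg_arcs N"
        using True less.prems by (auto simp: mg_arcs_def min_def max_def)
      moreover have "{(e, s), (e, t)} = {(e, min s t), (e, max s t)}"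
        by (auto simp: min_def max_def)
      ultimately have "\<exists>A'. trail G N x A' (e, t) \<and> arcs_length A' \<le> arcs_length A + (max s t - min s t)"
        by (rule trail_arc_step[OF less.prems(1)])
      moreover have "max s t - min s t = \<bar>s - t\<bar>" by (simp add: min_def max_def)
      ultimately show ?thesis by simp
    qed
  next
    case False
    then obtain c where c: "c \<in> ?B s t" by blast
    have st: "min s t < c" "c < max s t" using c by auto
    have "?B s c \<subseteq> ?B s t"
    proof
      fix d assume d: "d \<in> ?B s c"
      then have "min s c < d" "d < max s c" by auto
      then have "min s t < d" "d < max s t" using st by linarith+
      then show "d \<in> ?B s t" using d by simp
    qed
    moreover have "?B c t \<subseteq> ?B s t"
    proof
      fix d assume d: "d \<in> ?B c t"
      then have "min c t < d" "d < max c t" by auto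
      then have "min s t < d" "d < max s t" using st by linarith+
      then show "d \<in> ?B s t" using d by simp
    qed
    moreover have "c \<notin> ?B s c" "c \<notin> ?B c t" by auto
    ultimately have "?B s c \<subset> ?B s t" "?B c t \<subset> ?B s t" using c by blast+
    then have card: "card (?B s c) < card (?B s t)" "card (?B c t) < card (?B s t)"
      using fin by (auto intro!: psubset_card_mono)
    obtain A1 where A1: "trail G N x A1 (e, c)" "arcs_length A1 \<le> arcs_length A + \<bar>s - c\<bar>"
      using less.hyps[OF card(1) less.prems(1,2)] c by auto
    obtain A2 where "trail G N x A2 (e, t)" "arcs_length A2 \<le> arcs_length A1 + \<bar>c - t\<bar>"
      using less.hyps[OF card(2) A1(1)] c less.prems(3) by auto
    moreover have "\<bar>s - c\<bar> + \<bar>c - t\<bar> = \<bar>s - t\<bar>" using c by (auto simp: min_def max_def split: if_splits)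
    ultimately show ?thesis using A1 by (intro exI[of _ A2]) auto
  qed
qed

lemma endpoint_at_cases:
  assumes "endpoint_at G v x"
  obtains e where "e \<in> edges G" "x = (e, 0)" | e where "e \<in> edges G" "x = (e, len G e)"
  using assms by (auto simp: endpoint_at_def)

text \<open>A path may stop inside an edge, where no trail can end. The claim is therefore made for
  every node \<open>k\<close> on the current edge, at the extra cost of its distance to the current
  point; a segment step is then the triangle inequality, and proper gluing takes place at edge ends,
  which are nodes.\<close>

lemma trail_of_path:
  assumes N: "finite N" and ends: "\<And>e. e \<in> edges G \<Longrightarrow> (e, 0) \<in> N \<and> (e, len G e) \<in> N" and x: "x \<in> N"
    and path: "mg_path G x r y"
  shows "(fst y, k) \<in> N \<Longrightarrow> \<exists>A. trail G N x A (fst y, k) \<and> arcs_length A \<le> r + \<bar>snd y - k\<bar>"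
  using path
proof (induction arbitrary: k rule: mg_path.induct)
  case start
  have "trail G N x {} (fst x, snd x)" "(fst x, snd x) \<in> N"
    using trail.start[of G N x] x by simp_all
  from trail_along_edge[OF N this start.prems] show ?case
    by (simp add: arcs_length_def)
next
  case (segment r e s t)
  then obtain A where "trail G N x A (e, k)" "arcs_length A \<le> r + \<bar>s - k\<bar>"
    by auto
  then show ?case by (intro exI[of _ A]) auto
next
  case (glue r y z)
  show ?case
  \<comment> \<open>\<open>glued\<close> is reflexive, so in the first case \<open>y\<close> may be
    an interior point that is not a node.\<close>
  proof (cases "y = z")
    case True
    then show ?thesis using glue by blast
  next
    case False
    then obtain v where "endpoint_at G v y" "endpoint_at G v z" using glue.hyps by (auto simp: glued_def)
    then have yz: "y \<in> N" "z \<in> N" using ends by (metis endpoint_at_cases)+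
    then obtain A where A: "trail G N x A y" "arcs_length A \<le> r"
      using glue.IH[of "snd y"] by auto
    then have "trail G N x A (fst z, snd z)" using trail.glue[OF A(1) glue.hyps(2) yz(2)] by simp
    from trail_along_edge[OF N this _ glue.prems] show ?thesis using yz A(2) by fastforce
  qed
qed

text \<open>A trail to \<open>y\<close> has one of finitely many arc sets, so there is a least
  length. Every path dominates it, and so does their infimum.\<close>

lemma shortest_trail:
  assumes N: "finite N" and ends: "\<And>e. e \<in> edges G \<Longrightarrow> (e, 0) \<in> N \<and> (e, len G e) \<in> N"
    and x: "x \<in> N" and y: "y \<in> N" and ex: "\<exists>r. mg_path G x r y"
  shows "\<exists>A. trail G N x A y \<and> arcs_length A \<le> mg_dist G x y"
proof -
  let ?T = "{A. trail G N x A y}"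
  have fin: "finite ?T"
    by (rule finite_subset[of _ "Pow (mg_arcs N)"]) (use finite_mg_arcs[OF N] in \<open>auto dest!: trail_arcs\<close>)
  have le: "\<exists>A\<in>?T. arcs_length A \<le> r" if "mg_path G x r y" for r
    using trail_of_path[OF N ends x that, of "snd y"] y by auto
  then have ne: "?T \<noteq> {}" using ex by blast
  define l where "l = Min (arcs_length ` ?T)"
  have "l \<in> arcs_length ` ?T" unfolding l_def using fin ne by (intro Min_in) auto
  then obtain A where A: "trail G N x A y" "arcs_length A = l" by auto
  have "l \<le> mg_dist G x y"
    unfolding mg_dist_def
  proof (rule cInf_greatest)
    show "{r. mg_path G x r y} \<noteq> {}" using ex by blast
    fix r assume "r \<in> {r. mg_path G x r y}"
    then obtain B where "B \<in> ?T" "arcs_length B \<le> r" using le by blast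
    moreover have "l \<le> arcs_length B" unfolding l_def using fin \<open>B \<in> ?T\<close> by (intro Min_le) auto
    ultimately show "l \<le> r" by simp
  qed
  with A show ?thesis by blast
qed

section \<open>Segments with disjoint interiors\<close>

definition separated_segments :: "('v, 'e) metric_graph \<Rightarrow> ('e \<times> real \<times> real) set \<Rightarrow> bool" where
  "separated_segments G S \<longleftrightarrow> finite S \<and>
     (\<forall>(e, a, b)\<in>S. e \<in> edges G \<and> 0 \<le> a \<and> a < b \<and> b \<le> len G e) \<and>
     (\<forall>e a b a' b'. (e, a, b) \<in> S \<longrightarrow> (e, a', b') \<in> S \<longrightarrow> (a, b) \<noteq> (a', b') \<longrightarrow> {a<..<b} \<inter> {a'<..<b'} = {})"

text \<open>If two arcs of an edge shared an interior point, differing ends would place a node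
  strictly inside one of them.\<close>

lemma separated_segments_arcs:
  assumes N: "N \<subseteq> mg_points G" and S: "S \<subseteq> mg_arcs N" "finite S"
  shows "separated_segments G S"
  unfolding separated_segments_def
proof (intro conjI allI impI)
  show "\<forall>(e, a, b)\<in>S. e \<in> edges G \<and> 0 \<le> a \<and> a < b \<and> b \<le> len G e"
    using assms by (fastforce simp: mg_arcs_def mg_points_def)
  fix e a b a' b' assume 1: "(e, a, b) \<in> S" "(e, a', b') \<in> S" and ne: "(a, b) \<noteq> (a', b')"
  then have *: "(e, a, b) \<in> mg_arcs N" "(e, a', b') \<in> mg_arcs N" using S by auto
  show "{a<..<b} \<inter> {a'<..<b'} = {}"
  proof (rule ccontr)
    assume "{a<..<b} \<inter> {a'<..<b'} \<noteq> {}"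
    then obtain t where "t \<in> {a<..<b} \<inter> {a'<..<b'}" by blast
    then have t: "a < t" "t < b" "a' < t" "t < b'" by simp_all
    have "a = a'" using * t by (auto simp: mg_arcs_def) (meson less_linear less_trans)
    moreover have "b = b'" using * t by (auto simp: mg_arcs_def) (meson less_linear less_trans)
    ultimately show False using ne by simp
  qed
qed fact

text \<open>Grouped by edges, the segments are replaced by their open interiors, which are disjoint
  and carry the same integrals. The segments are arbitrary rather than arcs because a further
  segment off the trail has to be added to them.\<close>

lemma separated_segments_integral_le:
  assumes G: "compact_metric_graph G" and S: "separated_segments G S"
    and int: "\<And>e. e \<in> edges G \<Longrightarrow> set_integrable lborel {0..len G e} (\<lambda>t. k (e, t))"
    and nonneg: "\<And>x. x \<in> mg_points G \<Longrightarrow> 0 \<le> k x"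
  shows "(\<Sum>(e, a, b)\<in>S. LBINT t:{a..b}. k (e, t)) \<le> mg_integral G k"
proof -
  have fin: "finite S" "finite (edges G)" using S G by (auto simp: separated_segments_def compact_metric_graph_def)
  have seg: "\<And>e a b. (e, a, b) \<in> S \<Longrightarrow> e \<in> edges G \<and> 0 \<le> a \<and> a < b \<and> b \<le> len G e"
    using S by (auto simp: separated_segments_def)
  let ?F = "\<lambda>(e, a, b). LBINT t:{a..b}. k (e, t)"
  have "(\<Sum>s\<in>S. ?F s) = (\<Sum>e\<in>edges G. \<Sum>s\<in>{s\<in>S. fst s = e}. ?F s)"
    using fin seg by (intro sum.group[symmetric]) auto
  also have "\<dots> \<le> (\<Sum>e\<in>edges G. LBINT t:{0..len G e}. k (e, t))"
  proof (rule sum_mono)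
    fix e assume e: "e \<in> edges G"
    let ?S = "{s\<in>S. fst s = e}"
    let ?I = "\<lambda>s. {fst (snd s)<..<snd (snd s)}"
    have sub: "?I s \<subseteq> {0..len G e}" if "s \<in> ?S" for s
      using that seg[of e "fst (snd s)" "snd (snd s)"] by auto
    have "(\<Sum>s\<in>?S. ?F s) = (\<Sum>s\<in>?S. LBINT t:?I s. k (e, t))"
      by (intro sum.cong) (auto simp: set_integral_Ioo_eq_Icc)
    also have "\<dots> = (LBINT t:(\<Union>s\<in>?S. ?I s). k (e, t))"
    proof (rule set_integral_finite_Union[symmetric])
      show "disjoint_family_on ?I ?S"
        using S unfolding disjoint_family_on_def separated_segments_def by (auto split: prod.splits)
      show "set_integrable lborel (?I s) (\<lambda>t. k (e, t))" if "s \<in> ?S" for s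
        by (rule set_integrable_subset[OF int[OF e]]) (use sub[OF that] in auto)
    qed (use fin in auto)
    also have "\<dots> \<le> (LBINT t:{0..len G e}. k (e, t))"
    proof (rule set_integral_mono_set_nonneg[OF int[OF e]])
      show "(\<Union>s\<in>?S. ?I s) \<subseteq> {0..len G e}" using sub by blast
      show "(\<Union>s\<in>?S. ?I s) \<in> sets lborel" using fin by (intro sets.finite_UN) auto
      show "0 \<le> k (e, t)" if "t \<in> {0..len G e}" for t
        using that e by (intro nonneg) (auto simp: mg_points_def)
    qed
    finally show "(\<Sum>s\<in>?S. ?F s) \<le> (LBINT t:{0..len G e}. k (e, t))" .
  qed
  finally show ?thesis by (simp add: mg_integral_def)
qed

lemma separated_segments_length_le:
  assumes G: "compact_metric_graph G" and S: "separated_segments G S"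
  shows "arcs_length S \<le> total_length G"
proof -
  have "(\<Sum>(e, a, b)\<in>S. LBINT t:{a..b}. (\<lambda>x. 1) (e, t)) \<le> mg_integral G (\<lambda>x. 1)"
    by (rule separated_segments_integral_le[OF assms]) (auto intro: borel_integrable_atLeastAtMost')
  moreover have "(\<Sum>(e, a, b)\<in>S. LBINT t:{a..b}. (\<lambda>x. 1) (e, t)) = arcs_length S"
    using S unfolding arcs_length_def
    by (intro sum.cong) (auto simp: separated_segments_def set_lebesgue_integral_def)
  ultimately show ?thesis using mg_integral_const[OF G, of 1] by simp
qed

text \<open>If the closed segments covered the interior of every edge, subadditivity of measure
  would make their lengths add up to the total length. An uncovered point has a neighbourhood free
  of them, since finitely many closed intervals leave an open complement.\<close>

lemma exists_free_segment:
  assumes G: "compact_metric_graph G" and S: "separated_segments G S" and lt: "arcs_length S < total_length G"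
  shows "\<exists>e p q. (e, p, q) \<notin> S \<and> p < q \<and> separated_segments G (insert (e, p, q) S)"
proof -
  have fin: "finite S" "finite (edges G)" using S G by (auto simp: separated_segments_def compact_metric_graph_def)
  have seg: "\<And>e a b. (e, a, b) \<in> S \<Longrightarrow> e \<in> edges G \<and> 0 \<le> a \<and> a < b \<and> b \<le> len G e"
    using S by (auto simp: separated_segments_def)
  let ?S = "\<lambda>e. {s\<in>S. fst s = e}"
  let ?I = "\<lambda>s. {fst (snd s)..snd (snd s)}"
  have "\<exists>e\<in>edges G. \<not> {0<..<len G e} \<subseteq> (\<Union>s\<in>?S e. ?I s)"
  proof (rule ccontr)
    assume "\<not> ?thesis"
    then have cover: "{0<..<len G e} \<subseteq> (\<Union>s\<in>?S e. ?I s)" if "e \<in> edges G" for e using that by blast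
    have "total_length G \<le> (\<Sum>e\<in>edges G. \<Sum>s\<in>?S e. snd (snd s) - fst (snd s))"
      unfolding total_length_def
    proof (rule sum_mono)
      fix e assume e: "e \<in> edges G"
      have "len G e = measure lborel {0<..<len G e}"
        using G e by (simp add: compact_metric_graph_def less_imp_le)
      also have "\<dots> \<le> measure lborel (\<Union>s\<in>?S e. ?I s)"
      proof (rule measure_mono_fmeasurable[OF cover[OF e]])
        show "(\<Union>s\<in>?S e. ?I s) \<in> fmeasurable lborel"
          using fin by (intro fmeasurable.finite_UN) (auto intro!: fmeasurableI simp: emeasure_lborel_Icc_eq)
      qed auto
      also have "\<dots> \<le> (\<Sum>s\<in>?S e. measure lborel (?I s))"
        using fin by (intro measure_UNION_le) auto
      also have "\<dots> = (\<Sum>s\<in>?S e. snd (snd s) - fst (snd s))"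
        using seg by (intro sum.cong) (force simp: less_imp_le)+
      finally show "len G e \<le> (\<Sum>s\<in>?S e. snd (snd s) - fst (snd s))" .
    qed
    also have "\<dots> = (\<Sum>s\<in>S. snd (snd s) - fst (snd s))"
      using fin seg by (intro sum.group) auto
    also have "\<dots> = arcs_length S" by (simp add: arcs_length_def case_prod_beta)
    finally show False using lt by simp
  qed
  then obtain e t where e: "e \<in> edges G" and t: "t \<in> {0<..<len G e} - (\<Union>s\<in>?S e. ?I s)" by blast
  have "open ({0<..<len G e} - (\<Union>s\<in>?S e. ?I s))"
    using fin by (intro open_Diff closed_UN) auto
  then obtain \<epsilon> where \<epsilon>: "\<epsilon> > 0" "ball t \<epsilon> \<subseteq> {0<..<len G e} - (\<Union>s\<in>?S e. ?I s)"
    using t by (meson openE)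
  \<comment> \<open>Half the radius, so that the closed segment still lies in the open ball.\<close>
  define p q where "p = t - \<epsilon> / 2" and "q = t + \<epsilon> / 2"
  have pq: "{p..q} \<subseteq> {0<..<len G e} - (\<Union>s\<in>?S e. ?I s)"
    using \<epsilon> by (intro order_trans[OF _ \<epsilon>(2)]) (auto simp: p_def q_def dist_real_def)
  have lt: "p < q" using \<epsilon> by (simp add: p_def q_def)
  have disj: "{p..q} \<inter> {a..b} = {}" if "(e, a, b) \<in> S" for a b
  proof -
    have "(e, a, b) \<in> ?S e" using that by simp
    then have "?I (e, a, b) \<subseteq> (\<Union>s\<in>?S e. ?I s)" by (rule UN_upper)
    then have "{a..b} \<subseteq> (\<Union>s\<in>?S e. ?I s)" by simp
    then show ?thesis using pq by blast
  qed
  have "(e, p, q) \<notin> S" using disj[of p q] lt by auto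
  moreover have "separated_segments G (insert (e, p, q) S)"
    unfolding separated_segments_def
  proof (intro conjI allI impI)
    have "p \<in> {p..q}" "q \<in> {p..q}" using lt by auto
    then have "0 < p" "q < len G e" using pq by auto
    then have "e \<in> edges G \<and> 0 \<le> p \<and> p < q \<and> q \<le> len G e" using lt e by simp
    then show "\<forall>(e, a, b)\<in>insert (e, p, q) S. e \<in> edges G \<and> 0 \<le> a \<and> a < b \<and> b \<le> len G e"
      using S unfolding separated_segments_def by blast
    fix e' a b a' b' assume 1: "(e', a, b) \<in> insert (e, p, q) S" "(e', a', b') \<in> insert (e, p, q) S" "(a, b) \<noteq> (a', b')"
    have op: "{c<..<d} \<inter> {c'<..<d'} = {}" if "{c..d} \<inter> {c'..d'} = {}" for c d c' d' :: real
      using that by fastforce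
    show "{a<..<b} \<inter> {a'<..<b'} = {}"
    proof (cases "(e', a, b) \<in> S \<and> (e', a', b') \<in> S")
      case True
      then show ?thesis using S 1(3) unfolding separated_segments_def by blast
    next
      case False
      then consider "a = p" "b = q" "(e, a', b') \<in> S" | "a' = p" "b' = q" "(e, a, b) \<in> S"
        using 1 by auto
      then show ?thesis
      proof cases
        case 1
        then show ?thesis using op[OF disj[OF 1(3)]] by simp
      next
        case 2
        then show ?thesis using op[OF disj[OF 2(3)]] by (simp add: Int_commute)
      qed
    qed
  qed (use fin in auto)
  ultimately show ?thesis using lt by blast
qed

section \<open>Distances and the diameter\<close>

lemma trail_path:
  assumes x: "x \<in> mg_points G" and N: "N \<subseteq> mg_points G" and "trail G N x A y"
  shows "mg_path G x (arcs_length A) y"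
  using assms(3)
proof (induction rule: trail.induct)
  case start
  then show ?case using mg_path.start[OF x] by (simp add: arcs_length_def)
next
  case (forward A e a b)
  have "b \<in> {0..len G e}" "a < b" using forward.hyps(2) N by (auto simp: mg_arcs_def mg_points_def)
  then show ?case
    using mg_path.segment[OF forward.IH, of b] arcs_length_insert[OF trail_finite[OF forward.hyps(1)] forward.hyps(3)]
    by (simp add: add.commute)
next
  case (backward A e b a)
  have "a \<in> {0..len G e}" "a < b" using backward.hyps(2) N by (auto simp: mg_arcs_def mg_points_def)
  then show ?case
    using mg_path.segment[OF backward.IH, of a] arcs_length_insert[OF trail_finite[OF backward.hyps(1)] backward.hyps(3)]
    by (simp add: add.commute)
next
  case (glue A y z)
  then show ?case using mg_path.glue by blast
qed

lemma mg_path_nonneg: "mg_path G x r y \<Longrightarrow> 0 \<le> r"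
  by (induction rule: mg_path.induct) auto

lemma mg_dist_le: "mg_path G x r y \<Longrightarrow> mg_dist G x y \<le> r"
  unfolding mg_dist_def by (intro cInf_lower bdd_belowI[of _ 0]) (auto dest: mg_path_nonneg)

lemma trail_between:
  assumes G: "compact_metric_graph G" and conn: "mg_connected G" and x: "x \<in> mg_points G" and y: "y \<in> mg_points G"
  shows "\<exists>N A. finite N \<and> N \<subseteq> mg_points G \<and> x \<in> N \<and> trail G N x A y \<and> arcs_length A \<le> mg_dist G x y"
proof -
  define N where "N = {x, y} \<union> (\<lambda>e. (e, 0)) ` edges G \<union> (\<lambda>e. (e, len G e)) ` edges G"
  have N: "finite N" "N \<subseteq> mg_points G"
    using G x y by (auto simp: N_def compact_metric_graph_def mg_points_def less_imp_le)
  have "\<exists>A. trail G N x A y \<and> arcs_length A \<le> mg_dist G x y"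
    by (rule shortest_trail[OF N(1)]) (use conn x y in \<open>auto simp: N_def mg_connected_def\<close>)
  moreover have "x \<in> N" by (simp add: N_def)
  ultimately show ?thesis using N by blast
qed

text \<open>The arcs of a trail are disjoint pieces of the graph. The bound is needed because
  \<open>mg_diameter\<close> is a supremum of reals and dominates the distances only when they are
  bounded.\<close>

lemma mg_dist_le_total_length:
  assumes G: "compact_metric_graph G" and conn: "mg_connected G" and x: "x \<in> mg_points G" and y: "y \<in> mg_points G"
  shows "mg_dist G x y \<le> total_length G"
proof -
  obtain N A where N: "finite N" "N \<subseteq> mg_points G" and A: "trail G N x A y"
    using trail_between[OF assms] by blast
  have "mg_dist G x y \<le> arcs_length A" by (rule mg_dist_le[OF trail_path[OF x N(2) A]])
  also have "\<dots> \<le> total_length G"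
    by (intro separated_segments_length_le[OF G] separated_segments_arcs[OF N(2)] trail_arcs[OF A] trail_finite[OF A])
  finally show ?thesis .
qed

lemma mg_dist_le_diameter:
  assumes G: "compact_metric_graph G" and conn: "mg_connected G" and x: "x \<in> mg_points G" and y: "y \<in> mg_points G"
  shows "mg_dist G x y \<le> mg_diameter G"
proof -
  have "bdd_above ((\<lambda>(x, y). mg_dist G x y) ` (mg_points G \<times> mg_points G))"
    by (rule bdd_aboveI[of _ "total_length G"]) (auto intro: mg_dist_le_total_length[OF G conn])
  from cSUP_upper[OF _ this, of "(x, y)"] show ?thesis
    using x y by (simp add: mg_diameter_def)
qed

section \<open>The lower bound\<close>

lemma abs_mult_less_half_pi:
  assumes "\<bar>T\<bar> \<le> D / 2" "0 < \<omega>" "\<omega> * D < pi"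
  shows "\<bar>\<omega> * T\<bar> < pi / 2"
proof -
  have "\<bar>\<omega> * T\<bar> \<le> \<omega> * (D / 2)"
    using assms by (simp only: abs_mult abs_of_pos) (intro mult_left_mono, auto)
  also have "\<dots> < pi / 2" using assms(3) by simp
  finally show ?thesis .
qed

text \<open>The time of the calibration is the length travelled so far minus D/2, so it stays within
  [-D/2, D/2]. The contributions of the arcs telescope, with \<sigma> = 1 or -1 according to
  direction, and gluing changes neither the time nor the value of u.\<close>

lemma trail_calibration:
  assumes u: "H1_graph G u u'" and N: "N \<subseteq> mg_points G" and x: "x \<in> N"
    and A: "trail G N x A y" and len: "arcs_length A \<le> D" and \<omega>: "0 < \<omega>" "\<omega> * D < pi"
  shows "cal \<omega> a (u y) (arcs_length A - D / 2) - cal \<omega> a (u x) (- D / 2)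
    \<le> (\<Sum>(e, \<alpha>, \<beta>)\<in>A. LBINT t:{\<alpha>..\<beta>}. (u' (e, t))\<^sup>2 - \<omega>\<^sup>2 * (u (e, t))\<^sup>2)"
  using A len
proof (induction rule: trail.induct)
  case start
  then show ?case by (simp add: arcs_length_def)
next
  case (glue A y z)
  have "u y = u z"
    using trail_end[OF glue.hyps(1) x] glue.hyps N by (intro H1_graph_glued[OF u]) auto
  then show ?case using glue by simp
next
  case (forward A e \<alpha> \<beta>)
  have fin: "finite A" by (rule trail_finite[OF forward.hyps(1)])
  have arc: "e \<in> edges G" "0 \<le> \<alpha>" "\<alpha> < \<beta>" "\<beta> \<le> len G e"
    using forward.hyps(2) N by (auto simp: mg_arcs_def mg_points_def)
  have l: "arcs_length (insert (e, \<alpha>, \<beta>) A) = \<beta> - \<alpha> + arcs_length A"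
    by (rule arcs_length_insert[OF fin forward.hyps(3)])
  have l0: "0 \<le> arcs_length A"
    using arcs_length_mono[of "{}" A N] trail_arcs[OF forward.hyps(1)] fin by (simp add: arcs_length_def)
  let ?\<tau> = "arcs_length A - D / 2 - \<alpha>"
  have "1 * (cal \<omega> a (u (e, \<beta>)) (?\<tau> + 1 * \<beta>) - cal \<omega> a (u (e, \<alpha>)) (?\<tau> + 1 * \<alpha>))
      \<le> (LBINT t:{\<alpha>..\<beta>}. (u' (e, t))\<^sup>2 - \<omega>\<^sup>2 * (u (e, t))\<^sup>2)"
  proof (rule cal_le_integral)
    show "AC_on \<alpha> \<beta> (\<lambda>t. u (e, t)) (\<lambda>t. u' (e, t))"
      using arc by (intro AC_on_subset[OF H1_graph_AC(1)[OF u]])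
    show "set_integrable lborel {\<alpha>..\<beta>} (\<lambda>t. (u' (e, t))\<^sup>2)"
      by (rule set_integrable_subset[OF H1_graph_AC(2)[OF u arc(1)]]) (use arc in auto)
    fix t assume t: "t \<in> {\<alpha>..\<beta>}"
    have "\<bar>?\<tau> + 1 * t\<bar> \<le> D / 2" using t l l0 forward.prems unfolding abs_le_iff by auto
    then show "\<bar>\<omega> * (?\<tau> + 1 * t)\<bar> < pi / 2" by (rule abs_mult_less_half_pi[OF _ \<omega>])
  qed (use arc in auto)
  moreover have "cal \<omega> a (u (e, \<alpha>)) (arcs_length A - D / 2) - cal \<omega> a (u x) (- D / 2)
    \<le> (\<Sum>(e, \<alpha>, \<beta>)\<in>A. LBINT t:{\<alpha>..\<beta>}. (u' (e, t))\<^sup>2 - \<omega>\<^sup>2 * (u (e, t))\<^sup>2)"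
    using forward l arc by auto
  ultimately show ?case using fin forward.hyps(3) unfolding l by (simp add: algebra_simps)
next
  case (backward A e \<beta> \<alpha>)
  have fin: "finite A" by (rule trail_finite[OF backward.hyps(1)])
  have arc: "e \<in> edges G" "0 \<le> \<alpha>" "\<alpha> < \<beta>" "\<beta> \<le> len G e"
    using backward.hyps(2) N by (auto simp: mg_arcs_def mg_points_def)
  have l: "arcs_length (insert (e, \<alpha>, \<beta>) A) = \<beta> - \<alpha> + arcs_length A"
    by (rule arcs_length_insert[OF fin backward.hyps(3)])
  have l0: "0 \<le> arcs_length A"
    using arcs_length_mono[of "{}" A N] trail_arcs[OF backward.hyps(1)] fin by (simp add: arcs_length_def)
  let ?\<tau> = "arcs_length A - D / 2 + \<beta>"
  have "(-1) * (cal \<omega> a (u (e, \<beta>)) (?\<tau> + (-1) * \<beta>) - cal \<omega> a (u (e, \<alpha>)) (?\<tau> + (-1) * \<alpha>))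
      \<le> (LBINT t:{\<alpha>..\<beta>}. (u' (e, t))\<^sup>2 - \<omega>\<^sup>2 * (u (e, t))\<^sup>2)"
  proof (rule cal_le_integral)
    show "AC_on \<alpha> \<beta> (\<lambda>t. u (e, t)) (\<lambda>t. u' (e, t))"
      using arc by (intro AC_on_subset[OF H1_graph_AC(1)[OF u]])
    show "set_integrable lborel {\<alpha>..\<beta>} (\<lambda>t. (u' (e, t))\<^sup>2)"
      by (rule set_integrable_subset[OF H1_graph_AC(2)[OF u arc(1)]]) (use arc in auto)
    fix t assume t: "t \<in> {\<alpha>..\<beta>}"
    have "\<bar>?\<tau> + (-1) * t\<bar> \<le> D / 2" using t l l0 backward.prems unfolding abs_le_iff by auto
    then show "\<bar>\<omega> * (?\<tau> + (-1) * t)\<bar> < pi / 2" by (rule abs_mult_less_half_pi[OF _ \<omega>])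
  qed (use arc in auto)
  moreover have "cal \<omega> a (u (e, \<beta>)) (arcs_length A - D / 2) - cal \<omega> a (u x) (- D / 2)
    \<le> (\<Sum>(e, \<alpha>, \<beta>)\<in>A. LBINT t:{\<alpha>..\<beta>}. (u' (e, t))\<^sup>2 - \<omega>\<^sup>2 * (u (e, t))\<^sup>2)"
    using backward l arc by auto
  ultimately show ?case using fin backward.hyps(3) unfolding l by (simp add: algebra_simps)
qed

lemma H1_graph_attains_sup:
  assumes G: "compact_metric_graph G" and ne: "edges G \<noteq> {}" and f: "H1_graph G f f'"
  shows "\<exists>x\<in>mg_points G. \<forall>y\<in>mg_points G. f y \<le> f x"
proof -
  have "\<exists>t. \<forall>e\<in>edges G. t e \<in> {0..len G e} \<and> (\<forall>s\<in>{0..len G e}. f (e, s) \<le> f (e, t e))"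
  proof (rule bchoice, rule ballI)
    fix e assume e: "e \<in> edges G"
    then have "{0..len G e} \<noteq> {}" using G by (auto simp: compact_metric_graph_def less_imp_le)
    from continuous_attains_sup[OF compact_Icc this H1_graph_continuous[OF f e]]
    show "\<exists>t. t \<in> {0..len G e} \<and> (\<forall>s\<in>{0..len G e}. f (e, s) \<le> f (e, t))" by blast
  qed
  then obtain t where t: "\<And>e. e \<in> edges G \<Longrightarrow> t e \<in> {0..len G e}"
    "\<And>e s. e \<in> edges G \<Longrightarrow> s \<in> {0..len G e} \<Longrightarrow> f (e, s) \<le> f (e, t e)" by blast
  let ?V = "(\<lambda>e. f (e, t e)) ` edges G"
  have fin: "finite ?V" using G by (auto simp: compact_metric_graph_def)
  have "Max ?V \<in> ?V" using fin ne by (intro Max_in) auto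
  then obtain e where e: "e \<in> edges G" "f (e, t e) = Max ?V" by auto
  have "f (d, s) \<le> f (e, t e)" if "d \<in> edges G" "s \<in> {0..len G d}" for d s
    using t(2)[OF that] Max_ge[OF fin, of "f (d, t d)"] that(1) e(2) by fastforce
  then show ?thesis
    using e(1) t(1)[OF e(1)] by (intro bexI[of _ "(e, t e)"]) (auto simp: mg_points_def)
qed

text \<open>Under the contrary assumption the estimate on the trail, the estimate off it and the
  effect of the shift must all be equalities. A segment off the trail exists because the trail has
  length at most D < L; equality there is what the eigenvalue equation refutes.\<close>

lemma spectral_gap_gt:
  fixes G :: "('v, 'e) metric_graph"
  assumes G: "compact_metric_graph G" and conn: "mg_connected G"
    and L: "total_length G = L" and D: "mg_diameter G = D" and "0 < D" "D < L"
    and \<omega>: "0 < \<omega>" "\<omega> * D < pi" and eq: "cos (\<omega> * D / 2) = \<omega> * (L - D) / 2 * sin (\<omega> * D / 2)"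
  shows "\<omega>\<^sup>2 < mg_eigenvalue G 2"
proof (rule ccontr)
  assume "\<not> \<omega>\<^sup>2 < mg_eigenvalue G 2"
  then have ev: "mg_eigenvalue G 2 \<le> \<omega>\<^sup>2" by simp
  have L0: "0 < total_length G" using assms by simp
  then have ne: "edges G \<noteq> {}" by (auto simp: total_length_def)
  obtain f f' where f: "H1_graph G f f'" "mg_integral G f = 0" "mg_inner G f f = 1"
    and f': "mg_inner G f' f' = mg_eigenvalue G 2"
    and weak: "\<And>g g'. H1_graph G g g' \<Longrightarrow> mg_inner G f' g' = mg_eigenvalue G 2 * mg_inner G f g"
    using mg_eigenvalue_2_variational[OF G L0] by blast
  obtain x1 where x1: "x1 \<in> mg_points G" "\<And>y. y \<in> mg_points G \<Longrightarrow> f y \<le> f x1"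
    using H1_graph_attains_sup[OF G ne f(1)] by blast
  obtain x0 where x0: "x0 \<in> mg_points G" "\<And>y. y \<in> mg_points G \<Longrightarrow> f x0 \<le> f y"
    using H1_graph_attains_sup[OF G ne H1_graph_scale[OF f(1), of "-1"]] by auto
  define c M where "c = (f x1 + f x0) / 2" and "M = (f x1 - f x0) / 2"
  define g where "g = (\<lambda>x. f x + (- c))"
  have g: "H1_graph G g f'" using H1_graph_add[OF f(1) H1_graph_const[of G "- c"]] by (simp add: g_def)
  have g01: "g x0 = - M" "g x1 = M" by (simp_all add: g_def c_def M_def field_simps)
  have g_le: "(g y)\<^sup>2 \<le> M\<^sup>2" if "y \<in> mg_points G" for y
    using x0(2)[OF that] x1(2)[OF that] unfolding abs_le_square_iff[symmetric]
    by (auto simp: g_def c_def M_def abs_if field_simps)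
  \<comment> \<open>The cross term vanishes with the mean of f, so the shift adds c^2 L to the
    squared norm.\<close>
  have gg: "mg_inner G g g = 1 + c\<^sup>2 * L"
    using f(2,3) mg_inner_square_add[OF H1_graph_L2(1)[OF f(1)] L2_graph_const[of G "- c"]]
      mg_inner_scale_right[of G f "- c" "\<lambda>x. 1"] mg_integral_const[OF G, of "c * c"] L
    by (simp add: g_def mg_integral_eq_inner power2_eq_square) (simp add: mg_inner_def power2_eq_square)
  obtain N A where N: "finite N" "N \<subseteq> mg_points G" and x0N: "x0 \<in> N" and A: "trail G N x0 A x1" and "arcs_length A \<le> mg_dist G x0 x1"
    using trail_between[OF G conn x0(1) x1(1)] by blast
  then have lA: "arcs_length A \<le> D" using mg_dist_le_diameter[OF G conn x0(1) x1(1)] D by simp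
  have sepA: "separated_segments G A"
    by (intro separated_segments_arcs[OF N(2)] trail_arcs[OF A] trail_finite[OF A])
  obtain e p q where epq: "(e, p, q) \<notin> A" "p < q" and sep: "separated_segments G (insert (e, p, q) A)"
    using exists_free_segment[OF G sepA] lA L \<open>D < L\<close> by auto
  have e: "e \<in> edges G" "0 \<le> p" "q \<le> len G e" using sep by (auto simp: separated_segments_def)
  \<comment> \<open>The added constant makes the integrand nonnegative because |g| \<le> M, so parts
    of the graph may be dropped from its integral. Over the whole graph it contributes \<omega>^2
    M^2 L.\<close>
  define k where "k = (\<lambda>x. ((f' x)\<^sup>2 - \<omega>\<^sup>2 * (g x)\<^sup>2) + \<omega>\<^sup>2 * M\<^sup>2)"
  have intb: "set_integrable lborel {0..len G d} (\<lambda>t. (f' (d, t))\<^sup>2 - \<omega>\<^sup>2 * (g (d, t))\<^sup>2)" if "d \<in> edges G" for d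
    by (intro set_integral_diff(1) H1_graph_AC(2)[OF g that] borel_integrable_atLeastAtMost' continuous_intros
        H1_graph_continuous[OF g that])
  have intk: "set_integrable lborel {0..len G d} (\<lambda>t. k (d, t))" if "d \<in> edges G" for d
    unfolding k_def by (intro set_integral_add(1) intb that borel_integrable_atLeastAtMost' continuous_intros)
  have k0: "0 \<le> k x" if "x \<in> mg_points G" for x
    using mult_left_mono[OF g_le[OF that], of "\<omega>\<^sup>2"] unfolding k_def by (smt (verit) zero_le_power2)
  have le: "(\<Sum>(e, \<alpha>, \<beta>)\<in>insert (e, p, q) A. LBINT t:{\<alpha>..\<beta>}. k (e, t)) \<le> mg_integral G k"
    by (rule separated_segments_integral_le[OF G sep intk k0])
  have Gk: "mg_integral G k = mg_eigenvalue G 2 - \<omega>\<^sup>2 * (1 + c\<^sup>2 * L) + \<omega>\<^sup>2 * M\<^sup>2 * L"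
  proof -
    have "mg_integral G k = mg_inner G f' f' - \<omega>\<^sup>2 * mg_inner G g g + mg_integral G (\<lambda>x. \<omega>\<^sup>2 * M\<^sup>2)"
      unfolding mg_inner_def mg_integral_def sum_distrib_left sum_subtractf[symmetric] sum.distrib[symmetric]
    proof (rule sum.cong[OF refl])
      fix d assume d: "d \<in> edges G"
      have "set_integrable lborel {0..len G d} (\<lambda>t. \<omega>\<^sup>2 * M\<^sup>2)" by (intro borel_integrable_atLeastAtMost') simp
      moreover have "set_integrable lborel {0..len G d} (\<lambda>t. \<omega>\<^sup>2 * (g (d, t))\<^sup>2)"
        by (intro borel_integrable_atLeastAtMost' continuous_intros H1_graph_continuous[OF g d])
      ultimately show "(LBINT t:{0..len G d}. k (d, t)) = (LBINT t:{0..len G d}. f' (d, t) * f' (d, t)) -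
          \<omega>\<^sup>2 * (LBINT t:{0..len G d}. g (d, t) * g (d, t)) + (LBINT t:{0..len G d}. \<omega>\<^sup>2 * M\<^sup>2)"
        using intb[OF d] H1_graph_AC(2)[OF g d] unfolding k_def by (simp add: set_integral_add set_integral_diff power2_eq_square)
    qed
    then show ?thesis by (simp add: f' gg mg_integral_const[OF G] L)
  qed
  define s C where "s = sin (\<omega> * D / 2)" and "C = cos (\<omega> * D / 2)"
  have s: "s > 0" unfolding s_def using \<omega> \<open>0 < D\<close> pi_gt_zero by (intro sin_gt_zero mult_pos_pos divide_pos_pos) linarith+
  have C: "C > 0" unfolding C_def using \<omega> \<open>0 < D\<close> by (intro cos_gt_zero) auto
  have CS: "s\<^sup>2 + C\<^sup>2 = 1" by (simp add: s_def C_def)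
  have eq': "C = \<omega> * (L - D) / 2 * s" using eq by (simp add: s_def C_def)
  \<comment> \<open>The amplitude for which a sin(\<omega> \<tau>) runs from -M to M while \<tau>
    runs from -D/2 to D/2.\<close>
  define a where "a = M / s"
  have on_A: "\<omega>\<^sup>2 * M\<^sup>2 * (L - arcs_length A) \<le> (\<Sum>(e, \<alpha>, \<beta>)\<in>A. LBINT t:{\<alpha>..\<beta>}. (f' (e, t))\<^sup>2 - \<omega>\<^sup>2 * (g (e, t))\<^sup>2)"
  proof -
    have "cal \<omega> a M (arcs_length A - D / 2) - cal \<omega> a (- M) (- D / 2)
        \<le> (\<Sum>(e, \<alpha>, \<beta>)\<in>A. LBINT t:{\<alpha>..\<beta>}. (f' (e, t))\<^sup>2 - \<omega>\<^sup>2 * (g (e, t))\<^sup>2)"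
      using trail_calibration[OF g N(2) x0N A lA \<omega>, of a] g01 by simp
    \<comment> \<open>The missing time is spent at the value M: the calibration inequality for this
      constant function charges -\<omega>^2 M^2 per unit of time, the same rate as the bound off the
      trail.\<close>
    moreover have "cal \<omega> a M (D / 2) - cal \<omega> a M (arcs_length A - D / 2) \<le> - (\<omega>\<^sup>2 * M\<^sup>2 * (D - arcs_length A))"
    proof -
      have l0: "0 \<le> arcs_length A"
        using arcs_length_mono[of "{}" A N] trail_arcs[OF A] trail_finite[OF A] by (simp add: arcs_length_def)
      let ?\<tau> = "arcs_length A - D / 2"
      have "1 * (cal \<omega> a M (?\<tau> + 1 * (D - arcs_length A)) - cal \<omega> a M (?\<tau> + 1 * 0))
          \<le> (LBINT t:{0..D - arcs_length A}. 0\<^sup>2 - \<omega>\<^sup>2 * M\<^sup>2)"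
      proof (rule cal_le_integral)
        show "AC_on 0 (D - arcs_length A) (\<lambda>t. M) (\<lambda>t. 0)" by (intro AC_on_C1) auto
        fix t assume t: "t \<in> {0..D - arcs_length A}"
        have "\<bar>?\<tau> + 1 * t\<bar> \<le> D / 2" using t l0 unfolding abs_le_iff by auto
        then show "\<bar>\<omega> * (?\<tau> + 1 * t)\<bar> < pi / 2" by (rule abs_mult_less_half_pi[OF _ \<omega>])
      qed (use lA in \<open>auto intro!: borel_integrable_atLeastAtMost'\<close>)
      then show ?thesis using lA by (simp add: set_lebesgue_integral_def algebra_simps)
    qed
    \<comment> \<open>The choice of a leaves 2 \<omega> M^2 cot(\<omega> D / 2), and the equation
      for \<omega> evaluates the cotangent.\<close>
    moreover have "cal \<omega> a M (D / 2) - cal \<omega> a (- M) (- D / 2) = \<omega>\<^sup>2 * M\<^sup>2 * (L - D)"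
    proof -
      have "cal \<omega> a M (D / 2) - cal \<omega> a (- M) (- D / 2) = \<omega> * (4 * a * M / C - 2 * (s / C) * (M\<^sup>2 + a\<^sup>2))"
        by (simp add: cal_def C_def s_def tan_def algebra_simps)
      also have "\<dots> = 2 * \<omega> * M\<^sup>2 * (1 - s\<^sup>2) / (s * C)"
        using s C by (simp add: a_def field_simps power2_eq_square)
      also have "1 - s\<^sup>2 = C\<^sup>2" using CS by simp
      also have "2 * \<omega> * M\<^sup>2 * C\<^sup>2 / (s * C) = 2 * \<omega> * M\<^sup>2 * (C / s)"
        using s C by (simp add: power2_eq_square)
      also have "C / s = \<omega> * (L - D) / 2" using eq' s by simp
      finally show ?thesis by (simp add: power2_eq_square)
    qed
    ultimately show ?thesis by (simp add: algebra_simps)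
  qed
  have sum_k: "(\<Sum>(e, \<alpha>, \<beta>)\<in>A. LBINT t:{\<alpha>..\<beta>}. k (e, t)) =
      (\<Sum>(e, \<alpha>, \<beta>)\<in>A. LBINT t:{\<alpha>..\<beta>}. (f' (e, t))\<^sup>2 - \<omega>\<^sup>2 * (g (e, t))\<^sup>2) + \<omega>\<^sup>2 * M\<^sup>2 * arcs_length A"
    unfolding arcs_length_def sum_distrib_left sum.distrib[symmetric]
  proof (rule sum.cong[OF refl])
    fix x assume x: "x \<in> A"
    obtain d \<alpha> \<beta> where x': "x = (d, \<alpha>, \<beta>)" using prod_cases3 by blast
    have d: "d \<in> edges G" "0 \<le> \<alpha>" "\<alpha> < \<beta>" "\<beta> \<le> len G d" using sepA x x' by (auto simp: separated_segments_def)
    have "set_integrable lborel {\<alpha>..\<beta>} (\<lambda>t. (f' (d, t))\<^sup>2 - \<omega>\<^sup>2 * (g (d, t))\<^sup>2)"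
      by (rule set_integrable_subset[OF intb[OF d(1)]]) (use d in auto)
    moreover have "set_integrable lborel {\<alpha>..\<beta>} (\<lambda>t. \<omega>\<^sup>2 * M\<^sup>2)" by (intro borel_integrable_atLeastAtMost') simp
    ultimately have "(LBINT t:{\<alpha>..\<beta>}. k (d, t)) = (LBINT t:{\<alpha>..\<beta>}. (f' (d, t))\<^sup>2 - \<omega>\<^sup>2 * (g (d, t))\<^sup>2) + (LBINT t:{\<alpha>..\<beta>}. \<omega>\<^sup>2 * M\<^sup>2)"
      unfolding k_def by (rule set_integral_add(2))
    also have "(LBINT t:{\<alpha>..\<beta>}. \<omega>\<^sup>2 * M\<^sup>2) = \<omega>\<^sup>2 * M\<^sup>2 * (\<beta> - \<alpha>)"
      using d by (simp add: set_lebesgue_integral_def)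
    finally show "(case x of (e, \<alpha>, \<beta>) \<Rightarrow> LBINT t:{\<alpha>..\<beta>}. k (e, t)) =
        (case x of (e, \<alpha>, \<beta>) \<Rightarrow> LBINT t:{\<alpha>..\<beta>}. (f' (e, t))\<^sup>2 - \<omega>\<^sup>2 * (g (e, t))\<^sup>2) +
        \<omega>\<^sup>2 * M\<^sup>2 * (case x of (e, \<alpha>, \<beta>) \<Rightarrow> \<beta> - \<alpha>)"
      by (simp add: x')
  qed
  \<comment> \<open>The bound on the trail absorbs all multiples of M^2. What remains are two
    nonnegative quantities, the integral over the free segment and the gain from the shift, with sum
    at most zero.\<close>
  have free: "(LBINT t:{p..q}. k (e, t)) + \<omega>\<^sup>2 * (c\<^sup>2 * L) \<le> 0"
    using le Gk on_A sum_k ev epq(1) trail_finite[OF A] by (simp add: algebra_simps)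
  have subpq: "set_integrable lborel {p..q} h" if "set_integrable lborel {0..len G e} h" for h :: "real \<Rightarrow> real"
    by (rule set_integrable_subset[OF that]) (use e in auto)
  have "0 \<le> (LBINT t:{p..q}. k (e, t))"
    unfolding set_lebesgue_integral_def
    by (intro Bochner_Integration.integral_nonneg) (use k0 e in \<open>auto simp: mg_points_def split: split_indicator\<close>)
  moreover have "0 \<le> \<omega>\<^sup>2 * (c\<^sup>2 * L)" using \<open>0 < D\<close> \<open>D < L\<close> by simp
  ultimately have "\<omega>\<^sup>2 * (c\<^sup>2 * L) \<le> 0" and k_pq: "(LBINT t:{p..q}. k (e, t)) = 0"
    using free by linarith+
  then have c0: "c = 0" using \<omega> \<open>0 < D\<close> \<open>D < L\<close> by (auto simp: mult_le_0_iff zero_less_mult_iff)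
  then have gf: "g = f" by (simp add: g_def)
  have AC: "AC_on p q (\<lambda>t. f (e, t)) (\<lambda>t. f' (e, t))"
    by (rule AC_on_subset[OF H1_graph_AC(1)[OF f(1) e(1)] e(2,3)])
  have fpq: "(f (e, t))\<^sup>2 \<le> M\<^sup>2" if "t \<in> {p..q}" for t
    using g_le[of "(e, t)"] that e gf by (auto simp: mg_points_def)
  have i1: "set_integrable lborel {p..q} (\<lambda>t. (f' (e, t))\<^sup>2)"
    by (rule subpq[OF H1_graph_AC(2)[OF f(1) e(1)]])
  have i2: "set_integrable lborel {p..q} (\<lambda>t. \<omega>\<^sup>2 * (M\<^sup>2 - (f (e, t))\<^sup>2))"
    by (intro borel_integrable_atLeastAtMost' continuous_intros AC_on_continuous[OF AC])
  have "(LBINT t:{p..q}. k (e, t)) = (LBINT t:{p..q}. (f' (e, t))\<^sup>2 + \<omega>\<^sup>2 * (M\<^sup>2 - (f (e, t))\<^sup>2))"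
    by (simp add: k_def gf algebra_simps)
  also have "\<dots> = (LBINT t:{p..q}. (f' (e, t))\<^sup>2) + (LBINT t:{p..q}. \<omega>\<^sup>2 * (M\<^sup>2 - (f (e, t))\<^sup>2))"
    by (rule set_integral_add(2)[OF i1 i2])
  finally have split: "(LBINT t:{p..q}. (f' (e, t))\<^sup>2) + (LBINT t:{p..q}. \<omega>\<^sup>2 * (M\<^sup>2 - (f (e, t))\<^sup>2)) = 0"
    using k_pq by simp
  have n1: "0 \<le> (LBINT t:{p..q}. (f' (e, t))\<^sup>2)"
    unfolding set_lebesgue_integral_def by (intro Bochner_Integration.integral_nonneg) auto
  have n2: "0 \<le> (LBINT t:{p..q}. \<omega>\<^sup>2 * (M\<^sup>2 - (f (e, t))\<^sup>2))"
    unfolding set_lebesgue_integral_def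
    by (intro Bochner_Integration.integral_nonneg) (use fpq in \<open>auto split: split_indicator\<close>)
  have z1: "(LBINT t:{p..q}. (f' (e, t))\<^sup>2) = 0" and z2: "(LBINT t:{p..q}. \<omega>\<^sup>2 * (M\<^sup>2 - (f (e, t))\<^sup>2)) = 0"
    using split n1 n2 by linarith+
  define K where "K = f (e, p)"
  have fK: "f (e, t) = K" if "t \<in> {p..q}" for t
    using AC_on_Hoelder[OF AC i1, of p t] that epq(2) z1 by (simp add: K_def)
  have "(LBINT t:{p..q}. \<omega>\<^sup>2 * (M\<^sup>2 - (f (e, t))\<^sup>2)) = (LBINT t:{p..q}. \<omega>\<^sup>2 * (M\<^sup>2 - K\<^sup>2))"
    by (intro set_lebesgue_integral_cong) (auto simp: fK)
  also have "\<dots> = \<omega>\<^sup>2 * (M\<^sup>2 - K\<^sup>2) * (q - p)" using epq(2) by (simp add: set_lebesgue_integral_def)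
  finally have KM: "K\<^sup>2 = M\<^sup>2" using z2 \<omega> epq(2) by simp
  have "M \<noteq> 0"
  proof
    assume "M = 0"
    then have z: "f x = 0" if "x \<in> mg_points G" for x using g_le[OF that] gf by simp
    have "mg_inner G f f = 0"
      unfolding mg_inner_def mg_integral_def
    proof (rule sum.neutral, rule ballI)
      fix d assume "d \<in> edges G"
      then have "(LBINT t:{0..len G d}. f (d, t) * f (d, t)) = (LBINT t:{0..len G d}. 0)"
        by (intro set_lebesgue_integral_cong) (auto simp: z mg_points_def)
      then show "(LBINT t:{0..len G d}. f (d, t) * f (d, t)) = 0" by simp
    qed
    then show False using f(3) by simp
  qed
  then have K0: "K \<noteq> 0" using KM by auto
  \<comment> \<open>A nonzero constant does not satisfy the eigenvalue equation on \<open>{p..q}\<close>: test with a bump.\<close>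
  define \<phi> where "\<phi> = (\<lambda>x :: 'e \<times> real. if fst x = e \<and> snd x \<in> {p..q} then (snd x - p) * (q - snd x) else 0)"
  define \<phi>' where "\<phi>' = (\<lambda>x :: 'e \<times> real. if fst x = e \<and> snd x \<in> {p..q} then p + q - 2 * snd x else 0)"
  \<comment> \<open>Integration up to r meets {p..q} in {p..min r q}, which is empty for r <
    p.\<close>
  have restrict: "(LBINT t:{0..r}. h t * (if t \<in> {p..q} then v t else 0)) = (LBINT t:{p..min r q}. h t * v t)"
    for r and h v :: "real \<Rightarrow> real"
    unfolding set_lebesgue_integral_def using e(2)
    by (intro Bochner_Integration.integral_cong) (auto split: split_indicator)
  have AC2: "AC_on p q (\<lambda>t. (t - p) * (q - t)) (\<lambda>t. p + q - 2 * t)"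
    by (intro AC_on_C1 continuous_intros) (auto intro!: derivative_eq_intros)
  have \<phi>H: "H1_graph G \<phi> \<phi>'"
    unfolding H1_graph_def H1_interval_iff
  proof (intro conjI ballI impI)
    have ep: "\<phi> x = 0" if "endpoint_at G v x" for v x
      using that e epq(2) by (auto simp: endpoint_at_def \<phi>_def)
    show "\<phi> x = \<phi> y" if "glued G x y" for x y
      using that ep[of _ x] ep[of _ y] unfolding glued_def by metis
    fix d assume "d \<in> edges G"
    have ind: "(\<lambda>t. indicator {0..len G d} t *\<^sub>R (\<phi>' (d, t)) ^ n) = (\<lambda>t. if d = e then indicator {p..q} t *\<^sub>R (p + q - 2 * t) ^ n else 0)"
      if "n > 0" for n
      using e that by (auto simp: \<phi>'_def fun_eq_iff split: split_indicator)
    have int: "integrable lborel (\<lambda>t. indicator {p..q} t *\<^sub>R (p + q - 2 * t) ^ n)" for n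
    proof -
      have "continuous_on {p..q} (\<lambda>t. (p + q - 2 * t) ^ n)" by (intro continuous_intros)
      from borel_integrable_atLeastAtMost'[OF this] show ?thesis by (simp add: set_integrable_def)
    qed
    show "set_integrable lborel {0..len G d} (\<lambda>t. (\<phi>' (d, t))\<^sup>2)"
      unfolding set_integrable_def using ind[of 2] int[of 2] by (cases "d = e") auto
    show "AC_on 0 (len G d) (\<lambda>t. \<phi> (d, t)) (\<lambda>t. \<phi>' (d, t))"
      unfolding AC_on_def
    proof (intro conjI ballI)
      show "set_integrable lborel {0..len G d} (\<lambda>t. \<phi>' (d, t))"
        unfolding set_integrable_def using ind[of 1] int[of 1] by (cases "d = e") auto
      fix r assume r: "r \<in> {0..len G d}"
      show "\<phi> (d, r) = \<phi> (d, 0) + (LBINT t:{0..r}. \<phi>' (d, t))"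
      proof (cases "d = e")
        case True
        have "(LBINT t:{0..r}. \<phi>' (d, t)) = (LBINT t:{p..min r q}. p + q - 2 * t)"
          using restrict[of r "\<lambda>t. 1" "\<lambda>t. p + q - 2 * t"] True by (simp add: \<phi>'_def cong: if_cong)
        also have "\<dots> = \<phi> (d, r)"
        proof (cases "p \<le> r")
          case False
          then show ?thesis using True by (simp add: \<phi>_def set_lebesgue_integral_def)
        next
          case True
          then have "(LBINT t:{p..min r q}. p + q - 2 * t) = (min r q - p) * (q - min r q) - (p - p) * (q - p)"
            using epq(2) by (intro AC_on_diff_eq[OF AC2]) auto
          then show ?thesis using True \<open>d = e\<close> by (auto simp: \<phi>_def min_def)
        qed
        finally show ?thesis using e(2) by (simp add: \<phi>_def)
      qed (simp add: \<phi>_def \<phi>'_def)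
    qed
  qed
  have single: "mg_inner G h (\<lambda>x. if fst x = e \<and> snd x \<in> {p..q} then v (snd x) else 0) = (LBINT t:{p..q}. h (e, t) * v t)" for h v
  proof -
    have "mg_inner G h (\<lambda>x. if fst x = e \<and> snd x \<in> {p..q} then v (snd x) else 0)
        = (\<Sum>d\<in>edges G. if d = e then LBINT t:{0..len G d}. h (d, t) * (if t \<in> {p..q} then v t else 0) else 0)"
      unfolding mg_inner_def mg_integral_def by (intro sum.cong) (auto cong: if_cong)
    also have "\<dots> = (LBINT t:{0..len G e}. h (e, t) * (if t \<in> {p..q} then v t else 0))"
      using G e(1) by (simp add: compact_metric_graph_def sum.delta')
    also have "\<dots> = (LBINT t:{p..q}. h (e, t) * v t)"
      using restrict[of "len G e"] e(3) by (simp add: min_absorb2)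
    finally show ?thesis .
  qed
  \<comment> \<open>The representative \<open>f'\<close> need not vanish at every point. The product
    rule is used instead: f is the constant K on {p..q}, and the boundary terms cancel against the
    integral of -2 K.\<close>
  have "mg_inner G f' \<phi>' = 0"
  proof -
    have "AC_on p q (\<lambda>t. p + q - 2 * t) (\<lambda>t. - 2)"
      by (intro AC_on_C1 continuous_intros) (auto intro!: derivative_eq_intros)
    from AC_on_mult[OF AC this]
    have AC3: "AC_on p q (\<lambda>t. f (e, t) * (p + q - 2 * t)) (\<lambda>t. f' (e, t) * (p + q - 2 * t) + - 2 * f (e, t))" .
    have "(LBINT t:{p..q}. f' (e, t) * (p + q - 2 * t) + - 2 * f (e, t)) = K * (p - q) - K * (q - p)"
      using AC_on_diff_eq[OF AC3, of p q] epq(2) fK[of p] fK[of q] by simp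
    moreover have "(LBINT t:{p..q}. f' (e, t) * (p + q - 2 * t) + - 2 * f (e, t)) =
        (LBINT t:{p..q}. f' (e, t) * (p + q - 2 * t)) + (LBINT t:{p..q}. - 2 * f (e, t))"
      by (intro set_integral_add(2) set_integrable_mult_continuous AC_on_integrable[OF AC]
          borel_integrable_atLeastAtMost' continuous_intros AC_on_continuous[OF AC])
    moreover have "(LBINT t:{p..q}. - 2 * f (e, t)) = (LBINT t:{p..q}. - 2 * K)"
      by (intro set_lebesgue_integral_cong) (auto simp: fK)
    moreover have "(LBINT t:{p..q}. - 2 * K) = - 2 * K * (q - p)"
      using epq(2) by (simp add: set_lebesgue_integral_def)
    ultimately have "(LBINT t:{p..q}. f' (e, t) * (p + q - 2 * t)) = 0" by (simp add: algebra_simps)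
    then show ?thesis using single[of f' "\<lambda>t. p + q - 2 * t"] by (simp add: \<phi>'_def)
  qed
  then have "mg_eigenvalue G 2 * mg_inner G f \<phi> = 0"
    using weak[OF \<phi>H] by simp
  \<comment> \<open>Eigenvalue zero, which a nonzero constant would satisfy, is excluded by the
    non-strict form of the estimate: it already gives \<omega>^2 as a lower bound.\<close>
  moreover have "mg_eigenvalue G 2 \<noteq> 0"
  proof -
    have "0 \<le> (LBINT t:{p..q}. k (e, t))" using k_pq by simp
    then have "\<omega>\<^sup>2 * M\<^sup>2 * L \<le> mg_eigenvalue G 2 - \<omega>\<^sup>2 + \<omega>\<^sup>2 * M\<^sup>2 * L"
      using le Gk on_A sum_k epq(1) trail_finite[OF A] c0 by (simp add: algebra_simps)
    then have "\<omega>\<^sup>2 \<le> mg_eigenvalue G 2" by simp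
    then show ?thesis using \<omega> by (smt (verit) zero_less_power2)
  qed
  moreover have "mg_inner G f \<phi> \<noteq> 0"
  proof -
    have "AC_on p q (\<lambda>t. - (t ^ 3 / 3) + (p + q) * t\<^sup>2 / 2 - p * q * t) (\<lambda>t. (t - p) * (q - t))"
      by (intro AC_on_C1 continuous_intros) (auto intro!: derivative_eq_intros simp: power2_eq_square algebra_simps)
    from AC_on_diff_eq[OF this, of p q] epq(2)
    have "(LBINT t:{p..q}. (t - p) * (q - t)) = (q - p) ^ 3 / 6"
      by (simp add: power2_eq_square power3_eq_cube field_simps)
    moreover have "mg_inner G f \<phi> = (LBINT t:{p..q}. f (e, t) * ((t - p) * (q - t)))"
      using single[of f "\<lambda>t. (t - p) * (q - t)"] by (simp add: \<phi>_def)
    moreover have "\<dots> = (LBINT t:{p..q}. K * ((t - p) * (q - t)))"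
      by (intro set_lebesgue_integral_cong) (auto simp: fK)
    ultimately show ?thesis using K0 epq(2) zero_less_power[of "q - p" 3] by auto
  qed
  ultimately show False by simp
qed

section \<open>The transcendental equation\<close>

lemma x_cos_le_sin:
  fixes x :: real
  assumes "0 \<le> x" "x \<le> pi"
  shows "x * cos x \<le> sin x"
proof -
  have "sin 0 - 0 * cos 0 \<le> sin x - x * cos x"
  proof (rule DERIV_nonneg_imp_nondecreasing[OF assms(1)])
    fix y :: real assume "0 \<le> y" "y \<le> x"
    then show "\<exists>z. ((\<lambda>x. sin x - x * cos x) has_real_derivative z) (at y) \<and> 0 \<le> z"
      using assms by (intro exI[of _ "y * sin y"]) (auto intro!: derivative_eq_intros mult_nonneg_nonneg sin_ge_zero)
  qed
  then show ?thesis by simp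
qed

text \<open>The difference vanishes at 0 and has derivative x (sin x - x cos x) / 3, nonnegative by
  the preceding inequality. It is the bound x cot x \<le> 1 - x^2 / 3 without division, the source
  of the constant 12.\<close>

lemma x_cos_le_sin_minus_cubic:
  fixes x :: real
  assumes "0 \<le> x" "x \<le> pi"
  shows "x * cos x \<le> (1 - x\<^sup>2 / 3) * sin x"
proof -
  have "(1 - 0\<^sup>2 / 3) * sin 0 - 0 * cos 0 \<le> (1 - x\<^sup>2 / 3) * sin x - x * cos x"
  proof (rule DERIV_nonneg_imp_nondecreasing[OF assms(1)])
    fix y :: real assume y: "0 \<le> y" "y \<le> x"
    have "((\<lambda>x. (1 - x\<^sup>2 / 3) * sin x - x * cos x) has_real_derivative y / 3 * (sin y - y * cos y)) (at y)"
      by (auto intro!: derivative_eq_intros simp: field_simps power2_eq_square)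
    moreover have "0 \<le> y / 3 * (sin y - y * cos y)"
      using x_cos_le_sin[of y] y assms by simp
    ultimately show "\<exists>z. ((\<lambda>x. (1 - x\<^sup>2 / 3) * sin x - x * cos x) has_real_derivative z) (at y) \<and> 0 \<le> z"
      by blast
  qed
  then show ?thesis by simp
qed

text \<open>The difference of the two sides of the equation is 1 at w = 0 and negative at w = pi /
  D, where the cosine vanishes. So a positive root lies strictly below pi / D, and the smallest is
  no larger.\<close>

lemma smallest_root_less:
  fixes L D \<omega> :: real
  assumes D: "0 < D" "D < L"
    and min: "\<And>w. 0 < w \<Longrightarrow> cos (w * D / 2) = w * (L - D) / 2 * sin (w * D / 2) \<Longrightarrow> \<omega> \<le> w"
  shows "\<omega> * D < pi"
proof -
  let ?q = "\<lambda>w. cos (w * D / 2) - w * (L - D) / 2 * sin (w * D / 2)"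
  have end_neg: "?q (pi / D) < 0" using D by simp
  have "\<exists>w\<ge>0. w \<le> pi / D \<and> ?q w = 0"
    by (rule IVT2') (use D end_neg in \<open>auto intro!: continuous_intros\<close>)
  then obtain w where w: "0 \<le> w" "w \<le> pi / D" "?q w = 0" by blast
  have "w \<noteq> 0" using w(3) by auto
  then have "\<omega> \<le> w" using w by (intro min) auto
  moreover have "w \<noteq> pi / D" using w(3) end_neg by (metis less_irrefl)
  ultimately have "\<omega> < pi / D" using w by simp
  then show ?thesis using D by (simp add: field_simps)
qed

text \<open>With x = \<omega> D / 2 the equation reads \<omega>^2 L D = 4 (x^2 + x cot x). Above, x
  cot x \<le> 1 - x^2 / 3 gives at most 4 + 8 x^2 / 3, and positivity of the cosine turns the same
  inequality into x^2 < 3. Below, x^2 suffices for x \<ge> 1/2 and x cot x for smaller x.\<close>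

lemma root_bounds:
  fixes L D \<omega> :: real
  assumes D: "0 < D" "D < L" and \<omega>: "0 < \<omega>" "\<omega> * D < pi"
    and eq: "cos (\<omega> * D / 2) = \<omega> * (L - D) / 2 * sin (\<omega> * D / 2)"
  shows "1 / (L * D) < \<omega>\<^sup>2" "\<omega>\<^sup>2 < 12 / (L * D)"
proof -
  define x where "x = \<omega> * D / 2"
  have x: "0 < x" "x < pi / 2" using D \<omega> by (auto simp: x_def)
  have s: "sin x > 0" and c: "cos x > 0" using x pi_gt_zero by (auto intro!: sin_gt_zero cos_gt_zero)
  have "x * cos x = x * (\<omega> * (L - D) / 2 * sin x)" using eq by (simp add: x_def)
  then have key: "4 * (x\<^sup>2 * sin x + x * cos x) = \<omega>\<^sup>2 * (L * D) * sin x"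
    by (simp add: x_def power2_eq_square field_simps)
  have LD: "0 < L * D" using D by simp
  have t: "x * cos x \<le> (1 - x\<^sup>2 / 3) * sin x" using x pi_gt_zero by (intro x_cos_le_sin_minus_cubic) auto
  have "0 < x * cos x" using x c by simp
  then have "0 < (1 - x\<^sup>2 / 3) * sin x" using t by linarith
  then have x3: "x\<^sup>2 < 3" using s by (simp add: zero_less_mult_iff)
  have "4 * (x\<^sup>2 * sin x + x * cos x) \<le> (4 + 8 / 3 * x\<^sup>2) * sin x"
    using t by (simp add: algebra_simps)
  also have "\<dots> < 12 * sin x" using x3 s by (intro mult_strict_right_mono) auto
  finally have "\<omega>\<^sup>2 * (L * D) < 12" using s unfolding key by simp
  then show "\<omega>\<^sup>2 < 12 / (L * D)" using LD by (simp add: pos_less_divide_eq)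
  have "sin x < 4 * (x\<^sup>2 * sin x + x * cos x)"
  proof (cases "x < 1 / 2")
    case False
    then have "(1 / 2)\<^sup>2 \<le> x\<^sup>2" by (intro power_mono) auto
    then have "sin x \<le> 4 * (x\<^sup>2 * sin x)" using s by (simp add: power2_eq_square)
    then show ?thesis using \<open>0 < x * cos x\<close> by simp
  next
    case True
    \<comment> \<open>The half-angle formula with sin(x / 2) \<le> 1/4 gives cos x \<ge> 1 - 2/16 =
      7/8.\<close>
    have "(sin (x / 2))\<^sup>2 \<le> (1 / 4)\<^sup>2"
      using sin_x_le_x[of "x / 2"] sin_ge_zero[of "x / 2"] x True pi_gt_zero by (intro power_mono) auto
    moreover have "cos x = 1 - 2 * (sin (x / 2))\<^sup>2" using cos_double_sin[of "x / 2"] by simp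
    ultimately have "7 / 8 \<le> cos x" by (simp add: power2_eq_square)
    then have "sin x * (7 / 8) \<le> x * cos x"
      using sin_x_le_x[of x] x s by (intro mult_mono) auto
    moreover have "0 < x\<^sup>2 * sin x" using x s by simp
    ultimately show ?thesis using s by simp
  qed
  then have "1 < \<omega>\<^sup>2 * (L * D)" using s unfolding key by simp
  then show "1 / (L * D) < \<omega>\<^sup>2" using LD by (simp add: pos_divide_less_eq)
qed

section \<open>Dumbbells\<close>

text \<open>
  The handle is edge \<open>0\<close>, from vertex \<open>0\<close> to vertex \<open>1\<close>; \<open>n\<close> pendant edges of length \<open>\<epsilon>\<close> are attached
  to each of these two vertices. \<open>height\<close> is the coordinate along the axis.
\<close>

definition dumbbell :: "real \<Rightarrow> real \<Rightarrow> nat \<Rightarrow> (nat, nat) metric_graph" where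
  "dumbbell D \<epsilon> n = \<lparr>edges = {..2 * n}, len = (\<lambda>e. if e = 0 then D - 2 * \<epsilon> else \<epsilon>),
     src = (\<lambda>e. if e = 0 then 0 else if e \<le> n then e + 1 else 1),
     tgt = (\<lambda>e. if e = 0 then 1 else if e \<le> n then 0 else e + 1)\<rparr>"

definition height :: "real \<Rightarrow> real \<Rightarrow> nat \<Rightarrow> nat \<times> real \<Rightarrow> real" where
  "height D \<epsilon> n x = (if fst x = 0 then \<epsilon> else if fst x \<le> n then 0 else D - \<epsilon>) + snd x"

lemma dumbbell_simps [simp]:
  "edges (dumbbell D \<epsilon> n) = {..2 * n}"
  "len (dumbbell D \<epsilon> n) e = (if e = 0 then D - 2 * \<epsilon> else \<epsilon>)"
  "src (dumbbell D \<epsilon> n) e = (if e = 0 then 0 else if e \<le> n then e + 1 else 1)"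
  "tgt (dumbbell D \<epsilon> n) e = (if e = 0 then 1 else if e \<le> n then 0 else e + 1)"
  by (simp_all add: dumbbell_def)

lemma sum_dumbbell:
  fixes X Y Z :: real
  shows "(\<Sum>e\<le>2 * n. if e = 0 then X else if e \<le> n then Y else Z) = X + real n * Y + real n * Z"
proof -
  have "{..2 * n} = {0} \<union> {1..n} \<union> {n + 1..2 * n}" by auto
  then have "(\<Sum>e\<le>2 * n. if e = 0 then X else if e \<le> n then Y else Z) =
      (\<Sum>e\<in>{0} \<union> {1..n} \<union> {n + 1..2 * n}. if e = 0 then X else if e \<le> n then Y else Z)" by simp
  also have "\<dots> = (\<Sum>e\<in>{0}. if e = 0 then X else if e \<le> n then Y else Z)
      + (\<Sum>e\<in>{1..n}. if e = 0 then X else if e \<le> n then Y else Z)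
      + (\<Sum>e\<in>{n + 1..2 * n}. if e = 0 then X else if e \<le> n then Y else Z)"
    by (subst sum.union_disjoint; (subst sum.union_disjoint)?) auto
  also have "(\<Sum>e\<in>{1..n}. if e = 0 then X else if e \<le> n then Y else Z) = (\<Sum>e\<in>{1..n}. Y)"
    by (intro sum.cong) auto
  also have "(\<Sum>e\<in>{n + 1..2 * n}. if e = 0 then X else if e \<le> n then Y else Z) = (\<Sum>e\<in>{n + 1..2 * n}. Z)"
    by (intro sum.cong) auto
  finally show ?thesis by simp
qed

section \<open>Concatenation and reversal of paths\<close>

lemma mg_path_trans:
  assumes "mg_path G x r y" "mg_path G y s z"
  shows "mg_path G x (r + s) z"
  using assms(2)
proof (induction rule: mg_path.induct)
  case start
  then show ?case using assms(1) by simp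
next
  case (segment q e a b)
  then show ?case using mg_path.segment[OF segment.IH segment.hyps(2)] by (simp add: add.assoc)
next
  case (glue q y z)
  then show ?case using mg_path.glue by blast
qed

text \<open>Every step can be run backwards. That \<open>y\<close> is a point of the graph is part
  of the induction because the reversed path has to start there.\<close>

lemma mg_path_sym:
  assumes G: "compact_metric_graph G" and "mg_path G x r y"
  shows "y \<in> mg_points G \<and> mg_path G y r x"
  using assms(2)
proof (induction rule: mg_path.induct)
  case start
  then show ?case using mg_path.start by blast
next
  case (segment r e s t)
  then have pt: "(e, t) \<in> mg_points G" and s: "s \<in> {0..len G e}" by (auto simp: mg_points_def)
  have "mg_path G (e, t) (0 + \<bar>s - t\<bar>) (e, s)"
    by (rule mg_path.segment[OF mg_path.start[OF pt] s])
  from mg_path_trans[OF this] segment.IH pt show ?case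
    by (auto simp: add.commute abs_minus_commute)
next
  case (glue r y z)
  have pt: "z \<in> mg_points G"
    using glue G by (auto simp: glued_def endpoint_at_def mg_points_def compact_metric_graph_def less_imp_le)
  have "glued G z y" using glue.hyps by (auto simp: glued_def)
  then have "mg_path G z 0 y" by (rule mg_path.glue[OF mg_path.start[OF pt]])
  from mg_path_trans[OF this] glue.IH pt show ?case by fastforce
qed

context
  fixes D \<epsilon> :: real and n :: nat
  assumes \<epsilon>: "0 < \<epsilon>" "2 * \<epsilon> < D" and n: "0 < n"
begin

lemma compact_dumbbell: "compact_metric_graph (dumbbell D \<epsilon> n)"
  using \<epsilon> by (auto simp: compact_metric_graph_def)

lemma total_length_dumbbell: "total_length (dumbbell D \<epsilon> n) = D - 2 * \<epsilon> + 2 * real n * \<epsilon>"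
  using sum_dumbbell[of "D - 2 * \<epsilon>" n \<epsilon> \<epsilon>] by (simp add: total_length_def cong: if_cong)

text \<open>The coordinate at an edge end depends on the vertex alone, hence respects gluing.
  Vertices 0 and 1 are the hubs; the offset in e + 1 makes 2 to n + 1 the leaves on the left and the
  larger labels those on the right.\<close>

lemma height_endpoint:
  assumes "endpoint_at (dumbbell D \<epsilon> n) v x"
  shows "height D \<epsilon> n x = (if v = 0 then \<epsilon> else if v = 1 then D - \<epsilon> else if v \<le> n + 1 then 0 else D)"
proof -
  let ?G = "dumbbell D \<epsilon> n"
  obtain e where e: "x = (e, 0) \<and> v = src ?G e \<or> x = (e, len ?G e) \<and> v = tgt ?G e"
    using assms unfolding endpoint_at_def by blast
  consider "e = 0" | "0 < e" "e \<le> n" | "n < e" by linarith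
  then show ?thesis
    by cases (use e in \<open>auto simp: height_def\<close>)
qed

lemma height_glued: "glued (dumbbell D \<epsilon> n) x y \<Longrightarrow> height D \<epsilon> n x = height D \<epsilon> n y"
  unfolding glued_def using height_endpoint by metis

text \<open>Within an edge the coordinate moves at unit speed, and gluing does not change it. This
  yields the lower bound on distances.\<close>

lemma height_Lipschitz: "mg_path (dumbbell D \<epsilon> n) x r y \<Longrightarrow> \<bar>height D \<epsilon> n y - height D \<epsilon> n x\<bar> \<le> r"
proof (induction rule: mg_path.induct)
  case (segment r e s t)
  have "height D \<epsilon> n (e, t) = height D \<epsilon> n (e, s) + (t - s)" by (simp add: height_def)
  then show ?case using segment.IH by linarith
next
  case (glue r y z)
  then show ?case using height_glued[OF glue.hyps(2)] by simp
qed simp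

lemma height_range:
  assumes "x \<in> mg_points (dumbbell D \<epsilon> n)"
  shows "0 \<le> height D \<epsilon> n x" "height D \<epsilon> n x \<le> D"
  using assms \<epsilon> by (auto simp: mg_points_def height_def split: if_splits)

text \<open>Towards a hub the way is monotone along the axis, so its length is the difference of
  heights. This fails between two leaves of one bunch, which is why general pairs of points are
  joined through a hub.\<close>

lemma path_to_hubs:
  assumes "x \<in> mg_points (dumbbell D \<epsilon> n)"
  shows "mg_path (dumbbell D \<epsilon> n) x \<bar>height D \<epsilon> n x - \<epsilon>\<bar> (0, 0) \<and>
    mg_path (dumbbell D \<epsilon> n) x \<bar>height D \<epsilon> n x - (D - \<epsilon>)\<bar> (0, D - 2 * \<epsilon>)"
proof -
  let ?G = "dumbbell D \<epsilon> n"
  obtain e t where x: "x = (e, t)" using prod.exhaust by blast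
  have et: "e \<le> 2 * n" "0 \<le> t" "t \<le> len ?G e" using assms x by (auto simp: mg_points_def)
  note st = mg_path.start[OF assms, unfolded x]
  have v0: "endpoint_at ?G 0 (0, 0)" and v1: "endpoint_at ?G 1 (0, D - 2 * \<epsilon>)"
    unfolding endpoint_at_def by (rule bexI[of _ 0]; simp)+
  consider "e = 0" | "0 < e" "e \<le> n" | "n < e" by linarith
  then show ?thesis
  proof cases
    case 1
    have "mg_path ?G (e, t) (0 + \<bar>0 - t\<bar>) (e, 0)"
      "mg_path ?G (e, t) (0 + \<bar>D - 2 * \<epsilon> - t\<bar>) (e, D - 2 * \<epsilon>)"
      by (rule mg_path.segment[OF st]; use 1 \<epsilon> in simp)+
    moreover have "0 + \<bar>0 - t\<bar> = \<bar>height D \<epsilon> n x - \<epsilon>\<bar>"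
      "0 + \<bar>D - 2 * \<epsilon> - t\<bar> = \<bar>height D \<epsilon> n x - (D - \<epsilon>)\<bar>"
      using 1 by (simp_all add: height_def x)
    ultimately show ?thesis using 1 x by simp
  next
    case 2
    have "endpoint_at ?G 0 (e, \<epsilon>)"
      unfolding endpoint_at_def by (rule bexI[of _ e]) (use 2 et in auto)
    then have g: "glued ?G (e, \<epsilon>) (0, 0)" using v0 by (auto simp: glued_def)
    have "mg_path ?G (e, t) (0 + \<bar>\<epsilon> - t\<bar>) (e, \<epsilon>)"
      by (rule mg_path.segment[OF st]) (use 2 \<epsilon> in auto)
    from mg_path.glue[OF this g] have 0: "mg_path ?G (e, t) (0 + \<bar>\<epsilon> - t\<bar>) (0, 0)" .
    have "mg_path ?G (e, t) (0 + \<bar>\<epsilon> - t\<bar> + \<bar>D - 2 * \<epsilon> - 0\<bar>) (0, D - 2 * \<epsilon>)"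
      by (rule mg_path.segment[OF 0]) (use \<epsilon> in auto)
    moreover have "0 + \<bar>\<epsilon> - t\<bar> = \<bar>height D \<epsilon> n x - \<epsilon>\<bar>"
      "0 + \<bar>\<epsilon> - t\<bar> + \<bar>D - 2 * \<epsilon> - 0\<bar> = \<bar>height D \<epsilon> n x - (D - \<epsilon>)\<bar>"
      using 2 et \<epsilon> by (auto simp: height_def x)
    ultimately show ?thesis using 0 x by simp
  next
    case 3
    have "endpoint_at ?G 1 (e, 0)"
      unfolding endpoint_at_def by (rule bexI[of _ e]) (use 3 et in auto)
    then have g: "glued ?G (e, 0) (0, D - 2 * \<epsilon>)" using v1 by (auto simp: glued_def)
    have "mg_path ?G (e, t) (0 + \<bar>0 - t\<bar>) (e, 0)"
      by (rule mg_path.segment[OF st]) (use 3 \<epsilon> in auto)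
    from mg_path.glue[OF this g] have 1: "mg_path ?G (e, t) (0 + \<bar>0 - t\<bar>) (0, D - 2 * \<epsilon>)" .
    have "mg_path ?G (e, t) (0 + \<bar>0 - t\<bar> + \<bar>0 - (D - 2 * \<epsilon>)\<bar>) (0, 0)"
      by (rule mg_path.segment[OF 1]) (use \<epsilon> in auto)
    moreover have "0 + \<bar>0 - t\<bar> = \<bar>height D \<epsilon> n x - (D - \<epsilon>)\<bar>"
      "0 + \<bar>0 - t\<bar> + \<bar>0 - (D - 2 * \<epsilon>)\<bar> = \<bar>height D \<epsilon> n x - \<epsilon>\<bar>"
      using 3 et \<epsilon> by (auto simp: height_def x)
    ultimately show ?thesis using 1 x by simp
  qed
qed

lemma path_via_hubs:
  assumes x: "x \<in> mg_points (dumbbell D \<epsilon> n)" and y: "y \<in> mg_points (dumbbell D \<epsilon> n)"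
  shows "mg_path (dumbbell D \<epsilon> n) x (\<bar>height D \<epsilon> n x - \<epsilon>\<bar> + \<bar>height D \<epsilon> n y - \<epsilon>\<bar>) y"
    "mg_path (dumbbell D \<epsilon> n) x (\<bar>height D \<epsilon> n x - (D - \<epsilon>)\<bar> + \<bar>height D \<epsilon> n y - (D - \<epsilon>)\<bar>) y"
  using mg_path_trans path_to_hubs[OF x] path_to_hubs[OF y] mg_path_sym[OF compact_dumbbell] by blast+

lemma connected_dumbbell: "mg_connected (dumbbell D \<epsilon> n)"
  unfolding mg_connected_def using path_via_hubs by blast

text \<open>The two routes between points, one through each hub, have lengths adding up to at most 2
  D, so the shorter is at most D. Leaves of opposite bunches differ in height by D, so the value is
  attained.\<close>

lemma diameter_dumbbell: "mg_diameter (dumbbell D \<epsilon> n) = D"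
proof (rule antisym)
  let ?G = "dumbbell D \<epsilon> n"
  have pts: "(1, 0) \<in> mg_points ?G" "(n + 1, \<epsilon>) \<in> mg_points ?G"
    using n \<epsilon> by (auto simp: mg_points_def)
  have "mg_dist ?G x y \<le> D" if x: "x \<in> mg_points ?G" and y: "y \<in> mg_points ?G" for x y
  proof -
    define a b where "a = height D \<epsilon> n x" and "b = height D \<epsilon> n y"
    have r: "0 \<le> a" "a \<le> D" "0 \<le> b" "b \<le> D"
      using height_range[OF x] height_range[OF y] by (simp_all add: a_def b_def)
    have "mg_dist ?G x y \<le> \<bar>a - \<epsilon>\<bar> + \<bar>b - \<epsilon>\<bar>" "mg_dist ?G x y \<le> \<bar>a - (D - \<epsilon>)\<bar> + \<bar>b - (D - \<epsilon>)\<bar>"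
      unfolding a_def b_def by (intro mg_dist_le path_via_hubs x y)+
    \<comment> \<open>The distances to the hubs add up to D - 2 \<epsilon> on the handle and to at
      most D beyond it.\<close>
    moreover have "\<bar>z - \<epsilon>\<bar> + \<bar>z - (D - \<epsilon>)\<bar> \<le> D" if "0 \<le> z" "z \<le> D" for z
      using that \<epsilon> by (auto simp: abs_if)
    from this[OF r(1,2)] this[OF r(3,4)] have "\<bar>a - \<epsilon>\<bar> + \<bar>a - (D - \<epsilon>)\<bar> + (\<bar>b - \<epsilon>\<bar> + \<bar>b - (D - \<epsilon>)\<bar>) \<le> 2 * D" by simp
    ultimately show ?thesis by linarith
  qed
  then show "mg_diameter ?G \<le> D"
    unfolding mg_diameter_def using pts by (intro cSUP_least) auto
  have "D \<le> mg_dist ?G (1, 0) (n + 1, \<epsilon>)"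
    unfolding mg_dist_def
  proof (rule cInf_greatest)
    show "{r. mg_path ?G (1, 0) r (n + 1, \<epsilon>)} \<noteq> {}"
      using connected_dumbbell pts unfolding mg_connected_def by blast
    fix r assume "r \<in> {r. mg_path ?G (1, 0) r (n + 1, \<epsilon>)}"
    then have "\<bar>height D \<epsilon> n (n + 1, \<epsilon>) - height D \<epsilon> n (1, 0)\<bar> \<le> r"
      by (intro height_Lipschitz) simp
    then show "D \<le> r" using n by (simp add: height_def Suc_le_eq)
  qed
  also have "\<dots> \<le> mg_diameter ?G"
    by (rule mg_dist_le_diameter[OF compact_dumbbell connected_dumbbell pts])
  finally show "D \<le> mg_diameter ?G" .
qed

text \<open>The right-hand side is the Rayleigh quotient of the test function, with \<open>a\<close>
  half the length of the handle. The test function is odd about the centre, hence of mean zero; each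
  bunch, of length n \<epsilon>, contributes only to the norm.\<close>

lemma eigenvalue_dumbbell_le:
  assumes \<omega>: "0 < \<omega>" "\<omega> * D < pi" and a: "a = D / 2 - \<epsilon>"
  shows "mg_eigenvalue (dumbbell D \<epsilon> n) 2 \<le> \<omega>\<^sup>2 * (a + sin (2 * \<omega> * a) / (2 * \<omega>)) /
    (a - sin (2 * \<omega> * a) / (2 * \<omega>) + 2 * real n * \<epsilon> * (sin (\<omega> * a))\<^sup>2)"
proof -
  let ?G = "dumbbell D \<epsilon> n"
  have a0: "0 < a" "2 * a = D - 2 * \<epsilon>" using \<epsilon> a by auto
  \<comment> \<open>Clamping the height to [\<epsilon>, D - \<epsilon>] makes the function constant
    on the bunches, and as a function of the height it inherits compatibility with gluing.\<close>
  define f where "f = (\<lambda>x :: nat \<times> real. sin (\<omega> * (max \<epsilon> (min (D - \<epsilon>) (height D \<epsilon> n x)) - D / 2)))"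
  define f' where "f' = (\<lambda>x :: nat \<times> real. if fst x = 0 then \<omega> * cos (\<omega> * (snd x - a)) else 0)"
  have f_at: "f (e, t) = (if e = 0 then sin (\<omega> * (t - a)) else if e \<le> n then - sin (\<omega> * a) else sin (\<omega> * a))"
    if "t \<in> {0..len ?G e}" for e t
  proof -
    have "max \<epsilon> (min (D - \<epsilon>) (height D \<epsilon> n (e, t))) = (if e = 0 then \<epsilon> + t else if e \<le> n then \<epsilon> else D - \<epsilon>)"
      using that \<epsilon> by (auto simp: height_def)
    moreover have "\<omega> * (\<epsilon> + t - D / 2) = \<omega> * (t - a)" "\<omega> * (\<epsilon> - D / 2) = - (\<omega> * a)" "\<omega> * (D - \<epsilon> - D / 2) = \<omega> * a"
      using a by (auto simp: algebra_simps)
    ultimately show ?thesis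
      unfolding f_def by (cases "e = 0"; cases "e \<le> n"; simp only: sin_minus if_True if_False simp_thms)
  qed
  have H1: "H1_graph ?G f f'"
    unfolding H1_graph_def H1_interval_iff
  proof (intro conjI ballI impI)
    show "f x = f y" if "glued ?G x y" for x y
      using height_glued[OF that] by (simp add: f_def)
    fix e
    have AC: "AC_on 0 (len ?G e) (\<lambda>t. if e = 0 then sin (\<omega> * (t - a)) else if e \<le> n then - sin (\<omega> * a) else sin (\<omega> * a)) (\<lambda>t. f' (e, t))"
      by (cases "e = 0") (auto simp: f'_def intro!: AC_on_C1 continuous_intros derivative_eq_intros)
    show "AC_on 0 (len ?G e) (\<lambda>t. f (e, t)) (\<lambda>t. f' (e, t))"
    proof (rule AC_on_cong[OF _ _ AC])
      show "0 \<le> len ?G e" using \<epsilon> by simp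
    qed (rule f_at[symmetric])
    show "set_integrable lborel {0..len ?G e} (\<lambda>t. (f' (e, t))\<^sup>2)"
      by (cases "e = 0") (auto simp: f'_def intro!: borel_integrable_atLeastAtMost' continuous_intros)
  qed
  have FTC: "(LBINT t:{0..2 * a}. v t) = V (2 * a) - V 0"
    if "\<And>t. (V has_real_derivative v t) (at t)" "continuous_on UNIV v" for v V
    using that a0 by (intro AC_on_diff_eq[of 0 "2 * a"] AC_on_C1)
      (auto intro: has_field_derivative_at_within continuous_on_subset)
  have const: "(LBINT t:{0..\<epsilon>}. c) = \<epsilon> * c" for c :: real
    using \<epsilon> by (simp add: set_lebesgue_integral_def)
  have int_f: "(LBINT t:{0..len ?G e}. \<Phi> (f (e, t))) =
      (if e = 0 then LBINT t:{0..2 * a}. \<Phi> (sin (\<omega> * (t - a))) else if e \<le> n then \<epsilon> * \<Phi> (- sin (\<omega> * a)) else \<epsilon> * \<Phi> (sin (\<omega> * a)))"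
    for e and \<Phi> :: "real \<Rightarrow> real"
  proof -
    have "(LBINT t:{0..len ?G e}. \<Phi> (f (e, t))) =
        (LBINT t:{0..len ?G e}. \<Phi> (if e = 0 then sin (\<omega> * (t - a)) else if e \<le> n then - sin (\<omega> * a) else sin (\<omega> * a)))"
      by (intro set_lebesgue_integral_cong) (auto simp: f_at simp del: dumbbell_simps(2))
    then show ?thesis using const by (auto simp: a0)
  qed
  have i0: "(LBINT t:{0..2 * a}. sin (\<omega> * (t - a))) = 0"
  proof -
    have "(LBINT t:{0..2 * a}. sin (\<omega> * (t - a))) = - cos (\<omega> * (2 * a - a)) / \<omega> - - cos (\<omega> * (0 - a)) / \<omega>"
      by (rule FTC) (use \<omega> in \<open>auto intro!: derivative_eq_intros continuous_intros\<close>)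
    then show ?thesis by simp
  qed
  have i1: "(LBINT t:{0..2 * a}. sin (\<omega> * (t - a)) * sin (\<omega> * (t - a))) = a - sin (2 * \<omega> * a) / (2 * \<omega>)"
  proof -
    have "(LBINT t:{0..2 * a}. sin (\<omega> * (t - a)) * sin (\<omega> * (t - a))) =
        ((2 * a) / 2 - sin (2 * (\<omega> * (2 * a - a))) / (4 * \<omega>)) - (0 / 2 - sin (2 * (\<omega> * (0 - a))) / (4 * \<omega>))"
    proof (rule FTC)
      fix t
      have "((\<lambda>t. t / 2 - sin (2 * (\<omega> * (t - a))) / (4 * \<omega>)) has_real_derivative 1 / 2 - cos (2 * (\<omega> * (t - a))) / 2) (at t)"
        using \<omega> by (auto intro!: derivative_eq_intros)
      then show "((\<lambda>t. t / 2 - sin (2 * (\<omega> * (t - a))) / (4 * \<omega>)) has_real_derivative sin (\<omega> * (t - a)) * sin (\<omega> * (t - a))) (at t)"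
        unfolding cos_double_sin by (simp add: power2_eq_square diff_divide_distrib)
    qed (intro continuous_intros)
    also have "\<dots> = a - sin (2 * \<omega> * a) / (2 * \<omega>)"
      using \<omega> by (simp add: field_simps)
    finally show ?thesis .
  qed
  have i2: "(LBINT t:{0..2 * a}. (\<omega> * cos (\<omega> * (t - a))) * (\<omega> * cos (\<omega> * (t - a)))) = \<omega>\<^sup>2 * (a + sin (2 * \<omega> * a) / (2 * \<omega>))"
  proof -
    have "(LBINT t:{0..2 * a}. (\<omega> * cos (\<omega> * (t - a))) * (\<omega> * cos (\<omega> * (t - a)))) =
        \<omega>\<^sup>2 * ((2 * a) / 2 + sin (2 * (\<omega> * (2 * a - a))) / (4 * \<omega>)) - \<omega>\<^sup>2 * (0 / 2 + sin (2 * (\<omega> * (0 - a))) / (4 * \<omega>))"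
    proof (rule FTC)
      fix t
      have "((\<lambda>t. \<omega>\<^sup>2 * (t / 2 + sin (2 * (\<omega> * (t - a))) / (4 * \<omega>))) has_real_derivative \<omega>\<^sup>2 * (1 / 2 + cos (2 * (\<omega> * (t - a))) / 2)) (at t)"
        using \<omega> by (auto intro!: derivative_eq_intros)
      then show "((\<lambda>t. \<omega>\<^sup>2 * (t / 2 + sin (2 * (\<omega> * (t - a))) / (4 * \<omega>))) has_real_derivative \<omega> * cos (\<omega> * (t - a)) * (\<omega> * cos (\<omega> * (t - a)))) (at t)"
        unfolding cos_double_cos by (simp add: power2_eq_square mult_ac diff_divide_distrib)
    qed (intro continuous_intros)
    also have "\<dots> = \<omega>\<^sup>2 * (a + sin (2 * \<omega> * a) / (2 * \<omega>))"
      using \<omega> by (simp add: field_simps)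
    finally show ?thesis .
  qed
  have mean: "mg_integral ?G f = 0"
    using sum_dumbbell[of 0 n "\<epsilon> * - sin (\<omega> * a)" "\<epsilon> * sin (\<omega> * a)"] int_f[of _ "\<lambda>x. x"] i0
    by (simp add: mg_integral_def cong: if_cong)
  have ff: "mg_inner ?G f f = a - sin (2 * \<omega> * a) / (2 * \<omega>) + 2 * real n * \<epsilon> * (sin (\<omega> * a))\<^sup>2"
    using sum_dumbbell[of "a - sin (2 * \<omega> * a) / (2 * \<omega>)" n "\<epsilon> * (sin (\<omega> * a) * sin (\<omega> * a))" "\<epsilon> * (sin (\<omega> * a) * sin (\<omega> * a))"]
      int_f[of _ "\<lambda>x. x * x"] i1
    by (simp add: mg_inner_def mg_integral_def power2_eq_square cong: if_cong)
  have "(LBINT t:{0..len ?G e}. f' (e, t) * f' (e, t)) = (if e = 0 then \<omega>\<^sup>2 * (a + sin (2 * \<omega> * a) / (2 * \<omega>)) else if e \<le> n then 0 else 0)" for e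
    using i2 a0 by (simp add: f'_def)
  then have ff': "mg_inner ?G f' f' = \<omega>\<^sup>2 * (a + sin (2 * \<omega> * a) / (2 * \<omega>))"
    using sum_dumbbell[of "\<omega>\<^sup>2 * (a + sin (2 * \<omega> * a) / (2 * \<omega>))" n 0 0]
    by (simp add: mg_inner_def mg_integral_def)
  have "0 < total_length ?G" using total_length_dumbbell \<epsilon> n by (simp add: add_pos_nonneg)
  from mg_eigenvalue_2_variational[OF compact_dumbbell this] H1 mean
  have "mg_eigenvalue ?G 2 * mg_inner ?G f f \<le> mg_inner ?G f' f'" by blast
  moreover have "0 < mg_inner ?G f f"
  proof -
    have "\<omega> * a < pi" using \<omega> a0 \<epsilon> a by (smt (verit) mult_strict_left_mono)
    then have "0 < sin (\<omega> * a)" using \<omega> a0 by (intro sin_gt_zero) auto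
    then have "0 < 2 * real n * \<epsilon> * (sin (\<omega> * a))\<^sup>2" using n \<epsilon> by simp
    moreover have "sin (2 * \<omega> * a) / (2 * \<omega>) \<le> a"
      using sin_x_le_x[of "2 * \<omega> * a"] \<omega> a0 by (simp add: field_simps)
    ultimately show ?thesis unfolding ff by linarith
  qed
  ultimately show ?thesis unfolding ff[symmetric] ff'[symmetric] by (simp add: pos_le_divide_eq)
qed

end

text \<open>The strict lower bound holds for every dumbbell, so only the upper bounds have to
  converge to \<omega>^2.\<close>

lemma dumbbell_sequence:
  fixes L D \<omega> :: real
  assumes D: "0 < D" "D < L" and \<omega>: "0 < \<omega>" "\<omega> * D < pi"
    and eq: "cos (\<omega> * D / 2) = \<omega> * (L - D) / 2 * sin (\<omega> * D / 2)"
  shows "\<exists>\<D> :: nat \<Rightarrow> (nat, nat) metric_graph.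
            (\<forall>n. compact_metric_graph (\<D> n) \<and> mg_connected (\<D> n) \<and>
                 total_length (\<D> n) = L \<and> mg_diameter (\<D> n) = D) \<and>
            (\<lambda>n. mg_eigenvalue (\<D> n) 2) \<longlonglongrightarrow> \<omega>\<^sup>2"
proof -
  obtain k :: nat where k: "(L - D) / D < real k" using reals_Archimedean2 by blast
  define N where "N m = k + m + 1" for m :: nat
  \<comment> \<open>Solves D - 2 \<epsilon> + 2 N \<epsilon> = L: the handle gives up 2 \<epsilon>
    to keep the diameter D. The shift of N by k ensures 2 \<epsilon> < D from the first graph
    on.\<close>
  define \<epsilon> where "\<epsilon> m = (L - D) / (2 * real (N m - 1))" for m
  have "0 < (L - D) / D" using D by simp
  then have "0 < real k" using k by linarith
  then have k0: "0 < k" by simp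
  have \<epsilon>0: "0 < \<epsilon> m" "2 * \<epsilon> m < D" for m
  proof -
    show "0 < \<epsilon> m" using D k0 by (simp add: \<epsilon>_def N_def)
    have "L - D < D * real k" using k D by (simp add: field_simps)
    also have "\<dots> \<le> D * (real k + real m)" using D by (intro mult_left_mono) auto
    finally show "2 * \<epsilon> m < D" using k0 by (simp add: \<epsilon>_def N_def field_simps)
  qed
  have N0: "0 < N m" for m by (simp add: N_def)
  have N\<epsilon>: "2 * real (N m) * \<epsilon> m = L - D + 2 * \<epsilon> m" for m
    using k0 by (simp add: \<epsilon>_def N_def field_simps)
  define \<D> where "\<D> m = dumbbell D (\<epsilon> m) (N m)" for m
  have props: "compact_metric_graph (\<D> m)" "mg_connected (\<D> m)" "total_length (\<D> m) = L" "mg_diameter (\<D> m) = D" for m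
    unfolding \<D>_def
  proof -
    show "compact_metric_graph (dumbbell D (\<epsilon> m) (N m))" by (rule compact_dumbbell[OF \<epsilon>0 N0])
    show "mg_connected (dumbbell D (\<epsilon> m) (N m))" by (rule connected_dumbbell[OF \<epsilon>0 N0])
    show "total_length (dumbbell D (\<epsilon> m) (N m)) = L" unfolding total_length_dumbbell[OF \<epsilon>0 N0] using N\<epsilon>[of m] by linarith
    show "mg_diameter (dumbbell D (\<epsilon> m) (N m)) = D" by (rule diameter_dumbbell[OF \<epsilon>0 N0])
  qed
  define a where "a m = D / 2 - \<epsilon> m" for m
  define R where "R m = \<omega>\<^sup>2 * (a m + sin (2 * \<omega> * a m) / (2 * \<omega>)) /
    (a m - sin (2 * \<omega> * a m) / (2 * \<omega>) + (L - D + 2 * \<epsilon> m) * (sin (\<omega> * a m))\<^sup>2)" for m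
  have upper: "mg_eigenvalue (\<D> m) 2 \<le> R m" for m
    unfolding R_def \<D>_def N\<epsilon>[symmetric] by (rule eigenvalue_dumbbell_le[OF \<epsilon>0 N0 \<omega> a_def])
  have lower: "\<omega>\<^sup>2 < mg_eigenvalue (\<D> m) 2" for m
    by (rule spectral_gap_gt[OF props D \<omega> eq])
  have "filterlim (\<lambda>m. real (k + m)) at_top sequentially"
    by (intro filterlim_compose[OF filterlim_real_sequentially] filterlim_add_const_nat_at_top[of k, unfolded add.commute[of _ k]])
  then have "\<epsilon> \<longlonglongrightarrow> 0"
    unfolding \<epsilon>_def N_def
    by (intro real_tendsto_divide_at_top[of _ "L - D"] filterlim_tendsto_pos_mult_at_top[of _ 2]) auto
  then have a_lim: "a \<longlonglongrightarrow> D / 2" and \<epsilon>_lim: "\<epsilon> \<longlonglongrightarrow> 0"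
    unfolding a_def using tendsto_diff[OF tendsto_const[of "D / 2"], of \<epsilon> 0] by auto
  define S where "S = sin (2 * \<omega> * (D / 2)) / (2 * \<omega>)"
  \<comment> \<open>Here the equation for \<omega> enters: the mass term in the limit is 2 S, so
    numerator and denominator of the quotient agree up to the factor \<omega>^2.\<close>
  have S: "(L - D) * (sin (\<omega> * (D / 2)))\<^sup>2 = 2 * S"
  proof -
    define X where "X = \<omega> * (D / 2)"
    have c: "cos X = \<omega> * (L - D) / 2 * sin X" using eq by (simp add: X_def)
    have "S = sin (2 * X) / (2 * \<omega>)" by (simp add: S_def X_def)
    also have "\<dots> = sin X * cos X / \<omega>" by (simp add: sin_double)
    also have "\<dots> = (L - D) / 2 * (sin X)\<^sup>2" unfolding c using \<omega> by (simp add: power2_eq_square)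
    finally show ?thesis by (simp add: X_def)
  qed
  have "0 < S" unfolding S_def using \<omega> D by (intro divide_pos_pos sin_gt_zero) auto
  have den: "D / 2 - S + (L - D + 2 * 0) * (sin (\<omega> * (D / 2)))\<^sup>2 = D / 2 + S"
    using S by simp
  have "R \<longlonglongrightarrow> \<omega>\<^sup>2 * (D / 2 + S) / (D / 2 - S + (L - D + 2 * 0) * (sin (\<omega> * (D / 2)))\<^sup>2)"
  proof -
    have "D / 2 - S + (L - D + 2 * 0) * (sin (\<omega> * (D / 2)))\<^sup>2 \<noteq> 0" unfolding den using \<open>0 < S\<close> D by simp
    then show ?thesis
      unfolding R_def S_def using \<omega> by (intro tendsto_intros a_lim \<epsilon>_lim) simp_all
  qed
  also have "\<omega>\<^sup>2 * (D / 2 + S) / (D / 2 - S + (L - D + 2 * 0) * (sin (\<omega> * (D / 2)))\<^sup>2) = \<omega>\<^sup>2"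
    unfolding den using \<open>0 < S\<close> D by simp
  finally have "R \<longlonglongrightarrow> \<omega>\<^sup>2" .
  have "(\<lambda>n. mg_eigenvalue (\<D> n) 2) \<longlonglongrightarrow> \<omega>\<^sup>2"
  proof (rule tendsto_sandwich[OF _ _ tendsto_const])
    show "\<forall>\<^sub>F n in sequentially. \<omega>\<^sup>2 \<le> mg_eigenvalue (\<D> n) 2"
      by (intro always_eventually allI less_imp_le lower)
    show "\<forall>\<^sub>F n in sequentially. mg_eigenvalue (\<D> n) 2 \<le> R n"
      by (intro always_eventually allI upper)
  qed (fact \<open>R \<longlonglongrightarrow> \<omega>\<^sup>2\<close>)
  with props show ?thesis by blast
qed

theorem theorem1p1:
  fixes L D \<omega> :: real
  assumes "0 < L" and "0 < D" and "D < L"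
    and "0 < \<omega>"
    and "cos (\<omega> * D / 2) = \<omega> * (L - D) / 2 * sin (\<omega> * D / 2)"
    and "\<And>w. 0 < w \<Longrightarrow> cos (w * D / 2) = w * (L - D) / 2 * sin (w * D / 2) \<Longrightarrow> \<omega> \<le> w"
  shows "(\<forall>G :: ('v, 'e) metric_graph.
            compact_metric_graph G \<and> mg_connected G \<and> total_length G = L \<and> mg_diameter G = D
              \<longrightarrow> \<omega>\<^sup>2 < mg_eigenvalue G 2) \<and>
         (1 / (L * D) < \<omega>\<^sup>2 \<and> \<omega>\<^sup>2 < 12 / (L * D)) \<and>
         (\<exists>\<D> :: nat \<Rightarrow> (nat, nat) metric_graph.
            (\<forall>n. compact_metric_graph (\<D> n) \<and> mg_connected (\<D> n) \<and>
                 total_length (\<D> n) = L \<and> mg_diameter (\<D> n) = D) \<and>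
            (\<lambda>n. mg_eigenvalue (\<D> n) 2) \<longlonglongrightarrow> \<omega>\<^sup>2)"
proof -
  \<comment> \<open>Minimality of \<omega> enters in this form: it selects the root in the first
    branch, where the cosine of \<omega> D / 2 is positive.\<close>
  have \<omega>D: "\<omega> * D < pi"
    by (rule smallest_root_less[OF assms(2,3,6)])
  have "\<omega>\<^sup>2 < mg_eigenvalue G 2"
    if "compact_metric_graph G \<and> mg_connected G \<and> total_length G = L \<and> mg_diameter G = D"
    for G :: "('v, 'e) metric_graph"
    using that by (intro spectral_gap_gt[OF _ _ _ _ assms(2-4) \<omega>D assms(5)]) auto
  then show ?thesis
    using root_bounds[OF assms(2-4) \<omega>D assms(5)] dumbbell_sequence[OF assms(2-4) \<omega>D assms(5)]
    by blast
qed

end
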